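(* Let $k\in\mathbb N_0^2\setminus\{0\}$, $a_k\in\mathbb C$, and let $\xi_k=a_ke_k+\overline{a_k}e_{-k}+(-1)^{k_2+1}\overline{a_k}e_{\bar k}+(-1)^{k_2+1}a_ke_{-\bar k}$ be nonzero. Then the normalized Ricci curvature of $\mathrm{SDiff}(\mathbb K)$ in the direction $\xi_k$ is $$\mathrm{Ric}(\xi_k)=-\frac{3\|k\|^2}{8S_{\mathbb T}}=-\frac{3\|k\|^2}{16S_{\mathbb K}}.$$
   Context: $\mathbb T=\mathbb R^2/(2\pi\mathbb Z)^2$ (area $S_{\mathbb T}=4\pi^2$), $I(x_1,x_2)=(2\pi-x_1,\pi+x_2)$, $\mathbb K=\mathbb T/I$ (area $S_{\mathbb K}=S_{\mathbb T}/2$). The Lie algebra of $\mathrm{SDiff}(\mathbb K)$ is identified with real smooth zero-mean $f$ on $\mathbb T$ with $f\circ I=-f$, bracket $\{f,g\}=\partial_{x_2}f\partial_{x_1}g-\partial_{x_1}f\partial_{x_2}g$, inner product $\langle f,g\rangle=\int_{\mathbb T}\nabla f\cdot\nabla g\,dx_1dx_2$; sectional curvature $C(u,v)=\langle R(u,v)u,v\rangle/(\langle u,u\rangle\langle v,v\rangle-\langle u,v\rangle^2)$ with $R(u,v)w=-\nabla_u\nabla_vw+\nabla_v\nabla_uw+\nabla_{\{u,v\}}w$, $\nabla_uv=\frac12(\{u,v\}-B(u,v)-B(v,u))$, $\langle B(u,v),w\rangle=\langle u,\{v,w\}\rangle$. Basis $\mathcal B$: with $J^{\Re}=\{l\in\mathbb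 N_0^2\mid l\neq(n,0),\ l\neq(0,2n)\ \forall n\in\mathbb N_0\}$, $J^{\Im}=\{l\in\mathbb N_0^2\mid l\neq(0,2n)\ \forall n\in\mathbb N_0\}$, $\mathcal B$ consists of $4\cos(l_1x_1)\cos(l_2x_2)$ ($l\in J^{\Re}$, $l_2$ odd), $4\cos(l_1x_1)\sin(l_2x_2)$ ($l\in J^{\Im}$, $l_2$ odd), $4\sin(l_1x_1)\sin(l_2x_2)$ ($l\in J^{\Re}$, $l_2$ even), $4\sin(l_1x_1)\cos(l_2x_2)$ ($l\in J^{\Im}$, $l_2$ even); each has Laplace eigenvalue $-\|l\|^2$. $\mathcal B_R$ is the set of elements of $\mathcal B$ with $\|l\|\le R$. Normalized Ricci curvature: $\mathrm{Ric}(\xi)=\lim_{R\to\infty}\frac{1}{|\mathcal B_R|-1}\sum_{\mathcal E\in\mathcal B_R,\ \mathcal E\notin\mathbb R\xi}C(\xi,\mathcal E)$ ($R$ running over positive integers). $e_k=e^{i(k_1x_1+k_2x_2)}$, $\bar k=(k_1,-k_2)$, $\|k\|^2=k_1^2+k_2^2$. *)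

theory Defs
  imports "HOL-Analysis.Analysis"
begin

type_synonym rfun = "real \<times> real \<Rightarrow> real"

definition S_T :: real where "S_T = 4 * pi ^ 2"
definition S_K :: real where "S_K = S_T / 2"

definition invI :: "real \<times> real \<Rightarrow> real \<times> real" where
  "invI x = (2 * pi - fst x, pi + snd x)"

definition d1 :: "rfun \<Rightarrow> rfun" where
  "d1 f x = deriv (\<lambda>t. f (t, snd x)) (fst x)"

definition d2 :: "rfun \<Rightarrow> rfun" where
  "d2 f x = deriv (\<lambda>t. f (fst x, t)) (snd x)"

fun pdiff :: "bool list \<Rightarrow> rfun \<Rightarrow> rfun" where
  "pdiff [] f = f"
| "pdiff (b # bs) f = (if b then d1 else d2) (pdiff bs f)"

definition smooth :: "rfun \<Rightarrow> bool" where
  "smooth f \<longleftrightarrow> (\<forall>bs x. pdiff bs f differentiable (at x))"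

definition torus_sq :: "(real \<times> real) set" where
  "torus_sq = cbox (0, 0) (2 * pi, 2 * pi)"

text \<open>The Lie algebra of SDiff(K): real smooth zero-mean functions on T (i.e. 2pi-periodic
  in both variables) with f o I = - f.\<close>
definition liealg :: "rfun set" where
  "liealg = {f. smooth f
      \<and> (\<forall>x1 x2. f (x1 + 2 * pi, x2) = f (x1, x2) \<and> f (x1, x2 + 2 * pi) = f (x1, x2))
      \<and> integral torus_sq f = 0
      \<and> (\<forall>x. f (invI x) = - f x)}"

definition bracket :: "rfun \<Rightarrow> rfun \<Rightarrow> rfun" where
  "bracket f g = (\<lambda>x. d2 f x * d1 g x - d1 f x * d2 g x)"

definition ip :: "rfun \<Rightarrow> rfun \<Rightarrow> real" where
  "ip f g = integral torus_sq (\<lambda>x. d1 f x * d1 g x + d2 f x * d2 g x)"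

definition Bop :: "rfun \<Rightarrow> rfun \<Rightarrow> rfun" where
  "Bop u v = (THE b. b \<in> liealg \<and> (\<forall>w\<in>liealg. ip b w = ip u (bracket v w)))"

definition conn :: "rfun \<Rightarrow> rfun \<Rightarrow> rfun" where
  "conn u v = (\<lambda>x. (1/2) * (bracket u v x - Bop u v x - Bop v u x))"

definition curv :: "rfun \<Rightarrow> rfun \<Rightarrow> rfun \<Rightarrow> rfun" where
  "curv u v w = (\<lambda>x. - conn u (conn v w) x + conn v (conn u w) x + conn (bracket u v) w x)"

definition sec_curv :: "rfun \<Rightarrow> rfun \<Rightarrow> real" where
  "sec_curv u v = ip (curv u v u) v / (ip u u * ip v v - (ip u v) ^ 2)"

definition J_Re :: "(nat \<times> nat) set" where
  "J_Re = {l. (\<forall>n. l \<noteq> (n, 0)) \<and> (\<forall>n. l \<noteq> (0, 2 * n))}"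

definition J_Im :: "(nat \<times> nat) set" where
  "J_Im = {l. \<forall>n. l \<noteq> (0, 2 * n)}"

definition bfun :: "nat \<Rightarrow> nat \<times> nat \<Rightarrow> rfun" where
  "bfun t l = (\<lambda>x.
     if t = 0 then 4 * cos (real (fst l) * fst x) * cos (real (snd l) * snd x)
     else if t = 1 then 4 * cos (real (fst l) * fst x) * sin (real (snd l) * snd x)
     else if t = 2 then 4 * sin (real (fst l) * fst x) * sin (real (snd l) * snd x)
     else 4 * sin (real (fst l) * fst x) * cos (real (snd l) * snd x))"

definition bvalid :: "nat \<Rightarrow> nat \<times> nat \<Rightarrow> bool" where
  "bvalid t l \<longleftrightarrow>
     (t = 0 \<and> l \<in> J_Re \<and> odd (snd l)) \<or>
     (t = 1 \<and> l \<in> J_Im \<and> odd (snd l)) \<or>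
     (t = 2 \<and> l \<in> J_Re \<and> even (snd l)) \<or>
     (t = 3 \<and> l \<in> J_Im \<and> even (snd l))"

definition lnorm :: "nat \<times> nat \<Rightarrow> real" where
  "lnorm l = sqrt (real (fst l) ^ 2 + real (snd l) ^ 2)"

definition basis_R :: "nat \<Rightarrow> rfun set" where
  "basis_R R = {bfun t l | t l. bvalid t l \<and> lnorm l \<le> real R}"

definition ric_seq :: "rfun \<Rightarrow> nat \<Rightarrow> real" where
  "ric_seq \<xi> R = (1 / (real (card (basis_R R)) - 1)) *
     (\<Sum>E \<in> basis_R R - {(\<lambda>x. c * \<xi> x) | c. True}. sec_curv \<xi> E)"

definition expk :: "int \<times> int \<Rightarrow> real \<times> real \<Rightarrow> complex" where
  "expk k x = exp (\<i> * complex_of_real (real_of_int (fst k) * fst x + real_of_int (snd k) * snd x))"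

text \<open>xi_k is real-valued (the four terms pair into complex conjugates); we take Re.\<close>
definition xi :: "nat \<times> nat \<Rightarrow> complex \<Rightarrow> rfun" where
  "xi k a = (\<lambda>x. let k1 = int (fst k); k2 = int (snd k); s = (-1) ^ (snd k + 1) in
     Re (a * expk (k1, k2) x + cnj a * expk (-k1, -k2) x
         + s * cnj a * expk (k1, -k2) x + s * a * expk (-k1, k2) x))"

end

theory Submission
  imports Defs
begin

text \<open>
  Trigonometric polynomials that are odd under \<open>I\<close> are closed under the bracket and under the inverse
  Laplacian, so \<open>B(u, v) = \<Delta>\<inverse>{\<Delta>u, v}\<close> there. For Laplace eigenfunctions \<open>u\<close>, \<open>v\<close> with
  eigenvalues \<open>-p\<close>, \<open>-q\<close> the curvature numerator is therefore a quadratic form in the Fourier modes of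
  \<open>w = {u, v}\<close>, where a mode of eigenvalue \<open>-r\<close>, \<open>r = p + q + 2\<sigma>\<close>, has weight
  \<open>-2\<sigma> - (p q - \<sigma>\<^sup>2) / r\<close>. The modes occur in pairs \<open>\<plusminus>\<sigma>\<close> of equal amplitude, so the large linear term
  cancels, up to an error that stays bounded on the \<open>O(R)\<close> many \<open>l\<close> in a strip along the axes. What remains
  tends to a quartic form in the direction of \<open>l\<close>.

  Its average over lattice points of a disc follows from the vanishing average of \<open>exp (4 i \<theta>)\<close>. Splitting
  the Gaussian integers into cosets of \<open>5\<close> and of \<open>3 + 4 i\<close> computes the sum \<open>Z(5 R)\<close> of \<open>exp (4 i \<theta>)\<close>
  over a disc in two ways, as \<open>25 Z(R)\<close> and as \<open>25 \<omega> Z(R)\<close> with \<open>\<omega> \<noteq> 1\<close>, up to \<open>o(R\<^sup>2)\<close>; hence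
  \<open>Z(R) = o(R\<^sup>2)\<close>.
\<close>

section \<open>Calculus on the torus\<close>

text \<open>A mode weight contains \<sigma>, which may be as large as |k| |l|, so a single mode can
  contribute an amount of order |l| to a curvature whose limit is bounded: everything rests on the
  exactness of the cancellation between paired modes. It fails only on the lines l1 = k1 and l2 =
  k2, and there a second algebraic cancellation still brings the linear part down to a bounded size.
  The constant comes from a mean value. For the angle \<theta> between \<open>k\<close> and
  \<open>l\<close>, the cross product \<open>D\<close> is |k| |l| sin \<theta> up to sign,
  \<open>D'\<close> is its analogue for the reflected \<open>l\<close>, and the curvature is
  asymptotically - (D^4 + D'^4) / (8 p pi^2 q^2). Since sin^4 has mean 3/8, the average is - 3 p /
  (32 pi^2), and 32 pi^2 is 8 times the area of the torus. The limit is proved as numerator - limit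
  * denominator = o(R^2) with a denominator of at least R^2 / 8, so that crude quadratic bounds on
  lattice counts suffice. \<open>Bop\<close> is defined by testing against all smooth elements of
  the Lie algebra, whereas its values are computed for trigonometric polynomials only; this is why
  two classes of functions appear side by side.\<close>

definition periodic :: "rfun \<Rightarrow> bool" where
  "periodic f \<longleftrightarrow>
     (\<forall>x y. f (x + 2 * pi, y) = f (x, y) \<and> f (x, y + 2 * pi) = f (x, y))"

text \<open>The class for integration by parts. The test functions in the definition of
  \<open>Bop\<close> range over all of \<open>liealg\<close>, so products with them leave the
  trigonometric polynomials and call for a larger class closed under products.\<close>

definition C1per :: "rfun \<Rightarrow> bool" where
  "C1per f \<longleftrightarrow> (\<forall>x. f differentiable (at x)) \<and> continuous_on UNIV (d1 f)
     \<and> continuous_on UNIV (d2 f) \<and> periodic f"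

lemma has_derivative_imp_DERIV_fst:
  fixes f :: rfun
  assumes "(f has_derivative f') (at (x, y))"
  shows "((\<lambda>t. f (t, y)) has_real_derivative f' (1, 0)) (at x)"
proof -
  have *: "((\<lambda>t. (t, y)) has_derivative (\<lambda>t. (t, 0))) (at x)"
    by (intro derivative_eq_intros) auto
  have **: "(f has_derivative f') (at ((\<lambda>t. (t, y)) x))"
    using assms by simp
  have "((\<lambda>t. f (t, y)) has_derivative (\<lambda>t. f' (t, 0))) (at x)"
    using has_derivative_compose[OF * **] by simp
  moreover have "(\<lambda>t. f' (t, 0)) = (*) (f' (1, 0))"
  proof (rule ext)
    show "f' (t, 0) = f' (1, 0) * t" for t
      using linear_scale[OF has_derivative_linear[OF assms], of t "(1, 0)"] by simp
  qed
  ultimately show ?thesis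
    by (simp only: has_field_derivative_def)
qed

lemma has_derivative_imp_DERIV_snd:
  fixes f :: rfun
  assumes "(f has_derivative f') (at (x, y))"
  shows "((\<lambda>t. f (x, t)) has_real_derivative f' (0, 1)) (at y)"
proof -
  have *: "((\<lambda>t. (x, t)) has_derivative (\<lambda>t. (0, t))) (at y)"
    by (intro derivative_eq_intros) auto
  have **: "(f has_derivative f') (at ((\<lambda>t. (x, t)) y))"
    using assms by simp
  have "((\<lambda>t. f (x, t)) has_derivative (\<lambda>t. f' (0, t))) (at y)"
    using has_derivative_compose[OF * **] by simp
  moreover have "(\<lambda>t. f' (0, t)) = (*) (f' (0, 1))"
  proof (rule ext)
    show "f' (0, t) = f' (0, 1) * t" for t
      using linear_scale[OF has_derivative_linear[OF assms], of t "(0, 1)"] by simp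
  qed
  ultimately show ?thesis
    by (simp only: has_field_derivative_def)
qed

lemma d1_eqI:
  assumes "((\<lambda>t. f (t, snd x)) has_real_derivative D) (at (fst x))"
  shows "d1 f x = D"
  unfolding d1_def by (rule DERIV_imp_deriv[OF assms])

lemma d2_eqI:
  assumes "((\<lambda>t. f (fst x, t)) has_real_derivative D) (at (snd x))"
  shows "d2 f x = D"
  unfolding d2_def by (rule DERIV_imp_deriv[OF assms])

lemma has_derivative_imp_partials:
  assumes "(f has_derivative f') (at x)"
  shows "d1 f x = f' (1, 0)" "d2 f x = f' (0, 1)"
  using assms d1_eqI[OF has_derivative_imp_DERIV_fst[of f f' "fst x" "snd x"]]
    d2_eqI[OF has_derivative_imp_DERIV_snd[of f f' "fst x" "snd x"]]
  by simp_all

lemma has_derivative_partials: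
  assumes "f differentiable (at x)"
  shows "(f has_derivative (\<lambda>h. d1 f x * fst h + d2 f x * snd h)) (at x)"
proof -
  obtain f' where f': "(f has_derivative f') (at x)"
    using assms by (auto simp: differentiable_def)
  have lin: "linear f'"
    using f' by (rule has_derivative_linear)
  have "f' h = d1 f x * fst h + d2 f x * snd h" for h
  proof -
    have "f' h = f' (fst h *\<^sub>R (1, 0) + snd h *\<^sub>R (0, 1))"
      by (cases h) simp
    also have "\<dots> = fst h * f' (1, 0) + snd h * f' (0, 1)"
      by (simp only: linear_add[OF lin] linear_scale[OF lin] real_scaleR_def)
    finally show ?thesis
      by (simp add: has_derivative_imp_partials[OF f'])
  qed
  then have "f' = (\<lambda>h. d1 f x * fst h + d2 f x * snd h)"
    by blast
  then show ?thesis
    using f' by simp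
qed

lemma DERIV_d1:
  assumes "f differentiable (at x)"
  shows "((\<lambda>t. f (t, snd x)) has_real_derivative d1 f x) (at (fst x))"
  using has_derivative_imp_DERIV_fst[of f "\<lambda>h. d1 f x * fst h + d2 f x * snd h" "fst x" "snd x"]
    has_derivative_partials[OF assms]
  by simp

lemma DERIV_d2:
  assumes "f differentiable (at x)"
  shows "((\<lambda>t. f (fst x, t)) has_real_derivative d2 f x) (at (snd x))"
  using has_derivative_imp_DERIV_snd[of f "\<lambda>h. d1 f x * fst h + d2 f x * snd h" "fst x" "snd x"]
    has_derivative_partials[OF assms]
  by simp

lemma partials_add:
  assumes "\<And>x. f differentiable (at x)" "\<And>x. g differentiable (at x)"
  shows "d1 (\<lambda>x. f x + g x) = (\<lambda>x. d1 f x + d1 g x)"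
    and "d2 (\<lambda>x. f x + g x) = (\<lambda>x. d2 f x + d2 g x)"
  subgoal by (rule ext, rule d1_eqI, rule DERIV_add[OF DERIV_d1 DERIV_d1, OF assms])
  subgoal by (rule ext, rule d2_eqI, rule DERIV_add[OF DERIV_d2 DERIV_d2, OF assms])
  done

lemma partials_diff:
  assumes "\<And>x. f differentiable (at x)" "\<And>x. g differentiable (at x)"
  shows "d1 (\<lambda>x. f x - g x) = (\<lambda>x. d1 f x - d1 g x)"
    and "d2 (\<lambda>x. f x - g x) = (\<lambda>x. d2 f x - d2 g x)"
  subgoal by (rule ext, rule d1_eqI, rule DERIV_diff[OF DERIV_d1 DERIV_d1, OF assms])
  subgoal by (rule ext, rule d2_eqI, rule DERIV_diff[OF DERIV_d2 DERIV_d2, OF assms])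
  done

lemma partials_cmult:
  assumes "\<And>x. f differentiable (at x)"
  shows "d1 (\<lambda>x. c * f x) = (\<lambda>x. c * d1 f x)"
    and "d2 (\<lambda>x. c * f x) = (\<lambda>x. c * d2 f x)"
  subgoal by (rule ext, rule d1_eqI, rule DERIV_cmult[OF DERIV_d1, OF assms])
  subgoal by (rule ext, rule d2_eqI, rule DERIV_cmult[OF DERIV_d2, OF assms])
  done

lemma partials_mult:
  assumes "\<And>x. f differentiable (at x)" "\<And>x. g differentiable (at x)"
  shows "d1 (\<lambda>x. f x * g x) = (\<lambda>x. d1 f x * g x + f x * d1 g x)"
    and "d2 (\<lambda>x. f x * g x) = (\<lambda>x. d2 f x * g x + f x * d2 g x)"
proof -
  show "d1 (\<lambda>x. f x * g x) = (\<lambda>x. d1 f x * g x + f x * d1 g x)"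
    by (rule ext, rule d1_eqI) (use DERIV_mult[OF DERIV_d1 DERIV_d1, OF assms] in \<open>simp add: mult.commute\<close>)
  show "d2 (\<lambda>x. f x * g x) = (\<lambda>x. d2 f x * g x + f x * d2 g x)"
    by (rule ext, rule d2_eqI) (use DERIV_mult[OF DERIV_d2 DERIV_d2, OF assms] in \<open>simp add: mult.commute\<close>)
qed

lemma C1perD:
  assumes "C1per f"
  shows "f differentiable (at x)" "continuous_on A f" "continuous_on A (d1 f)"
    "continuous_on A (d2 f)" "periodic f"
proof -
  show *: "f differentiable (at x)" for x
    using assms unfolding C1per_def by blast
  then have "continuous_on UNIV f"
    by (simp add: continuous_at_imp_continuous_on differentiable_imp_continuous_within)
  then show "continuous_on A f" "continuous_on A (d1 f)" "continuous_on A (d2 f)" "periodic f"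
    using assms by (auto simp: C1per_def intro: continuous_on_subset)
qed

lemma C1per_add:
  assumes "C1per f" "C1per g"
  shows "C1per (\<lambda>x. f x + g x)"
proof -
  note f = C1perD[OF assms(1)] and g = C1perD[OF assms(2)]
  have "periodic (\<lambda>x. f x + g x)"
    using f(5) g(5) by (simp add: periodic_def)
  then show ?thesis
    by (simp add: C1per_def partials_add f g differentiable_add continuous_on_add)
qed

lemma C1per_diff:
  assumes "C1per f" "C1per g"
  shows "C1per (\<lambda>x. f x - g x)"
proof -
  note f = C1perD[OF assms(1)] and g = C1perD[OF assms(2)]
  have "periodic (\<lambda>x. f x - g x)"
    using f(5) g(5) by (simp add: periodic_def)
  then show ?thesis
    by (simp add: C1per_def partials_diff f g differentiable_diff continuous_on_diff)
qed

lemma C1per_mult: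
  assumes "C1per f" "C1per g"
  shows "C1per (\<lambda>x. f x * g x)"
proof -
  note f = C1perD[OF assms(1)] and g = C1perD[OF assms(2)]
  have "periodic (\<lambda>x. f x * g x)"
    using f(5) g(5) by (simp add: periodic_def)
  then show ?thesis
    by (simp add: C1per_def partials_mult f g differentiable_mult continuous_on_add
        continuous_on_mult)
qed

lemma C1per_cmult:
  assumes "C1per f"
  shows "C1per (\<lambda>x. c * f x)"
proof -
  note f = C1perD[OF assms]
  have "periodic (\<lambda>x. c * f x)"
    using f(5) by (simp add: periodic_def)
  then show ?thesis
    by (simp add: C1per_def partials_cmult f differentiable_mult continuous_on_mult_left)
qed

section \<open>Integration over the torus\<close>

abbreviation tint :: "rfun \<Rightarrow> real" where
  "tint f \<equiv> integral torus_sq f"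

lemma integrable_torus: "continuous_on UNIV f \<Longrightarrow> f integrable_on torus_sq" for f :: rfun
  unfolding torus_sq_def by (rule integrable_continuous) (rule continuous_on_subset, auto)

lemma tint_add:
  "continuous_on UNIV f \<Longrightarrow> continuous_on UNIV g \<Longrightarrow> tint (\<lambda>x. f x + g x) = tint f + tint g"
  by (intro integral_add integrable_torus)

lemma tint_diff:
  "continuous_on UNIV f \<Longrightarrow> continuous_on UNIV g \<Longrightarrow> tint (\<lambda>x. f x - g x) = tint f - tint g"
  by (intro integral_diff integrable_torus)

lemma tint_cmult: "tint (\<lambda>x. c * f x) = c * tint f"
  by simp

lemma content_torus: "measure lborel torus_sq = 4 * pi\<^sup>2"
  unfolding torus_sq_def by (simp add: content_Pair power2_eq_square)

lemma tint_const: "tint (\<lambda>x. c) = 4 * pi\<^sup>2 * c"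
  using content_torus unfolding torus_sq_def by simp

lemma tint_abs_le:
  assumes "continuous_on UNIV f" "\<And>x. \<bar>f x\<bar> \<le> K"
  shows "\<bar>tint f\<bar> \<le> 4 * pi\<^sup>2 * K"
proof -
  have "0 \<le> K"
    using assms(2)[of "(0, 0)"] by linarith
  then have "norm (tint f) \<le> K * measure lborel torus_sq"
    unfolding torus_sq_def
    by (rule integrable_bound) (use assms integrable_torus torus_sq_def in auto)
  then show ?thesis
    by (simp add: content_torus mult.commute)
qed

lemma tint_prod:
  assumes "continuous_on UNIV f" "continuous_on UNIV g"
  shows "tint (\<lambda>x. f (fst x) * g (snd x)) = integral {0..2*pi} f * integral {0..2*pi} g"
proof -
  have "tint (\<lambda>x. f (fst x) * g (snd x))
      = integral (cbox 0 (2*pi)) (\<lambda>x. integral (cbox 0 (2*pi)) (\<lambda>y. f x * g y))"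
    unfolding torus_sq_def
    by (subst integral_prod_continuous)
      (auto intro!: continuous_intros continuous_on_compose2[OF assms(1)]
        continuous_on_compose2[OF assms(2)])
  then show ?thesis
    by simp
qed

text \<open>Integrating first in the direction of the derivative leaves a boundary term that
  periodicity cancels; for \<open>d1\<close> the order of integration has to be swapped to get
  there.\<close>

lemma tint_d1:
  assumes "C1per f"
  shows "tint (d1 f) = 0"
proof -
  have "tint (d1 f) = integral (cbox 0 (2*pi)) (\<lambda>y. integral (cbox 0 (2*pi)) (\<lambda>x. d1 f (x, y)))"
    using integral_swap_continuous[of 0 0 "2*pi" "2*pi" "\<lambda>x y. d1 f (x, y)"]
      integral_prod_continuous[of 0 0 "2*pi" "2*pi" "d1 f"] C1perD(3)[OF assms]
    by (simp add: torus_sq_def)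
  also have "\<dots> = 0"
  proof -
    have "((\<lambda>x. d1 f (x, y)) has_integral (f (2*pi, y) - f (0, y))) {0..2*pi}" for y
    proof (rule fundamental_theorem_of_calculus)
      show "((\<lambda>x. f (x, y)) has_vector_derivative d1 f (x, y)) (at x within {0..2*pi})" for x
        using DERIV_d1[OF C1perD(1)[OF assms, of "(x, y)"]]
        by (auto simp: has_real_derivative_iff_has_vector_derivative
            intro: has_vector_derivative_at_within)
    qed simp
    moreover have "f (2*pi, y) = f (0, y)" for y
      using C1perD(5)[OF assms] unfolding periodic_def by (metis add_0)
    ultimately have "integral (cbox 0 (2*pi)) (\<lambda>x. d1 f (x, y)) = 0" for y
      by (simp add: integral_unique)
    then show ?thesis
      by simp
  qed
  finally show ?thesis .
qed

lemma tint_d2: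
  assumes "C1per f"
  shows "tint (d2 f) = 0"
proof -
  have "tint (d2 f) = integral (cbox 0 (2*pi)) (\<lambda>x. integral (cbox 0 (2*pi)) (\<lambda>y. d2 f (x, y)))"
    using integral_prod_continuous[of 0 0 "2*pi" "2*pi" "d2 f"] C1perD(4)[OF assms]
    by (simp add: torus_sq_def)
  also have "\<dots> = 0"
  proof -
    have "((\<lambda>y. d2 f (x, y)) has_integral (f (x, 2*pi) - f (x, 0))) {0..2*pi}" for x
    proof (rule fundamental_theorem_of_calculus)
      show "((\<lambda>y. f (x, y)) has_vector_derivative d2 f (x, y)) (at y within {0..2*pi})" for y
        using DERIV_d2[OF C1perD(1)[OF assms, of "(x, y)"]]
        by (auto simp: has_real_derivative_iff_has_vector_derivative
            intro: has_vector_derivative_at_within)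
    qed simp
    moreover have "f (x, 2*pi) = f (x, 0)" for x
      using C1perD(5)[OF assms] unfolding periodic_def by (metis add_0)
    ultimately have "integral (cbox 0 (2*pi)) (\<lambda>y. d2 f (x, y)) = 0" for x
      by (simp add: integral_unique)
    then show ?thesis
      by simp
  qed
  finally show ?thesis .
qed

lemma periodic_int:
  assumes "periodic f"
  shows "f (x + 2 * pi * of_int m, y + 2 * pi * of_int n) = f (x, y)"
proof -
  have nat1: "f (x + 2 * pi * real j, y) = f (x, y)" for x y j
  proof (induction j)
    case (Suc j)
    have "x + 2 * pi * real (Suc j) = (x + 2 * pi * real j) + 2 * pi"
      by (simp add: algebra_simps)
    then show ?case
      using assms Suc unfolding periodic_def by metis
  qed simp
  have nat2: "f (x, y + 2 * pi * real j) = f (x, y)" for x y j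
  proof (induction j)
    case (Suc j)
    have "y + 2 * pi * real (Suc j) = (y + 2 * pi * real j) + 2 * pi"
      by (simp add: algebra_simps)
    then show ?case
      using assms Suc unfolding periodic_def by metis
  qed simp
  have int1: "f (x + 2 * pi * of_int m, y) = f (x, y)" for x y m
  proof (cases m rule: int_cases2)
    case (nonpos j)
    then show ?thesis
      using nat1[of "x + 2 * pi * of_int m" j y] by simp
  qed (use nat1 in simp)
  have int2: "f (x, y + 2 * pi * of_int n) = f (x, y)" for x y n
  proof (cases n rule: int_cases2)
    case (nonpos j)
    then show ?thesis
      using nat2[of x "y + 2 * pi * of_int n" j] by simp
  qed (use nat2 in simp)
  show ?thesis
    by (simp add: int1 int2)
qed

text \<open>Carries the vanishing of a periodic function from the fundamental square to the plane,
  in \<open>ip_zero_imp_zero\<close>.\<close>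

lemma torus_representative:
  obtains m n :: int where "(x + 2 * pi * of_int m, y + 2 * pi * of_int n) \<in> torus_sq"
proof -
  have "\<exists>m::int. 0 \<le> x + 2 * pi * of_int m \<and> x + 2 * pi * of_int m \<le> 2 * pi" for x
  proof (rule exI[of _ "- \<lfloor>x / (2 * pi)\<rfloor>"])
    define z where "z = \<lfloor>x / (2 * pi)\<rfloor>"
    have "of_int z \<le> x / (2 * pi)" "x / (2 * pi) \<le> of_int z + 1"
      unfolding z_def by linarith+
    then have "of_int z * (2 * pi) \<le> x" "x \<le> (of_int z + 1) * (2 * pi)"
      by (simp_all add: pos_le_divide_eq pos_divide_le_eq)
    then show "0 \<le> x + 2 * pi * of_int (- \<lfloor>x / (2 * pi)\<rfloor>) \<and>
        x + 2 * pi * of_int (- \<lfloor>x / (2 * pi)\<rfloor>) \<le> 2 * pi"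
      unfolding z_def[symmetric] by (simp add: algebra_simps)
  qed
  from this[of x] this[of y] show ?thesis
    using that by (auto simp: torus_sq_def cbox_Pair_eq)
qed

section \<open>Trigonometric polynomials\<close>

text \<open>A free real phase merges sines and cosines into one family: differentiation adds pi/2 to
  the phase, and products of waves are again sums of waves.\<close>

definition wave :: "int \<Rightarrow> int \<Rightarrow> real \<Rightarrow> rfun" where
  "wave m n \<phi> = (\<lambda>x. cos (of_int m * fst x + of_int n * snd x + \<phi>))"

inductive_set trig :: "rfun set" where
  trig_wave: "wave m n \<phi> \<in> trig"
| trig_add: "f \<in> trig \<Longrightarrow> g \<in> trig \<Longrightarrow> (\<lambda>x. f x + g x) \<in> trig"
| trig_cmult: "f \<in> trig \<Longrightarrow> (\<lambda>x. c * f x) \<in> trig"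

lemma trig_diff:
  assumes "f \<in> trig" "g \<in> trig"
  shows "(\<lambda>x. f x - g x) \<in> trig"
  using trig_add[OF assms(1) trig_cmult[OF assms(2), of "-1"]] by simp

lemma trig_zero: "(\<lambda>x. 0) \<in> trig"
  using trig_cmult[OF trig_wave, of 0 0 0 0] by simp

lemma trig_mult_wave: "f \<in> trig \<Longrightarrow> (\<lambda>x. wave m n \<phi> x * f x) \<in> trig"
proof (induction rule: trig.induct)
  case (trig_wave m' n' \<phi>')
  have "(\<lambda>x. (1/2) * (wave (m - m') (n - n') (\<phi> - \<phi>') x
      + wave (m + m') (n + n') (\<phi> + \<phi>') x)) \<in> trig"
    by (intro trig.intros)
  also have "(\<lambda>x. (1/2) * (wave (m - m') (n - n') (\<phi> - \<phi>') x
      + wave (m + m') (n + n') (\<phi> + \<phi>') x)) = (\<lambda>x. wave m n \<phi> x * wave m' n' \<phi>' x)"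
    by (simp add: wave_def cos_times_cos algebra_simps add_divide_distrib)
  finally show ?case .
next
  case (trig_add f g)
  then show ?case
    using trig.trig_add by (simp add: distrib_left)
next
  case (trig_cmult f c)
  then show ?case
    using trig.trig_cmult[of "\<lambda>x. wave m n \<phi> x * f x" c] by (simp add: mult.left_commute)
qed

lemma trig_mult:
  assumes "f \<in> trig" "g \<in> trig"
  shows "(\<lambda>x. f x * g x) \<in> trig"
  using assms(1)
proof (induction rule: trig.induct)
  case (trig_wave m n \<phi>)
  then show ?case
    by (rule trig_mult_wave[OF assms(2)])
next
  case (trig_add f1 f2)
  then show ?case
    using trig.trig_add by (simp add: distrib_right)
next
  case (trig_cmult f c)
  then show ?case
    using trig.trig_cmult[of "\<lambda>x. f x * g x" c] by (simp add: mult.assoc)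
qed

lemma wave_has_derivative:
  "(wave m n \<phi> has_derivative
     (\<lambda>h. of_int m * wave m n (\<phi> + pi/2) x * fst h + of_int n * wave m n (\<phi> + pi/2) x * snd h)) (at x)"
proof -
  let ?y = "of_int m * fst x + of_int n * snd x + \<phi>"
  have "(wave m n \<phi> has_derivative (\<lambda>h. (of_int m * fst h + of_int n * snd h) * - sin ?y)) (at x)"
    unfolding wave_def by (auto intro!: derivative_eq_intros)
  moreover have "wave m n (\<phi> + pi/2) x = - sin ?y"
    using cos_add[of ?y "pi/2"] by (simp add: wave_def add.assoc)
  ultimately show ?thesis
    by (simp add: algebra_simps)
qed

lemma trig_differentiable: "f \<in> trig \<Longrightarrow> f differentiable (at x)"
proof (induction rule: trig.induct)
  case (trig_wave m n \<phi>)
  then show ?case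
    using wave_has_derivative by (blast intro: differentiableI)
qed (auto intro!: derivative_intros)

lemma partials_wave:
  "d1 (wave m n \<phi>) = (\<lambda>x. of_int m * wave m n (\<phi> + pi/2) x)"
  "d2 (wave m n \<phi>) = (\<lambda>x. of_int n * wave m n (\<phi> + pi/2) x)"
  using has_derivative_imp_partials[OF wave_has_derivative] by auto

lemma trig_partials: "f \<in> trig \<Longrightarrow> d1 f \<in> trig \<and> d2 f \<in> trig"
proof (induction rule: trig.induct)
  case (trig_wave m n \<phi>)
  then show ?case
    by (auto simp: partials_wave intro: trig.intros)
next
  case (trig_add f g)
  then show ?case
    by (auto simp: partials_add trig_differentiable intro: trig.intros)
next
  case (trig_cmult f c)
  then show ?case
    by (auto simp: partials_cmult trig_differentiable intro: trig.intros)
qed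

lemmas trig_d1 = conjunct1[OF trig_partials] and trig_d2 = conjunct2[OF trig_partials]

lemma trig_partials_commute: "f \<in> trig \<Longrightarrow> d1 (d2 f) = d2 (d1 f)"
proof (induction rule: trig.induct)
  case (trig_wave m n \<phi>)
  have "wave m n (\<phi> + pi/2) differentiable (at x)" for x
    by (intro trig_differentiable trig.intros)
  then show ?case
    by (simp add: partials_wave partials_cmult mult.left_commute)
next
  case (trig_add f g)
  then show ?case
    by (simp add: partials_add trig_differentiable trig_d1 trig_d2)
next
  case (trig_cmult f c)
  then show ?case
    by (simp add: partials_cmult trig_differentiable trig_d1 trig_d2)
qed

lemma trig_continuous: "f \<in> trig \<Longrightarrow> continuous_on A f"
  by (simp add: continuous_at_imp_continuous_on differentiable_imp_continuous_within
      trig_differentiable)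

lemma cos_int_shift: "cos (y + 2 * pi * of_int m) = cos y"
  by (simp add: cos_add cos_int_2pin sin_int_2pin)

lemma trig_periodic: "f \<in> trig \<Longrightarrow> periodic f"
proof (induction rule: trig.induct)
  case (trig_wave m n \<phi>)
  have "of_int m * (x + 2 * pi) + of_int n * y + \<phi> = (of_int m * x + of_int n * y + \<phi>) + 2 * pi * of_int m"
    "of_int m * x + of_int n * (y + 2 * pi) + \<phi> = (of_int m * x + of_int n * y + \<phi>) + 2 * pi * of_int n"
    for x y :: real
    by (simp_all add: algebra_simps)
  then show ?case
    by (simp only: periodic_def wave_def fst_conv snd_conv cos_int_shift simp_thms)
qed (auto simp: periodic_def)

lemma trig_C1per: "f \<in> trig \<Longrightarrow> C1per f"
  by (simp add: C1per_def trig_differentiable trig_continuous trig_d1 trig_d2 trig_periodic)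

lemma trig_bracket: "f \<in> trig \<Longrightarrow> g \<in> trig \<Longrightarrow> bracket f g \<in> trig"
  unfolding bracket_def by (intro trig_diff trig_mult trig_d1 trig_d2)

definition lap :: "rfun \<Rightarrow> rfun" where
  "lap f = (\<lambda>x. d1 (d1 f) x + d2 (d2 f) x)"

lemma trig_lap: "f \<in> trig \<Longrightarrow> lap f \<in> trig"
  unfolding lap_def by (intro trig_add trig_d1 trig_d2)

lemma lap_add: "f \<in> trig \<Longrightarrow> g \<in> trig \<Longrightarrow> lap (\<lambda>x. f x + g x) = (\<lambda>x. lap f x + lap g x)"
  by (auto simp: lap_def partials_add trig_differentiable trig_d1 trig_d2)

lemma lap_cmult: "f \<in> trig \<Longrightarrow> lap (\<lambda>x. c * f x) = (\<lambda>x. c * lap f x)"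
  by (auto simp: lap_def partials_cmult trig_differentiable trig_d1 trig_d2 distrib_left)

lemma lap_wave: "lap (wave m n \<phi>) = (\<lambda>x. - ((of_int m)\<^sup>2 + (of_int n)\<^sup>2) * wave m n \<phi> x)"
proof -
  have "wave m n (\<phi> + pi/2) differentiable (at x)" for x
    by (intro trig_differentiable trig.intros)
  moreover have "wave m n (\<phi> + pi/2 + pi/2) x = - wave m n \<phi> x" for x
    using cos_periodic_pi[of "of_int m * fst x + of_int n * snd x + \<phi>"]
    by (simp add: wave_def add.assoc)
  ultimately show ?thesis
    by (auto simp: lap_def partials_wave partials_cmult power2_eq_square algebra_simps)
qed

lemma tint_lap: "f \<in> trig \<Longrightarrow> tint (lap f) = 0"
  unfolding lap_def
  by (simp add: tint_add trig_continuous trig_d1 trig_d2 tint_d1 tint_d2 trig_C1per)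

section \<open>Anti-invariance and inversion of the Laplacian\<close>

definition antiinv :: "rfun \<Rightarrow> bool" where
  "antiinv f \<longleftrightarrow> (\<forall>x. f (invI x) = - f x)"

definition ktrig :: "rfun set" where
  "ktrig = {f \<in> trig. antiinv f}"

lemma ktrig_add: "f \<in> ktrig \<Longrightarrow> g \<in> ktrig \<Longrightarrow> (\<lambda>x. f x + g x) \<in> ktrig"
  and ktrig_diff: "f \<in> ktrig \<Longrightarrow> g \<in> ktrig \<Longrightarrow> (\<lambda>x. f x - g x) \<in> ktrig"
  and ktrig_cmult: "f \<in> ktrig \<Longrightarrow> (\<lambda>x. c * f x) \<in> ktrig"
  and ktrig_zero: "(\<lambda>x. 0) \<in> ktrig"
  by (auto simp: ktrig_def antiinv_def intro: trig_add trig_diff trig_cmult trig_zero)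

lemma ktrig_trig: "f \<in> ktrig \<Longrightarrow> f \<in> trig"
  by (simp add: ktrig_def)

text \<open>The involution reflects the first variable and translates the second, so only
  \<open>d1\<close> changes the sign. The general factor \<open>s\<close> makes the lemma applicable
  to \<open>f\<close> and, a second time, to its derivatives.\<close>

lemma partials_invI:
  assumes "\<And>x. f differentiable (at x)" "\<And>x. f (invI x) = s * f x"
  shows "d1 f (invI x) = - s * d1 f x" "d2 f (invI x) = s * d2 f x"
proof -
  have "f (t, snd (invI x)) = s * f (2 * pi - t, snd x)" for t
    using assms(2)[of "(2 * pi - t, snd x)"] by (simp add: invI_def)
  moreover have "((\<lambda>t. s * f (2 * pi - t, snd x)) has_real_derivative - s * d1 f x) (at (fst (invI x)))"
  proof -
    have 1: "((\<lambda>t. 2 * pi - t) has_real_derivative - 1) (at (fst (invI x)))"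
      by (auto intro!: derivative_eq_intros)
    have 2: "((\<lambda>t. f (t, snd x)) has_real_derivative d1 f x) (at (2 * pi - fst (invI x)))"
      using DERIV_d1[OF assms(1), of x] by (simp add: invI_def)
    show ?thesis
      using DERIV_cmult[OF DERIV_chain2[OF 2 1], of s] by simp
  qed
  ultimately show "d1 f (invI x) = - s * d1 f x"
    by (intro d1_eqI) simp
  have "f (fst (invI x), t) = s * f (fst x, t - pi)" for t
    using assms(2)[of "(fst x, t - pi)"] by (simp add: invI_def)
  moreover have "((\<lambda>t. s * f (fst x, t - pi)) has_real_derivative s * d2 f x) (at (snd (invI x)))"
  proof -
    have 1: "((\<lambda>t. t - pi) has_real_derivative 1) (at (snd (invI x)))"
      by (auto intro!: derivative_eq_intros)
    have 2: "((\<lambda>t. f (fst x, t)) has_real_derivative d2 f x) (at (snd (invI x) - pi))"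
      using DERIV_d2[OF assms(1), of x] by (simp add: invI_def)
    show ?thesis
      using DERIV_cmult[OF DERIV_chain2[OF 2 1], of s] by simp
  qed
  ultimately show "d2 f (invI x) = s * d2 f x"
    by (intro d2_eqI) simp
qed

text \<open>The factors \<open>1\<close> and \<open>- 1\<close> are kept visible so that these
  equations have the shape \<open>s * f x\<close> under which \<open>partials_invI\<close> applies
  to \<open>d1 f\<close> and \<open>d2 f\<close>.\<close>

lemma ktrig_partials_invI:
  assumes "f \<in> ktrig"
  shows "d1 f (invI x) = 1 * d1 f x" "d2 f (invI x) = - 1 * d2 f x"
proof -
  have f: "f differentiable (at y)" "f (invI y) = - 1 * f y" for y
    using assms by (simp_all add: ktrig_def antiinv_def trig_differentiable del: split_paired_All)
  show "d1 f (invI x) = 1 * d1 f x" "d2 f (invI x) = - 1 * d2 f x"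
    using partials_invI[OF f] by simp_all
qed

lemma ktrig_bracket:
  assumes "f \<in> ktrig" "g \<in> ktrig"
  shows "bracket f g \<in> ktrig"
proof -
  have "antiinv (bracket f g)"
    by (simp add: antiinv_def bracket_def ktrig_partials_invI assms)
  then show ?thesis
    using trig_bracket assms by (simp add: ktrig_def)
qed

lemma ktrig_lap:
  assumes "f \<in> ktrig"
  shows "lap f \<in> ktrig"
proof -
  note 1 = ktrig_partials_invI[OF assms]
  have f: "f \<in> trig"
    using assms by (rule ktrig_trig)
  have "d1 (d1 f) (invI x) = - d1 (d1 f) x" "d2 (d2 f) (invI x) = - d2 (d2 f) x" for x
    using partials_invI(1)[OF trig_differentiable[OF trig_d1[OF f]] 1(1)]
      partials_invI(2)[OF trig_differentiable[OF trig_d2[OF f]] 1(2)]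
    by simp_all
  then show ?thesis
    using trig_lap[OF f] by (simp add: ktrig_def antiinv_def lap_def)
qed

lemma wave_invI: "wave m n \<phi> (invI x) = wave (- m) n (\<phi> + pi * of_int n) x"
proof -
  have "of_int m * fst (invI x) + of_int n * snd (invI x) + \<phi>
    = (of_int (- m) * fst x + of_int n * snd x + (\<phi> + pi * of_int n)) + 2 * pi * of_int m"
    by (simp add: invI_def algebra_simps)
  then show ?thesis
    by (simp only: wave_def cos_int_shift)
qed

lemma invI_invI: "periodic f \<Longrightarrow> f (invI (invI x)) = f x"
  using periodic_int[of f "fst x" 0 "snd x" 1] by (simp add: invI_def add.commute)

text \<open>Anti-invariance of a sum does not pass to its summands, so an induction over
  \<open>trig\<close> cannot assume it. Every \<open>f\<close> has an antisymmetrization, which is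
  linear in \<open>f\<close>; for the constant mode it vanishes, so the eigenvalue 0 is never
  inverted.\<close>

lemma lap_preimage_antisymmetrization:
  "f \<in> trig \<Longrightarrow> \<exists>b \<in> ktrig. lap b = (\<lambda>x. (f x - f (invI x)) / 2)"
proof (induction rule: trig.induct)
  case (trig_wave m n \<phi>)
  show ?case
  proof (cases "m = 0 \<and> n = 0")
    case True
    then have "lap (\<lambda>x. 0) = (\<lambda>x. (wave m n \<phi> x - wave m n \<phi> (invI x)) / 2)"
      using lap_cmult[OF trig_zero, of 0] by (simp add: wave_def)
    then show ?thesis
      using ktrig_zero by blast
  next
    case False
    define r :: real where "r = (of_int m)\<^sup>2 + (of_int n)\<^sup>2"
    have r: "r \<noteq> 0"
      using False by (simp add: r_def sum_power2_eq_zero_iff)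
    \<comment> \<open>The involution sends the wave to one of frequency \<open>(- m, n)\<close>,
      which has the same eigenvalue \<open>- r\<close>; dividing the antisymmetrized wave by
      \<open>- r\<close> therefore inverts the Laplacian.\<close>
    define b where "b = (\<lambda>x. (- 1 / (2 * r)) * (wave m n \<phi> x + (- 1) * wave (- m) n (\<phi> + pi * of_int n) x))"
    have bt: "b \<in> trig"
      unfolding b_def by (intro trig.intros)
    have "wave (- m) n (\<phi> + pi * of_int n) (invI x) = wave m n \<phi> x" for x
      using wave_invI[of m n \<phi> "invI x"] invI_invI[OF trig_periodic[OF trig.trig_wave]] by simp
    then have "antiinv b"
      by (simp add: antiinv_def b_def wave_invI[of m n \<phi>] algebra_simps)
    moreover have "lap b = (\<lambda>x. (wave m n \<phi> x - wave m n \<phi> (invI x)) / 2)"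
      unfolding b_def
      by (subst lap_cmult, intro trig.intros, subst lap_add, (intro trig.intros)+,
          subst lap_cmult, intro trig.intros)
        (use r in \<open>auto simp: lap_wave wave_invI r_def[symmetric] field_simps\<close>)
    ultimately show ?thesis
      using bt by (auto simp: ktrig_def)
  qed
next
  case (trig_add f g)
  then obtain b b' where "b \<in> ktrig" "b' \<in> ktrig" "lap b = (\<lambda>x. (f x - f (invI x)) / 2)"
    "lap b' = (\<lambda>x. (g x - g (invI x)) / 2)"
    by blast
  then show ?case
    by (intro bexI[of _ "\<lambda>x. b x + b' x"] ktrig_add)
      (auto simp: lap_add ktrig_trig field_simps)
next
  case (trig_cmult f c)
  then obtain b where "b \<in> ktrig" "lap b = (\<lambda>x. (f x - f (invI x)) / 2)"
    by blast
  then show ?case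
    by (intro bexI[of _ "\<lambda>x. c * b x"] ktrig_cmult)
      (auto simp: lap_cmult ktrig_trig field_simps)
qed

lemma lap_preimage:
  assumes "f \<in> ktrig"
  obtains b where "b \<in> ktrig" "lap b = f"
proof -
  have "(\<lambda>x. (f x - f (invI x)) / 2) = f"
    using assms by (auto simp: ktrig_def antiinv_def)
  then show ?thesis
    using lap_preimage_antisymmetrization[of f] assms that by (auto simp: ktrig_def)
qed

lemma trig_pdiff: "f \<in> trig \<Longrightarrow> pdiff bs f \<in> trig"
  by (induction bs) (auto intro: trig_d1 trig_d2)

text \<open>The zero mean is the condition that takes an argument: \<open>f\<close> is a Laplacian,
  hence a divergence.\<close>

lemma ktrig_liealg:
  assumes "f \<in> ktrig"
  shows "f \<in> liealg"
proof -
  obtain b where "b \<in> ktrig" "lap b = f"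
    using lap_preimage[OF assms] .
  then have "tint f = 0"
    using tint_lap[of b] ktrig_trig by simp
  moreover have "smooth f"
    using assms by (auto simp: smooth_def ktrig_trig intro!: trig_differentiable trig_pdiff)
  ultimately show ?thesis
    using assms trig_periodic[of f]
    by (auto simp: liealg_def ktrig_def antiinv_def periodic_def)
qed

section \<open>The operator B and the curvature of eigenfunctions\<close>

lemma pdiff_append: "pdiff (bs @ cs) f = pdiff bs (pdiff cs f)"
  by (induction bs) auto

lemma smooth_partials:
  assumes "smooth f"
  shows "smooth (d1 f)" "smooth (d2 f)"
proof -
  have "pdiff bs (d1 f) = pdiff (bs @ [True]) f" "pdiff bs (d2 f) = pdiff (bs @ [False]) f" for bs
    by (simp_all add: pdiff_append)
  then show "smooth (d1 f)" "smooth (d2 f)"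
    using assms by (simp_all only: smooth_def simp_thms)
qed

lemma smooth_differentiable: "smooth f \<Longrightarrow> f differentiable (at x)"
  unfolding smooth_def by (metis pdiff.simps(1))

lemma smooth_continuous: "smooth f \<Longrightarrow> continuous_on A f"
  by (simp add: continuous_at_imp_continuous_on differentiable_imp_continuous_within
      smooth_differentiable)

lemma periodic_partials:
  assumes "smooth f" "periodic f"
  shows "periodic (d1 f)" "periodic (d2 f)"
proof -
  note d = smooth_differentiable[OF assms(1)]
  have p: "f (x + 2 * pi, y) = f (x, y)" "f (x, y + 2 * pi) = f (x, y)" for x y
    using assms(2) by (auto simp: periodic_def)
  have "((\<lambda>t. f (t, y)) has_real_derivative d1 f (x, y)) (at (x + 2 * pi))" for x y
  proof -
    have 1: "((\<lambda>t. t - 2 * pi) has_real_derivative 1) (at (x + 2 * pi))"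
      by (auto intro!: derivative_eq_intros)
    have 2: "((\<lambda>t. f (t, y)) has_real_derivative d1 f (x, y)) (at ((x + 2 * pi) - 2 * pi))"
      using DERIV_d1[OF d, of "(x, y)"] by simp
    show ?thesis
      using DERIV_chain2[OF 2 1] p(1)[of "_ - 2 * pi" y] by simp
  qed
  moreover have "((\<lambda>t. f (t, y + 2 * pi)) has_real_derivative d1 f (x, y)) (at x)" for x y
    using DERIV_d1[OF d, of "(x, y)"] by (simp add: p)
  ultimately show "periodic (d1 f)"
    by (auto simp: periodic_def intro!: d1_eqI)
  have "((\<lambda>t. f (x, t)) has_real_derivative d2 f (x, y)) (at (y + 2 * pi))" for x y
  proof -
    have 1: "((\<lambda>t. t - 2 * pi) has_real_derivative 1) (at (y + 2 * pi))"
      by (auto intro!: derivative_eq_intros)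
    have 2: "((\<lambda>t. f (x, t)) has_real_derivative d2 f (x, y)) (at ((y + 2 * pi) - 2 * pi))"
      using DERIV_d2[OF d, of "(x, y)"] by simp
    show ?thesis
      using DERIV_chain2[OF 2 1] p(2)[of x "_ - 2 * pi"] by simp
  qed
  moreover have "((\<lambda>t. f (x + 2 * pi, t)) has_real_derivative d2 f (x, y)) (at y)" for x y
    using DERIV_d2[OF d, of "(x, y)"] by (simp add: p)
  ultimately show "periodic (d2 f)"
    by (auto simp: periodic_def intro!: d2_eqI)
qed

lemma smooth_C1per: "smooth f \<Longrightarrow> periodic f \<Longrightarrow> C1per f"
  by (simp add: C1per_def smooth_differentiable smooth_continuous smooth_partials)

lemma liealgD:
  assumes "f \<in> liealg"
  shows "smooth f" "periodic f" "tint f = 0" "antiinv f" "C1per f" "C1per (d1 f)" "C1per (d2 f)"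
proof -
  show *: "smooth f" "periodic f" "tint f = 0" "antiinv f"
    using assms by (auto simp: liealg_def periodic_def antiinv_def)
  then show "C1per f" "C1per (d1 f)" "C1per (d2 f)"
    by (auto intro: smooth_C1per smooth_partials periodic_partials)
qed

lemma smooth_diff:
  assumes "smooth f" "smooth g"
  shows "smooth (\<lambda>x. f x - g x)"
proof -
  have d: "pdiff bs f differentiable (at x)" "pdiff bs g differentiable (at x)" for bs x
    using assms by (auto simp only: smooth_def)
  have "pdiff bs (\<lambda>x. f x - g x) = (\<lambda>x. pdiff bs f x - pdiff bs g x)" for bs
    by (induction bs) (auto simp: partials_diff[OF d])
  then show ?thesis
    using d by (simp add: smooth_def differentiable_diff)
qed

lemma liealg_diff:
  assumes "f \<in> liealg" "g \<in> liealg"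
  shows "(\<lambda>x. f x - g x) \<in> liealg"
proof -
  note f = liealgD[OF assms(1)] and g = liealgD[OF assms(2)]
  have "tint (\<lambda>x. f x - g x) = 0"
    using f(3) g(3) tint_diff smooth_continuous[OF f(1)] smooth_continuous[OF g(1)] by simp
  then show ?thesis
    using smooth_diff[OF f(1) g(1)] f(2,4) g(2,4)
    by (auto simp: liealg_def periodic_def antiinv_def)
qed

lemma ip_diff_left:
  assumes "C1per f" "C1per g" "C1per h"
  shows "ip (\<lambda>x. f x - g x) h = ip f h - ip g h"
proof -
  note C = C1perD[OF assms(1)] C1perD[OF assms(2)] C1perD[OF assms(3)]
  have "ip (\<lambda>x. f x - g x) h = tint (\<lambda>x. (d1 f x * d1 h x + d2 f x * d2 h x)
      - (d1 g x * d1 h x + d2 g x * d2 h x))"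
    by (simp add: ip_def partials_diff C algebra_simps)
  also have "\<dots> = ip f h - ip g h"
    unfolding ip_def by (intro tint_diff continuous_intros C)
  finally show ?thesis .
qed

lemma ip_add_left:
  assumes "C1per f" "C1per g" "C1per h"
  shows "ip (\<lambda>x. f x + g x) h = ip f h + ip g h"
proof -
  note C = C1perD[OF assms(1)] C1perD[OF assms(2)] C1perD[OF assms(3)]
  have "ip (\<lambda>x. f x + g x) h = tint (\<lambda>x. (d1 f x * d1 h x + d2 f x * d2 h x)
      + (d1 g x * d1 h x + d2 g x * d2 h x))"
    by (simp add: ip_def partials_add C algebra_simps)
  also have "\<dots> = ip f h + ip g h"
    unfolding ip_def by (intro tint_add continuous_intros C)
  finally show ?thesis .
qed

lemma ip_cmult_left:
  assumes "C1per f"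
  shows "ip (\<lambda>x. c * f x) h = c * ip f h"
proof -
  have "ip (\<lambda>x. c * f x) h = tint (\<lambda>x. c * (d1 f x * d1 h x + d2 f x * d2 h x))"
    by (simp add: ip_def partials_cmult C1perD[OF assms] algebra_simps)
  then show ?thesis
    by (simp add: ip_def)
qed

lemma ip_commute: "ip f g = ip g f"
  by (simp add: ip_def mult.commute)

text \<open>A vanishing Dirichlet energy forces a zero gradient on the square, so \<open>f\<close>
  is constant there, and zero mean makes the constant 0. This definiteness gives the uniqueness
  behind the definite description in \<open>Bop\<close>.\<close>

lemma ip_zero_imp_zero:
  assumes "f \<in> liealg" "ip f f = 0"
  shows "f = (\<lambda>x. 0)"
proof -
  note f = liealgD[OF assms(1)] and C = C1perD[OF liealgD(5)[OF assms(1)]]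
  have "box (0, 0) (2 * pi, 2 * pi) \<noteq> {}"
    by (auto simp: box_ne_empty Basis_prod_def)
  then have "\<forall>x\<in>torus_sq. d1 f x * d1 f x + d2 f x * d2 f x = 0"
    using assms(2) unfolding ip_def torus_sq_def
    by (subst (asm) integral_cbox_eq_0_iff) (auto intro!: continuous_intros C)
  then have zero: "d1 f x = 0" "d2 f x = 0" if "x \<in> torus_sq" for x
    using that by (auto simp: sum_squares_eq_zero_iff)
  have "\<exists>c. \<forall>x\<in>torus_sq. f x = c"
  proof (rule has_derivative_zero_constant)
    show "convex torus_sq"
      by (simp add: torus_sq_def)
    show "(f has_derivative (\<lambda>h. 0)) (at x within torus_sq)" if "x \<in> torus_sq" for x
      using has_derivative_partials[OF C(1), of x] zero[OF that]
      by (auto intro: has_derivative_at_withinI)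
  qed
  then obtain c where c: "\<And>x. x \<in> torus_sq \<Longrightarrow> f x = c"
    by blast
  have "tint f = tint (\<lambda>x. c)"
    by (rule integral_cong) (rule c)
  then have "c = 0"
    using f(3) by (simp add: tint_const)
  show ?thesis
  proof
    fix x :: "real \<times> real"
    obtain m n :: int where "(fst x + 2 * pi * of_int m, snd x + 2 * pi * of_int n) \<in> torus_sq"
      by (rule torus_representative)
    then show "f x = 0"
      using c \<open>c = 0\<close> periodic_int[OF f(2), of "fst x" m "snd x" n] by simp
  qed
qed

text \<open>The difference of two candidates lies in \<open>liealg\<close>, so it may serve as its
  own test function.\<close>

lemma Bop_eqI:
  assumes "b \<in> liealg" "\<And>w. w \<in> liealg \<Longrightarrow> ip b w = ip u (bracket v w)"
  shows "Bop u v = b"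
  unfolding Bop_def
proof (rule the_equality)
  show "b \<in> liealg \<and> (\<forall>w\<in>liealg. ip b w = ip u (bracket v w))"
    using assms by blast
next
  fix b' assume b': "b' \<in> liealg \<and> (\<forall>w\<in>liealg. ip b' w = ip u (bracket v w))"
  let ?d = "\<lambda>x. b' x - b x"
  have d: "?d \<in> liealg"
    using b' assms(1) by (intro liealg_diff) auto
  have "ip ?d ?d = ip b' ?d - ip b ?d"
    using b' assms(1) d by (intro ip_diff_left liealgD) auto
  also have "\<dots> = 0"
    using b' assms(2) d by simp
  finally have zero: "?d = (\<lambda>x. 0)"
    by (rule ip_zero_imp_zero[OF d])
  show "b' = b"
  proof
    show "b' x = b x" for x
      using fun_cong[OF zero, of x] by simp
  qed
qed

lemma tint_bracket_by_parts:
  assumes "C1per u" "v \<in> trig" "C1per w"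
  shows "tint (\<lambda>x. u x * bracket v w x) = tint (\<lambda>x. bracket u v x * w x)"
proof -
  \<comment> \<open>The two integrands differ by the divergence \<open>d2 ?G - d1 ?F\<close>: the
    terms with the mixed second derivatives of \<open>v\<close> cancel.\<close>
  let ?F = "\<lambda>x. u x * d2 v x * w x" and ?G = "\<lambda>x. u x * d1 v x * w x"
  have v: "C1per v" "C1per (d1 v)" "C1per (d2 v)"
    using assms(2) by (auto intro: trig_C1per trig_d1 trig_d2)
  note C = C1perD[OF assms(1)] C1perD[OF v(1)] C1perD[OF v(2)] C1perD[OF v(3)] C1perD[OF assms(3)]
  have FG: "C1per ?F" "C1per ?G"
    by (intro C1per_mult assms v)+
  have F: "d1 ?F = (\<lambda>x. (d1 u x * d2 v x + u x * d1 (d2 v) x) * w x + u x * d2 v x * d1 w x)"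
    by (simp add: partials_mult C differentiable_mult)
  have G: "d2 ?G = (\<lambda>x. (d2 u x * d1 v x + u x * d1 (d2 v) x) * w x + u x * d1 v x * d2 w x)"
    by (simp add: partials_mult C differentiable_mult trig_partials_commute[OF assms(2)])
  have "(\<lambda>x. bracket u v x * w x - u x * bracket v w x) = (\<lambda>x. d2 ?G x - d1 ?F x)"
    unfolding F G bracket_def by (simp add: algebra_simps)
  then have "tint (\<lambda>x. bracket u v x * w x - u x * bracket v w x) = tint (d2 ?G) - tint (d1 ?F)"
    by (simp add: tint_diff C1perD[OF FG(1)] C1perD[OF FG(2)])
  also have "\<dots> = 0"
    using FG by (simp add: tint_d1 tint_d2)
  finally have "tint (\<lambda>x. bracket u v x * w x - u x * bracket v w x) = 0" .
  moreover have "tint (\<lambda>x. bracket u v x * w x - u x * bracket v w x)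
      = tint (\<lambda>x. bracket u v x * w x) - tint (\<lambda>x. u x * bracket v w x)"
    unfolding bracket_def by (intro tint_diff continuous_intros C)
  ultimately show ?thesis
    by simp
qed

lemma ip_lap:
  assumes "u \<in> trig" "C1per f"
  shows "ip u f = - tint (\<lambda>x. lap u x * f x)"
proof -
  let ?F = "\<lambda>x. d1 u x * f x" and ?G = "\<lambda>x. d2 u x * f x"
  have u: "C1per (d1 u)" "C1per (d2 u)"
    using assms(1) by (auto intro: trig_C1per trig_d1 trig_d2)
  note C = C1perD[OF u(1)] C1perD[OF u(2)] C1perD[OF assms(2)]
  have FG: "C1per ?F" "C1per ?G"
    by (intro C1per_mult assms u)+
  have "tint (d1 ?F) = 0" "tint (d2 ?G) = 0"
    using FG by (simp_all add: tint_d1 tint_d2)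
  then have "0 = tint (\<lambda>x. d1 ?F x + d2 ?G x)"
    by (simp add: tint_add C1perD[OF FG(1)] C1perD[OF FG(2)])
  also have "\<dots> = tint (\<lambda>x. (d1 u x * d1 f x + d2 u x * d2 f x) + lap u x * f x)"
    by (simp add: partials_mult C lap_def algebra_simps)
  also have "\<dots> = ip u f + tint (\<lambda>x. lap u x * f x)"
    unfolding ip_def lap_def by (intro tint_add continuous_intros C)
  finally show ?thesis
    by simp
qed

lemma C1per_bracket:
  assumes "v \<in> trig" "w \<in> liealg"
  shows "C1per (bracket v w)"
  unfolding bracket_def
  by (intro C1per_diff C1per_mult trig_C1per trig_d1 trig_d2 assms liealgD)

text \<open>Green's formula turns both inner products into integrals against Laplacians, and between
  them \<open>tint_bracket_by_parts\<close> moves \<open>v\<close> from one bracket to the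
  other.\<close>

lemma Bop_preimage:
  assumes "u \<in> ktrig" "v \<in> ktrig" "b \<in> ktrig" "lap b = bracket (lap u) v"
  shows "Bop u v = b" "\<And>w. w \<in> liealg \<Longrightarrow> ip b w = ip u (bracket v w)"
proof -
  show *: "ip b w = ip u (bracket v w)" if "w \<in> liealg" for w
  proof -
    have t: "u \<in> trig" "v \<in> trig" "b \<in> trig" "lap u \<in> trig"
      using assms by (auto intro: ktrig_trig trig_lap)
    have "ip b w = - tint (\<lambda>x. bracket (lap u) v x * w x)"
      using ip_lap[OF t(3) liealgD(5)[OF that]] assms(4) by simp
    also have "\<dots> = - tint (\<lambda>x. lap u x * bracket v w x)"
      using tint_bracket_by_parts[OF trig_C1per[OF t(4)] t(2) liealgD(5)[OF that]] by simp
    also have "\<dots> = ip u (bracket v w)"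
      using ip_lap[OF t(1) C1per_bracket[OF t(2) that]] by simp
    finally show ?thesis .
  qed
  show "Bop u v = b"
    using ktrig_liealg[OF assms(3)] * by (rule Bop_eqI)
qed

lemma Bop_ktrig:
  assumes "u \<in> ktrig" "v \<in> ktrig"
  shows "Bop u v \<in> ktrig" "\<And>w. w \<in> liealg \<Longrightarrow> ip (Bop u v) w = ip u (bracket v w)"
proof -
  obtain b where b: "b \<in> ktrig" "lap b = bracket (lap u) v"
    using lap_preimage[OF ktrig_bracket[OF ktrig_lap[OF assms(1)] assms(2)]] .
  note B = Bop_preimage[OF assms b]
  show "Bop u v \<in> ktrig" "\<And>w. w \<in> liealg \<Longrightarrow> ip (Bop u v) w = ip u (bracket v w)"
    using B b by auto
qed

lemma conn_ktrig: "u \<in> ktrig \<Longrightarrow> v \<in> ktrig \<Longrightarrow> conn u v \<in> ktrig"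
  unfolding conn_def by (intro ktrig_cmult ktrig_diff ktrig_bracket Bop_ktrig)

lemma ktrig_C1per: "f \<in> ktrig \<Longrightarrow> C1per f"
  by (intro trig_C1per ktrig_trig)

text \<open>The Koszul formula: tested against \<open>w\<close>, both \<open>B\<close> terms turn
  into brackets.\<close>

lemma ip_conn:
  assumes "u \<in> ktrig" "v \<in> ktrig" "w \<in> ktrig"
  shows "ip (conn u v) w = (1/2) * (ip (bracket u v) w - ip u (bracket v w) - ip v (bracket u w))"
proof -
  have "ip (conn u v) w = (1/2) * ip (\<lambda>x. bracket u v x - Bop u v x - Bop v u x) w"
    unfolding conn_def
    by (intro ip_cmult_left ktrig_C1per ktrig_diff ktrig_bracket Bop_ktrig assms)
  also have "ip (\<lambda>x. bracket u v x - Bop u v x - Bop v u x) w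
      = ip (\<lambda>x. bracket u v x - Bop u v x) w - ip (Bop v u) w"
    by (intro ip_diff_left ktrig_C1per ktrig_diff ktrig_bracket Bop_ktrig assms)
  also have "ip (\<lambda>x. bracket u v x - Bop u v x) w = ip (bracket u v) w - ip (Bop u v) w"
    by (intro ip_diff_left ktrig_C1per ktrig_bracket Bop_ktrig assms)
  finally show ?thesis
    by (simp add: Bop_ktrig assms ktrig_liealg)
qed

lemma bracket_swap: "bracket u v = (\<lambda>x. (- 1) * bracket v u x)"
  by (simp add: bracket_def algebra_simps)

lemma ip_bracket_swap:
  assumes "u \<in> ktrig" "v \<in> ktrig"
  shows "ip (bracket u v) w = - ip (bracket v u) w" "ip w (bracket u v) = - ip w (bracket v u)"
proof -
  have "ip (bracket u v) w = - 1 * ip (bracket v u) w" for w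
    by (subst bracket_swap) (intro ip_cmult_left ktrig_C1per ktrig_bracket assms)
  then show "ip (bracket u v) w = - ip (bracket v u) w" "ip w (bracket u v) = - ip w (bracket v u)"
    by (simp_all add: ip_commute[of w])
qed

text \<open>The right side of the Koszul formula is skew in \<open>v\<close> and \<open>w\<close>,
  so the connection is metric. In the curvature this moves the outer derivative of
  \<open>conn u (conn v u)\<close> to the other argument.\<close>

lemma conn_metric:
  assumes "u \<in> ktrig" "v \<in> ktrig" "w \<in> ktrig"
  shows "ip (conn u v) w = - ip v (conn u w)"
  using ip_conn[OF assms] ip_conn[OF assms(1,3,2)]
    ip_bracket_swap(2)[OF assms(2,3), of u]
    ip_commute[of "bracket u v" w] ip_commute[of "bracket u w" v] ip_commute[of "conn u w" v]
  by (simp add: algebra_simps)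

lemma bracket_cmult_left:
  "f \<in> trig \<Longrightarrow> bracket (\<lambda>x. c * f x) g = (\<lambda>x. c * bracket f g x)"
  by (simp add: bracket_def partials_cmult trig_differentiable algebra_simps)

text \<open>For an eigenfunction \<open>bracket (lap u) u\<close> vanishes, so
  \<open>conn u u = 0\<close> and one of the three curvature terms drops out. In the others
  \<open>B\<close> contributes only multiples of \<open>g\<close> with \<open>lap g = - w\<close>,
  so everything reduces to pairings of \<open>w\<close> and \<open>g\<close>. The statement accepts
  any trigonometric \<open>g0\<close> with this Laplacian, whatever its symmetry, so that the
  explicit Fourier inverse of \<open>w\<close> can be inserted as it is.\<close>

lemma curv_eigenfunctions:
  assumes u: "u \<in> ktrig" "lap u = (\<lambda>x. - p * u x)" and v: "v \<in> ktrig" "lap v = (\<lambda>x. - q * v x)"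
    and g0: "g0 \<in> trig" "lap g0 = (\<lambda>x. - bracket u v x)"
  defines "w \<equiv> bracket u v"
  shows "ip (curv u v u) v = (3/4) * tint (\<lambda>x. w x * lap w x) + (p + q) / 2 * tint (\<lambda>x. w x * w x)
     + (p - q)\<^sup>2 / 4 * tint (\<lambda>x. w x * g0 x)"
proof -
  have w: "w \<in> ktrig"
    unfolding w_def by (intro ktrig_bracket u v)
  obtain g where g: "g \<in> ktrig" "lap g = (\<lambda>x. (- 1) * w x)"
    using lap_preimage[OF ktrig_cmult[OF w]] .
  note tr = ktrig_trig[OF u(1)] ktrig_trig[OF v(1)] ktrig_trig[OF w] ktrig_trig[OF g(1)]
  have wvu: "bracket v u x = - w x" for x
    unfolding w_def by (simp add: bracket_def)
  have Buv: "Bop u v = (\<lambda>x. p * g x)"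
  proof (rule Bop_preimage[OF u(1) v(1)])
    show "lap (\<lambda>x. p * g x) = bracket (lap u) v"
      using bracket_cmult_left[OF tr(1), of "- p" v]
      by (simp add: lap_cmult tr g u w_def)
  qed (intro ktrig_cmult g)
  have Bvu: "Bop v u = (\<lambda>x. (- q) * g x)"
  proof (rule Bop_preimage[OF v(1) u(1)])
    show "lap (\<lambda>x. (- q) * g x) = bracket (lap v) u"
      using bracket_cmult_left[OF tr(2), of "- q" u] lap_cmult[OF tr(4), of "- q"]
      by (simp add: g v wvu)
  qed (intro ktrig_cmult g)
  have zero: "Bop f h = (\<lambda>x. 0)" if "f \<in> ktrig" "h \<in> ktrig" "bracket (lap f) h = (\<lambda>x. 0)" for f h
  proof (rule Bop_preimage[OF that(1,2) ktrig_zero])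
    show "lap (\<lambda>x. 0) = bracket (lap f) h"
      using lap_cmult[OF trig_zero, of 0] that(3) by simp
  qed
  have lap0: "lap (\<lambda>x. 0) = (\<lambda>x. 0)"
    using lap_cmult[OF trig_zero, of 0] by simp
  have br0: "bracket (\<lambda>x. 0) f = (\<lambda>x. 0)" "bracket f (\<lambda>x. 0) = (\<lambda>x. 0)" for f
    by (simp_all add: bracket_def d1_def d2_def)
  have "bracket (lap u) u = (\<lambda>x. 0)"
    using bracket_cmult_left[OF tr(1), of "- p" u] by (simp add: u bracket_def)
  then have uu: "conn u u = (\<lambda>x. 0)"
    using zero[OF u(1) u(1)] by (simp add: conn_def bracket_def)
  have "Bop v (\<lambda>x. 0) = (\<lambda>x. 0)" "Bop (\<lambda>x. 0) v = (\<lambda>x. 0)"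
    by (rule zero; simp add: v ktrig_zero lap0 br0)+
  then have v0: "conn v (conn u u) = (\<lambda>x. 0)"
    unfolding uu by (simp add: conn_def br0)
  define c where "c = conn v u"
  have c: "c \<in> ktrig"
    unfolding c_def by (intro conn_ktrig u v)
  have c_eq: "c = (\<lambda>x. (- 1/2) * (w x + (p - q) * g x))"
    by (simp add: c_def conn_def Buv Bvu wvu algebra_simps)
  have uv_eq: "conn u v = (\<lambda>x. (1/2) * (w x - (p - q) * g x))"
    by (simp add: conn_def Buv Bvu w_def algebra_simps)
  have curv_eq: "curv u v u = (\<lambda>x. conn w u x - conn u c x)"
    by (simp add: curv_def v0 c_def w_def)
  have ipBuv: "ip u (bracket v w) = p * ip g w"
    using Bop_ktrig(2)[OF u(1) v(1) ktrig_liealg[OF w]] ip_cmult_left[OF ktrig_C1per[OF g(1)], of p w]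
    by (simp add: Buv)
  have ipBvu: "ip v (bracket u w) = - q * ip g w"
    using Bop_ktrig(2)[OF v(1) u(1) ktrig_liealg[OF w]] ip_cmult_left[OF ktrig_C1per[OF g(1)], of "- q" w]
    by (simp add: Bvu)
  have wu: "ip (conn w u) v = (1/2) * ((p + q) * ip g w - ip w w)"
  proof -
    have "ip (conn w u) v = (1/2) * (ip (bracket w u) v - ip w (bracket u v) - ip u (bracket w v))"
      by (rule ip_conn[OF w u(1) v(1)])
    also have "ip (bracket w u) v = q * ip g w"
      using ip_bracket_swap(1)[OF w u(1), of v] ip_commute[of "bracket u w" v] ipBvu by simp
    also have "ip u (bracket w v) = - p * ip g w"
      using ip_bracket_swap(2)[OF w v(1), of u] ipBuv by simp
    finally show ?thesis
      by (simp add: w_def algebra_simps)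
  qed
  have uc: "ip (conn u c) v = (1/4) * (ip w w - (p - q)\<^sup>2 * ip g g)"
  proof -
    have 1: "ip (\<lambda>x. (p - q) * g x) h = (p - q) * ip g h" for h
      by (rule ip_cmult_left[OF ktrig_C1per[OF g(1)]])
    have 2: "ip (\<lambda>x. w x + (p - q) * g x) h = ip w h + (p - q) * ip g h" if "C1per h" for h
      using ip_add_left[OF ktrig_C1per[OF w] C1per_cmult[OF ktrig_C1per[OF g(1)]] that, of "p - q"] 1 by simp
    have 3: "ip (\<lambda>x. w x - (p - q) * g x) h = ip w h - (p - q) * ip g h" if "C1per h" for h
      using ip_diff_left[OF ktrig_C1per[OF w] C1per_cmult[OF ktrig_C1per[OF g(1)]] that, of "p - q"] 1 by simp
    have gw: "C1per g" "C1per w" "C1per (\<lambda>x. w x + (p - q) * g x)" "C1per (\<lambda>x. w x - (p - q) * g x)"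
      by (intro ktrig_C1per ktrig_add ktrig_diff ktrig_cmult g w)+
    have "ip (conn u c) v = - ip c (conn u v)"
      by (rule conn_metric[OF u(1) c v(1)])
    also have "\<dots> = (1/2) * ip (\<lambda>x. w x + (p - q) * g x) (conn u v)"
      unfolding c_eq by (subst ip_cmult_left[OF gw(3)]) simp
    also have "\<dots> = (1/2) * ip (conn u v) (\<lambda>x. w x + (p - q) * g x)"
      by (simp add: ip_commute)
    also have "\<dots> = (1/4) * ip (\<lambda>x. w x - (p - q) * g x) (\<lambda>x. w x + (p - q) * g x)"
      unfolding uv_eq by (subst ip_cmult_left[OF gw(4)]) simp
    also have "\<dots> = (1/4) * (ip (\<lambda>x. w x + (p - q) * g x) w - (p - q) * ip (\<lambda>x. w x + (p - q) * g x) g)"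
      by (simp add: 3[OF gw(3)] ip_commute[of _ "\<lambda>x. w x + (p - q) * g x"])
    also have "\<dots> = (1/4) * (ip w w - (p - q)\<^sup>2 * ip g g)"
      by (simp only: 2[OF gw(1)] 2[OF gw(2)] ip_commute[of w g]) (simp add: power2_eq_square algebra_simps)
    finally show ?thesis .
  qed
  have "ip (curv u v u) v = ip (conn w u) v - ip (conn u c) v"
    unfolding curv_eq by (intro ip_diff_left ktrig_C1per conn_ktrig w u v c)
  also have "\<dots> = (p + q) / 2 * ip g w - 3/4 * ip w w + (p - q)\<^sup>2 / 4 * ip g g"
    by (simp add: wu uc field_simps)
  also have "ip g w = tint (\<lambda>x. w x * w x)"
    using ip_lap[OF tr(4) ktrig_C1per[OF w]] by (simp add: g)
  also have "ip w w = - tint (\<lambda>x. w x * lap w x)"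
    using ip_lap[OF tr(3) ktrig_C1per[OF w]] by (simp add: mult.commute)
  also have "ip g g = tint (\<lambda>x. w x * g x)"
    using ip_lap[OF tr(4) ktrig_C1per[OF g(1)]] by (simp add: g)
  \<comment> \<open>\<open>g\<close> and \<open>g0\<close> solve the same Poisson equation; Green's
    formula, used once on each side, exchanges them.\<close>
  also have "\<dots> = ip g0 g"
    using ip_lap[OF g0(1) ktrig_C1per[OF g(1)]] by (simp add: g0 w_def)
  also have "\<dots> = tint (\<lambda>x. w x * g0 x)"
    using ip_lap[OF tr(4) trig_C1per[OF g0(1)]] by (simp add: g ip_commute[of g0])
  finally show ?thesis
    by simp
qed

section \<open>Equidistribution of lattice points in discs\<close>

lemma linear_over_square_tendsto_zero:
  fixes f :: "nat \<Rightarrow> 'a::real_normed_field"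
  assumes "\<And>n. n \<ge> N \<Longrightarrow> norm (f n) \<le> K * real n"
  shows "(\<lambda>n. f n / of_nat (n\<^sup>2)) \<longlonglongrightarrow> 0"
proof (rule Lim_null_comparison)
  show "(\<lambda>n. K * (1 / real n)) \<longlonglongrightarrow> 0"
    using tendsto_mult_right[OF lim_1_over_n, of K] by simp
  show "\<forall>\<^sub>F n in sequentially. norm (f n / of_nat (n\<^sup>2)) \<le> K * (1 / real n)"
    using eventually_ge_at_top[of "max 1 N"]
  proof eventually_elim
    case (elim n)
    then have "norm (f n) / (real n)\<^sup>2 \<le> K * real n / (real n)\<^sup>2"
      using assms[of n] by (intro divide_right_mono) auto
    then show ?case
      using elim by (simp add: norm_divide norm_mult power2_eq_square)
  qed
qed

text \<open>Finiteness of every \<open>{z. norm (h z) > \<epsilon>}\<close> says that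
  \<open>h\<close> tends to 0 at infinity without naming an order on the index set. The finitely
  many large terms are absorbed by \<open>M\<close>, the others cost at most
  \<open>\<epsilon>\<close> each.\<close>

lemma cesaro_square_tendsto_zero:
  fixes h :: "'a \<Rightarrow> 'b::real_normed_field" and B :: "nat \<Rightarrow> 'a set"
  assumes fin: "\<And>n. finite (B n)" and card: "\<And>n. n \<ge> 1 \<Longrightarrow> real (card (B n)) \<le> K * (real n)\<^sup>2"
    and h: "\<And>\<epsilon>. \<epsilon> > 0 \<Longrightarrow> finite {z. norm (h z) > \<epsilon>}"
  shows "(\<lambda>n. (\<Sum>z\<in>B n. h z) / of_nat (n\<^sup>2)) \<longlonglongrightarrow> 0"
proof (rule LIMSEQ_I)
  fix r :: real assume r: "r > 0"
  define K' where "K' = max K 1"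
  define \<epsilon> where "\<epsilon> = r / (2 * K')"
  have K': "K' \<ge> 1" "K \<le> K'"
    by (auto simp: K'_def)
  have \<epsilon>: "\<epsilon> > 0"
    using r K' by (simp add: \<epsilon>_def)
  define E where "E = {z. norm (h z) > \<epsilon>}"
  define M where "M = (\<Sum>z\<in>E. norm (h z))"
  have E: "finite E"
    unfolding E_def by (rule h[OF \<epsilon>])
  have le: "norm (\<Sum>z\<in>B n. h z) \<le> M + \<epsilon> * (K' * (real n)\<^sup>2)" if "n \<ge> 1" for n
  proof -
    have "norm (\<Sum>z\<in>B n. h z) \<le> (\<Sum>z\<in>B n. norm (h z))"
      by (rule norm_sum)
    also have "\<dots> \<le> (\<Sum>z\<in>B n. (if z \<in> E then norm (h z) else 0) + \<epsilon>)"
      using \<epsilon> by (intro sum_mono) (auto simp: E_def)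
    also have "\<dots> = (\<Sum>z\<in>B n \<inter> E. norm (h z)) + \<epsilon> * real (card (B n))"
      using fin by (simp add: sum.distrib sum.inter_restrict)
    also have "\<dots> \<le> M + \<epsilon> * (K' * (real n)\<^sup>2)"
    proof (intro add_mono mult_left_mono)
      show "(\<Sum>z\<in>B n \<inter> E. norm (h z)) \<le> M"
        unfolding M_def using E by (intro sum_mono2) auto
      have "K * (real n)\<^sup>2 \<le> K' * (real n)\<^sup>2"
        using K' by (intro mult_right_mono) auto
      then show "real (card (B n)) \<le> K' * (real n)\<^sup>2"
        using card[OF that] by linarith
    qed (use \<epsilon> in simp)
    finally show ?thesis .
  qed
  have M: "M \<ge> 0"
    unfolding M_def by (intro sum_nonneg) auto
  obtain N where N: "real N > 2 * M / r"
    using reals_Archimedean2 by blast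
  show "\<exists>no. \<forall>n\<ge>no. norm ((\<Sum>z\<in>B n. h z) / of_nat (n\<^sup>2) - 0) < r"
  proof (intro exI[of _ "max 1 N"] allI impI)
    fix n assume n: "max 1 N \<le> n"
    have "2 * M / r < real n"
      using n N by linarith
    also have "real n \<le> (real n)\<^sup>2"
      using n by (simp add: power2_eq_square)
    finally have "M < r / 2 * (real n)\<^sup>2"
      using r by (simp add: field_simps)
    moreover have "\<epsilon> * (K' * (real n)\<^sup>2) = r / 2 * (real n)\<^sup>2"
      using K' by (simp add: \<epsilon>_def)
    ultimately have "norm (\<Sum>z\<in>B n. h z) < r * (real n)\<^sup>2"
      using le[of n] n by linarith
    then show "norm ((\<Sum>z\<in>B n. h z) / of_nat (n\<^sup>2) - 0) < r"
      using n by (simp add: norm_divide norm_power pos_divide_less_eq)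
  qed
qed

section \<open>Gaussian integers in discs and annuli\<close>

definition gz :: "int \<times> int \<Rightarrow> complex" where
  "gz z = Complex (of_int (fst z)) (of_int (snd z))"

definition gball :: "nat \<Rightarrow> (int \<times> int) set" where
  "gball R = {z. cmod (gz z) \<le> real R}"

lemma cmod_gz: "cmod (gz z) = sqrt ((of_int (fst z))\<^sup>2 + (of_int (snd z))\<^sup>2)"
  by (simp add: gz_def cmod_def)

lemma cmod_gz_le_box:
  assumes "cmod (gz z) \<le> real M"
  shows "z \<in> {- int M..int M} \<times> {- int M..int M}"
proof -
  have "\<bar>of_int (fst z)\<bar> \<le> cmod (gz z)" "\<bar>of_int (snd z)\<bar> \<le> cmod (gz z)"
    using abs_Re_le_cmod[of "gz z"] abs_Im_le_cmod[of "gz z"] by (simp_all add: gz_def)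
  then have "\<bar>of_int (fst z) :: real\<bar> \<le> of_int (int M)" "\<bar>of_int (snd z) :: real\<bar> \<le> of_int (int M)"
    using assms by simp_all
  then have "\<bar>fst z\<bar> \<le> int M" "\<bar>snd z\<bar> \<le> int M"
    by (simp_all only: of_int_abs[symmetric] of_int_le_iff)
  then show ?thesis
    by (cases z) auto
qed

lemma finite_cmod_gz_le: "finite {z. cmod (gz z) \<le> r}"
proof -
  obtain M :: nat where "r \<le> real M"
    using real_arch_simple by blast
  then have "{z. cmod (gz z) \<le> r} \<subseteq> {- int M..int M} \<times> {- int M..int M}"
    using cmod_gz_le_box[of _ M] order_trans by blast
  then show ?thesis
    by (rule finite_subset) simp
qed

lemma finite_gball: "finite (gball R)"
  unfolding gball_def by (rule finite_cmod_gz_le)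

lemma card_gball_le:
  assumes "R \<ge> 1"
  shows "real (card (gball R)) \<le> 9 * (real R)\<^sup>2"
proof -
  have "gball R \<subseteq> {- int R..int R} \<times> {- int R..int R}"
    using cmod_gz_le_box[of _ R] by (auto simp: gball_def simp del: mem_Times_iff)
  then have "card (gball R) \<le> card ({- int R..int R} \<times> {- int R..int R})"
    by (rule card_mono[rotated]) simp
  also have "\<dots> = (2 * R + 1)\<^sup>2"
  proof -
    have "card {- int R..int R} = 2 * R + 1"
      by simp
    then show ?thesis
      by (simp only: card_cartesian_product power2_eq_square)
  qed
  also have "\<dots> \<le> (3 * R)\<^sup>2"
    using assms by (intro power_mono) auto
  finally have "real (card (gball R)) \<le> real ((3 * R)\<^sup>2)"
    by (simp only: of_nat_le_iff)
  then show ?thesis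
    by (simp add: power_mult_distrib)
qed

lemma card_int_set_diameter:
  fixes S :: "int set"
  assumes "finite S" "\<And>y y'. y \<in> S \<Longrightarrow> y' \<in> S \<Longrightarrow> y - y' \<le> int d"
  shows "card S \<le> d + 1"
proof (cases "S = {}")
  case False
  have "S \<subseteq> {Min S..Min S + int d}"
  proof
    fix y assume "y \<in> S"
    then show "y \<in> {Min S..Min S + int d}"
      using assms Min_in[OF assms(1) False] by force
  qed
  then have "card S \<le> card {Min S..Min S + int d}"
    by (rule card_mono[rotated]) simp
  then show ?thesis
    by simp
qed simp

text \<open>The half-width 5 comes from the coset comparison below: for \<open>cmod w = 5\<close>
  and \<open>cmod c \<le> 24\<close> the modulus of \<open>w * gz z + c\<close> is within 24 of
  \<open>5 * cmod (gz z)\<close>, so membership in the two discs can differ only if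
  \<open>cmod (gz z)\<close> is within 24/5 of the radius.\<close>

definition annulus :: "nat \<Rightarrow> (int \<times> int) set" where
  "annulus R = {z. real R - 5 \<le> cmod (gz z) \<and> cmod (gz z) \<le> real R + 5}"

lemma finite_annulus: "finite (annulus R)"
  by (rule finite_subset[OF _ finite_cmod_gz_le[of "real R + 5"]]) (auto simp: annulus_def)

text \<open>In the sector \<open>\<bar>x\<bar> \<le> y\<close> vertical lines cross the circle
  transversally. The squares of the two ordinates differ by at most
  \<open>(R + 5)^2 - (R - 5)^2 = 20 * R\<close>, and division by \<open>Y + Y' \<ge> R / 2\<close>
  leaves a gap of at most 40.\<close>

lemma annulus_fibre_diameter:
  assumes "R \<ge> 10" "(x, y) \<in> annulus R" "(x, y') \<in> annulus R" "\<bar>x\<bar> \<le> y" "\<bar>x\<bar> \<le> y'"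
  shows "y - y' \<le> 40"
proof (rule ccontr)
  assume "\<not> y - y' \<le> 40"
  then have "y \<ge> y' + 41"
    by simp
  define X Y Y' where "X = real_of_int x" and "Y = real_of_int y" and "Y' = real_of_int y'"
  have YY: "Y - Y' \<ge> 41"
    using \<open>y \<ge> y' + 41\<close> unfolding Y_def Y'_def by linarith
  have abs: "X\<^sup>2 \<le> Y'\<^sup>2"
  proof -
    have "\<bar>X\<bar> \<le> Y'"
      using assms(5) unfolding X_def Y'_def by linarith
    then have "\<bar>X\<bar>\<^sup>2 \<le> Y'\<^sup>2"
      by (intro power_mono) auto
    then show ?thesis
      by simp
  qed
  have Y'0: "Y' \<ge> 0"
    using assms(5) unfolding Y'_def by simp
  have "sqrt (X\<^sup>2 + Y\<^sup>2) \<le> real R + 5" "real R - 5 \<le> sqrt (X\<^sup>2 + Y'\<^sup>2)"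
    using assms(2,3) by (auto simp: annulus_def cmod_gz X_def Y_def Y'_def)
  then have "(sqrt (X\<^sup>2 + Y\<^sup>2))\<^sup>2 \<le> (real R + 5)\<^sup>2" "(real R - 5)\<^sup>2 \<le> (sqrt (X\<^sup>2 + Y'\<^sup>2))\<^sup>2"
    using assms(1) by (intro power_mono; simp)+
  then have 1: "X\<^sup>2 + Y\<^sup>2 \<le> (real R + 5)\<^sup>2" and 2: "(real R - 5)\<^sup>2 \<le> X\<^sup>2 + Y'\<^sup>2"
    by simp_all
  have "((real R - 5) / 2)\<^sup>2 \<le> Y'\<^sup>2"
  proof -
    have "((real R - 5) / 2)\<^sup>2 = (real R - 5)\<^sup>2 / 4"
      by (simp add: power_divide)
    then show ?thesis
      using 2 abs zero_le_power2[of Y'] by linarith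
  qed
  then have "(real R - 5) / 2 \<le> Y'"
    using Y'0 by (rule power2_le_imp_le)
  then have "Y + Y' \<ge> real R / 2"
    using YY assms(1) by simp
  then have "41 * (real R / 2) \<le> (Y - Y') * (Y + Y')"
    using YY by (intro mult_mono) auto
  also have "\<dots> = Y\<^sup>2 - Y'\<^sup>2"
    by (simp add: power2_eq_square algebra_simps)
  also have "\<dots> \<le> 20 * real R"
    using 1 2 by (simp add: power2_eq_square algebra_simps)
  finally show False
    using assms(1) by simp
qed

text \<open>Each of at most \<open>3 * R\<close> columns holds at most 41 points of the upper
  sector, and four images of this sector under symmetries of the square cover the plane. The
  condition \<open>R \<ge> 11\<close> makes \<open>2 * (R + 5) + 1 \<le> 3 * R\<close>.\<close>

lemma card_annulus_le:
  assumes R: "R \<ge> 11"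
  shows "real (card (annulus R)) \<le> 600 * real R"
proof -
  define U where "U = {z \<in> annulus R. \<bar>fst z\<bar> \<le> snd z}"
  have finU: "finite U"
    unfolding U_def using finite_annulus by simp
  have "U \<subseteq> Sigma {- int (R + 5)..int (R + 5)} (\<lambda>x. {y. (x, y) \<in> U})"
    using cmod_gz_le_box[of _ "R + 5"] by (force simp: U_def annulus_def)
  moreover have fin: "finite {y. (x, y) \<in> U}" for x
    by (rule finite_subset[OF _ finite_imageI[OF finU, of snd]]) force
  ultimately have "card U \<le> card (Sigma {- int (R + 5)..int (R + 5)} (\<lambda>x. {y. (x, y) \<in> U}))"
    by (intro card_mono) auto
  also have "\<dots> = (\<Sum>x\<in>{- int (R + 5)..int (R + 5)}. card {y. (x, y) \<in> U})"
    using fin by (intro card_SigmaI) auto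
  also have "\<dots> \<le> (\<Sum>x\<in>{- int (R + 5)..int (R + 5)}. 41)"
  proof (intro sum_mono)
    show "card {y. (x, y) \<in> U} \<le> 41" for x
      using card_int_set_diameter[OF fin, of x 40] annulus_fibre_diameter[of R x] R
      by (auto simp: U_def)
  qed
  also have "\<dots> \<le> 41 * (3 * R)"
    using R by (simp add: nat_add_distrib)
  finally have cardU: "card U \<le> 123 * R"
    by simp
  have "annulus R \<subseteq> U \<union> (\<lambda>(x, y). (x, - y)) ` U \<union> (\<lambda>(x, y). (y, x)) ` U
      \<union> (\<lambda>(x, y). (- y, x)) ` U" (is "_ \<subseteq> ?V")
  proof
    fix z assume z: "z \<in> annulus R"
    obtain x y where xy: "z = (x, y)"
      by (cases z)
    have sym: "(x, - y) \<in> annulus R" "(y, x) \<in> annulus R" "(y, - x) \<in> annulus R"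
      using z by (auto simp: annulus_def cmod_gz xy add.commute)
    consider "\<bar>x\<bar> \<le> y" | "\<bar>x\<bar> \<le> - y" | "\<bar>y\<bar> \<le> x" | "\<bar>y\<bar> \<le> - x"
      by linarith
    then show "z \<in> ?V"
    proof cases
      case 1
      then show ?thesis
        using z xy by (auto simp: U_def)
    next
      case 2
      then have "(x, - y) \<in> U"
        using sym by (auto simp: U_def)
      then show ?thesis
        using xy by force
    next
      case 3
      then have "(y, x) \<in> U"
        using sym by (auto simp: U_def)
      then show ?thesis
        using xy by force
    next
      case 4
      then have "(y, - x) \<in> U"
        using sym by (auto simp: U_def)
      then show ?thesis
        using xy by force
    qed
  qed
  then have "card (annulus R) \<le> card ?V"
    using finU by (intro card_mono) auto
  also have "\<dots> \<le> card U + card ((\<lambda>(x, y). (x, - y)) ` U) + card ((\<lambda>(x, y). (y, x)) ` U)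
      + card ((\<lambda>(x, y). (- y, x)) ` U)"
    by (intro order_trans[OF card_Un_le] add_mono order_refl)
  also have "\<dots> \<le> card U + card U + card U + card U"
    by (intro add_mono card_image_le finU order_refl)
  also have "\<dots> \<le> 600 * R"
    using cardU by simp
  finally have "real (card (annulus R)) \<le> real (600 * R)"
    by (simp only: of_nat_le_iff)
  then show ?thesis
    by simp
qed

section \<open>The sum of a fourth-power character over a disc\<close>

lemma norm_sgn_diff_le:
  fixes a b :: "'a::real_normed_vector"
  assumes "b \<noteq> 0"
  shows "norm (sgn a - sgn b) \<le> 2 * norm (a - b) / norm b"
proof (cases "a = 0")
  case True
  then show ?thesis
    using assms by (simp add: norm_sgn)
next
  case False
  have "(norm b - norm a) / (norm b * norm a) = inverse (norm a) - inverse (norm b)"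
    using assms False by (simp add: field_simps)
  then have "sgn a - sgn b = (a - b) /\<^sub>R norm b + ((norm b - norm a) / (norm b * norm a)) *\<^sub>R a"
    by (simp only: sgn_div_norm) (simp add: algebra_simps)
  then have "norm (sgn a - sgn b) \<le> norm ((a - b) /\<^sub>R norm b)
      + norm (((norm b - norm a) / (norm b * norm a)) *\<^sub>R a)"
    by (metis norm_triangle_ineq)
  also have "\<dots> = norm (a - b) / norm b + \<bar>norm b - norm a\<bar> / norm b"
  proof -
    have "norm ((a - b) /\<^sub>R norm b) = norm (a - b) / norm b"
      by (simp add: divide_inverse mult.commute)
    moreover have "norm (((norm b - norm a) / (norm b * norm a)) *\<^sub>R a) = \<bar>norm b - norm a\<bar> / norm b"
      using False by (simp add: abs_divide abs_mult)
    ultimately show ?thesis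
      by simp
  qed
  also have "\<dots> \<le> norm (a - b) / norm b + norm (a - b) / norm b"
    using norm_triangle_ineq3[of b a] by (intro add_left_mono divide_right_mono) (auto simp: norm_minus_commute)
  finally show ?thesis
    by simp
qed

text \<open>On a complex number of argument \<open>\<theta>\<close> this is \<open>exp (4 i \<theta>)\<close>.\<close>
definition hecke :: "complex \<Rightarrow> complex" where
  "hecke z = sgn z ^ 4"

lemma hecke_mult: "hecke (z * w) = hecke z * hecke w"
  by (simp add: hecke_def sgn_mult power_mult_distrib)

lemma norm_hecke_le: "cmod (hecke z) \<le> 1"
  by (simp add: hecke_def norm_power norm_sgn)

lemma norm_hecke_diff_le:
  assumes "b \<noteq> 0"
  shows "cmod (hecke a - hecke b) \<le> 8 * cmod (a - b) / cmod b"
proof -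
  have "cmod (hecke a - hecke b) \<le> real 4 * cmod (sgn a - sgn b)"
    unfolding hecke_def by (rule norm_power_diff) (auto simp: norm_sgn)
  also have "\<dots> \<le> 4 * (2 * cmod (a - b) / cmod b)"
    using norm_sgn_diff_le[OF assms, of a] by simp
  finally show ?thesis
    by simp
qed

definition hecke_sum :: "nat \<Rightarrow> complex" where
  "hecke_sum R = (\<Sum>z\<in>gball R. hecke (gz z))"

text \<open>Two approximations are made: dropping the shift \<open>c\<close> changes a summand by
  O(1 / |z|), which averages to 0, and passing from \<open>D R\<close> to \<open>gball R\<close>
  affects only the O(R) points of an annulus.\<close>

lemma hecke_sum_coset:
  fixes c w :: complex
  assumes w: "cmod w = 5" and c: "cmod c \<le> 24"
  defines "D \<equiv> \<lambda>R::nat. {z. cmod (w * gz z + c) \<le> real (5 * R)}"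
  shows "(\<lambda>R. ((\<Sum>z\<in>D R. hecke (w * gz z + c)) - hecke w * hecke_sum R) / of_nat (R\<^sup>2)) \<longlonglongrightarrow> 0"
proof -
  define h where "h = (\<lambda>z. hecke (w * gz z + c) - hecke (w * gz z))"
  define e where "e = (\<lambda>R. (\<Sum>z\<in>D R - gball R. hecke (w * gz z + c))
      - (\<Sum>z\<in>gball R - D R. hecke (w * gz z)) - (\<Sum>z\<in>gball R - D R. h z))"
  have D: "5 * cmod (gz z) - 24 \<le> cmod (w * gz z + c)" "cmod (w * gz z + c) \<le> 5 * cmod (gz z) + 24" for z
    using norm_triangle_ineq[of "w * gz z" c] norm_diff_ineq[of "w * gz z" c] w c
    by (simp_all add: norm_mult)
  have sub: "D R - gball R \<subseteq> annulus R" "gball R - D R \<subseteq> annulus R" for R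
  proof -
    show "D R - gball R \<subseteq> annulus R"
    proof
      fix z assume "z \<in> D R - gball R"
      then show "z \<in> annulus R"
        using D[of z] by (simp add: D_def gball_def annulus_def)
    qed
    show "gball R - D R \<subseteq> annulus R"
    proof
      fix z assume "z \<in> gball R - D R"
      then show "z \<in> annulus R"
        using D[of z] by (simp add: D_def gball_def annulus_def)
    qed
  qed
  have "D R \<subseteq> gball R \<union> annulus R" for R
    using sub(1) by blast
  then have finD: "finite (D R)" for R
    by (rule finite_subset) (simp add: finite_gball finite_annulus)
  have split: "(\<Sum>z\<in>D R. hecke (w * gz z + c)) - hecke w * hecke_sum R
      = (\<Sum>z\<in>gball R. h z) + e R" for R
  proof -
    have "(\<Sum>z\<in>D R. hecke (w * gz z + c))
        = (\<Sum>z\<in>D R \<inter> gball R. hecke (w * gz z + c)) + (\<Sum>z\<in>D R - gball R. hecke (w * gz z + c))"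
      by (rule sum.Int_Diff[OF finD])
    moreover have "hecke w * hecke_sum R
        = (\<Sum>z\<in>gball R \<inter> D R. hecke (w * gz z)) + (\<Sum>z\<in>gball R - D R. hecke (w * gz z))"
      unfolding hecke_sum_def
      by (simp add: sum.Int_Diff[OF finite_gball, of _ _ "D R"] hecke_mult distrib_left sum_distrib_left)
    moreover have "(\<Sum>z\<in>gball R. h z) = (\<Sum>z\<in>gball R \<inter> D R. h z) + (\<Sum>z\<in>gball R - D R. h z)"
      by (rule sum.Int_Diff[OF finite_gball])
    ultimately show ?thesis
      by (simp add: e_def h_def sum_subtractf Int_commute)
  qed
  have "(\<lambda>R. (\<Sum>z\<in>gball R. h z) / of_nat (R\<^sup>2)) \<longlonglongrightarrow> 0"
  proof (rule cesaro_square_tendsto_zero[OF finite_gball card_gball_le])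
    fix \<epsilon> :: real assume \<epsilon>: "\<epsilon> > 0"
    \<comment> \<open>The radius rounds up 8 * 24 / 5: 8 from the Lipschitz bound of
      \<open>hecke\<close>, 24 from the shift, 5 from the modulus of \<open>w\<close>.\<close>
    have "{z. \<epsilon> < cmod (h z)} \<subseteq> {z. cmod (gz z) \<le> 40 / \<epsilon>}"
    proof (intro subsetI CollectI)
      fix z assume "z \<in> {z. \<epsilon> < cmod (h z)}"
      then have z: "\<epsilon> < cmod (h z)"
        by simp
      show "cmod (gz z) \<le> 40 / \<epsilon>"
      proof (cases "gz z = 0")
        case False
        then have "cmod (h z) \<le> 8 * cmod c / (5 * cmod (gz z))"
          using norm_hecke_diff_le[of "w * gz z" "w * gz z + c"] w
          by (force simp: h_def norm_mult)
        also have "\<dots> \<le> 8 * 24 / (5 * cmod (gz z))"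
          using c by (intro divide_right_mono mult_left_mono) auto
        finally have "\<epsilon> < 8 * 24 / (5 * cmod (gz z))"
          using z by linarith
        then have "\<epsilon> * (5 * cmod (gz z)) < 8 * 24"
          using False by (simp add: pos_less_divide_eq)
        then show ?thesis
          using \<epsilon> by (simp add: pos_le_divide_eq mult.commute)
      qed (use \<epsilon> in simp)
    qed
    then show "finite {z. \<epsilon> < cmod (h z)}"
      by (rule finite_subset) (rule finite_cmod_gz_le)
  qed
  \<comment> \<open>The three sums in \<open>e\<close> have terms bounded by 1, 1 and 2, each over
    at most \<open>600 * R\<close> points.\<close>
  moreover have "(\<lambda>R. e R / of_nat (R\<^sup>2)) \<longlonglongrightarrow> 0"
  proof (rule linear_over_square_tendsto_zero[of 11 _ 2400])
    fix R :: nat assume R: "R \<ge> 11"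
    have h2: "cmod (h z) \<le> 2" for z
      unfolding h_def using norm_hecke_le[of "w * gz z + c"] norm_hecke_le[of "w * gz z"]
      by (intro order_trans[OF norm_triangle_ineq4]) linarith
    have cards: "real (card (D R - gball R)) \<le> real (card (annulus R))"
      "real (card (gball R - D R)) \<le> real (card (annulus R))"
      using sub finite_annulus by (simp_all add: card_mono)
    have "cmod (\<Sum>z\<in>D R - gball R. hecke (w * gz z + c)) \<le> real (card (D R - gball R)) * 1"
      by (rule sum_norm_bound) (rule norm_hecke_le)
    moreover have "cmod (\<Sum>z\<in>gball R - D R. hecke (w * gz z)) \<le> real (card (gball R - D R)) * 1"
      by (rule sum_norm_bound) (rule norm_hecke_le)
    moreover have "cmod (\<Sum>z\<in>gball R - D R. h z) \<le> real (card (gball R - D R)) * 2"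
      by (rule sum_norm_bound) (rule h2)
    moreover have "cmod (e R) \<le> cmod (\<Sum>z\<in>D R - gball R. hecke (w * gz z + c))
        + cmod (\<Sum>z\<in>gball R - D R. hecke (w * gz z)) + cmod (\<Sum>z\<in>gball R - D R. h z)"
      unfolding e_def
      by (intro order_trans[OF norm_triangle_ineq4] add_mono norm_triangle_ineq4 order_refl)
    ultimately show "cmod (e R) \<le> 2400 * real R"
      using card_annulus_le[OF R] cards by linarith
  qed
  ultimately have "(\<lambda>R. (\<Sum>z\<in>gball R. h z) / of_nat (R\<^sup>2) + e R / of_nat (R\<^sup>2)) \<longlonglongrightarrow> 0 + 0"
    by (rule tendsto_add)
  then show ?thesis
    by (simp add: split add_divide_distrib)
qed

text \<open>The bijection \<open>T\<close> says that the cosets \<open>w * gz z + c j\<close>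
  partition the Gaussian integers; an ideal generated by an element of modulus 5 has index 25. By
  multiplicativity each coset contributes \<open>hecke w * hecke_sum R\<close>
  asymptotically.\<close>

lemma hecke_sum_dilation:
  fixes w :: complex and J :: "'j set" and c :: "'j \<Rightarrow> complex"
    and T :: "(int \<times> int) \<times> 'j \<Rightarrow> int \<times> int"
  assumes w: "cmod w = 5" and J: "finite J" "card J = 25" and c: "\<And>j. j \<in> J \<Longrightarrow> cmod (c j) \<le> 24"
    and T: "bij_betw T (UNIV \<times> J) UNIV" "\<And>z j. j \<in> J \<Longrightarrow> gz (T (z, j)) = w * gz z + c j"
  shows "(\<lambda>R. (hecke_sum (5 * R) - 25 * hecke w * hecke_sum R) / of_nat (R\<^sup>2)) \<longlonglongrightarrow> 0"
proof -
  define D where "D = (\<lambda>j R. {z. cmod (w * gz z + c j) \<le> real (5 * R)})"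
  have "bij_betw T {p \<in> UNIV \<times> J. T p \<in> gball (5 * R)} (gball (5 * R))" for R
  proof (rule bij_betw_subset[OF T(1)])
    have "gball (5 * R) \<subseteq> T ` (UNIV \<times> J)"
      using T(1) by (auto simp: bij_betw_def)
    then show "T ` {p \<in> UNIV \<times> J. T p \<in> gball (5 * R)} = gball (5 * R)"
      by blast
  qed auto
  then have bij: "hecke_sum (5 * R) = (\<Sum>p\<in>{p \<in> UNIV \<times> J. T p \<in> gball (5 * R)}. hecke (gz (T p)))" for R
    unfolding hecke_sum_def by (rule sum.reindex_bij_betw[symmetric])
  have fin: "finite (D j R)" if "j \<in> J" for j R
  proof (rule finite_subset[OF _ finite_cmod_gz_le[of "real R + 5"]])
    show "D j R \<subseteq> {z. cmod (gz z) \<le> real R + 5}"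
    proof
      fix z assume "z \<in> D j R"
      then show "z \<in> {z. cmod (gz z) \<le> real R + 5}"
        using norm_diff_ineq[of "w * gz z" "c j"] c[OF that] w by (simp add: D_def norm_mult)
    qed
  qed
  have "hecke_sum (5 * R) = (\<Sum>j\<in>J. \<Sum>z\<in>D j R. hecke (w * gz z + c j))" for R
  proof -
    have "(\<Sum>j\<in>J. \<Sum>z\<in>D j R. hecke (w * gz z + c j))
        = (\<Sum>(j, z)\<in>Sigma J (\<lambda>j. D j R). hecke (w * gz z + c j))"
      using J fin by (intro sum.Sigma) auto
    also have "\<dots> = (\<Sum>p\<in>{p \<in> UNIV \<times> J. T p \<in> gball (5 * R)}. hecke (gz (T p)))"
      by (rule sum.reindex_bij_witness[of _ "\<lambda>(z, j). (j, z)" "\<lambda>(j, z). (z, j)"])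
        (auto simp: D_def gball_def T(2))
    finally show ?thesis
      using bij by simp
  qed
  then have "(\<lambda>R. (hecke_sum (5 * R) - 25 * hecke w * hecke_sum R) / of_nat (R\<^sup>2))
      = (\<lambda>R. \<Sum>j\<in>J. ((\<Sum>z\<in>D j R. hecke (w * gz z + c j)) - hecke w * hecke_sum R) / of_nat (R\<^sup>2))"
    by (simp add: sum_divide_distrib[symmetric] sum_subtractf J mult.assoc)
  moreover have "(\<lambda>R. \<Sum>j\<in>J. ((\<Sum>z\<in>D j R. hecke (w * gz z + c j)) - hecke w * hecke_sum R) / of_nat (R\<^sup>2))
      \<longlonglongrightarrow> (\<Sum>j\<in>J. 0)"
    unfolding D_def by (intro tendsto_sum hecke_sum_coset w c)
  ultimately show ?thesis
    by simp
qed

lemma hecke_sum_dilation_5: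
  "(\<lambda>R. (hecke_sum (5 * R) - 25 * hecke_sum R) / of_nat (R\<^sup>2)) \<longlonglongrightarrow> 0"
proof -
  define T :: "(int \<times> int) \<times> (int \<times> int) \<Rightarrow> int \<times> int"
    where "T = (\<lambda>((a, b), (i, j)). (5 * a + i, 5 * b + j))"
  have "bij_betw T (UNIV \<times> ({0..<5} \<times> {0..<5})) UNIV"
    by (rule bij_betwI[where g = "\<lambda>(x, y). ((x div 5, y div 5), (x mod 5, y mod 5))"])
      (auto simp: T_def)
  moreover have "gz (T (z, j)) = 5 * gz z + gz j" for z j
    by (cases z; cases j) (simp add: T_def gz_def complex_eq_iff)
  moreover have "cmod (gz j) \<le> 24" if "j \<in> {0..<5} \<times> {0..<5}" for j
  proof -
    have "cmod (gz j) \<le> \<bar>Re (gz j)\<bar> + \<bar>Im (gz j)\<bar>"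
      by (rule cmod_le)
    also have "\<dots> \<le> 5 + 5"
      using that by (intro add_mono) (auto simp: gz_def)
    finally show ?thesis
      by simp
  qed
  ultimately have "(\<lambda>R. (hecke_sum (5 * R) - 25 * hecke 5 * hecke_sum R) / of_nat (R\<^sup>2)) \<longlonglongrightarrow> 0"
    by (intro hecke_sum_dilation[where T = T and J = "{0..<5} \<times> {0..<5}" and c = gz]) auto
  moreover have "hecke 5 = 1"
    by (simp add: hecke_def sgn_div_norm scaleR_conv_of_real)
  ultimately show ?thesis
    by simp
qed

text \<open>Multiplication by \<open>3 + 4 i\<close> has the same modulus as multiplication by \<open>5\<close>; the integers
  \<open>0, \<dots>, 24\<close> represent the cosets of its image.\<close>
lemma hecke_sum_dilation_3_4:
  "(\<lambda>R. (hecke_sum (5 * R) - 25 * hecke (Complex 3 4) * hecke_sum R) / of_nat (R\<^sup>2)) \<longlonglongrightarrow> 0"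
proof -
  define T :: "(int \<times> int) \<times> int \<Rightarrow> int \<times> int"
    where "T = (\<lambda>((a, b), j). (3 * a - 4 * b + j, 4 * a + 3 * b))"
  \<comment> \<open>Modulo 3 + 4 i the unit i is congruent to -7, so the residue of x + i y is
    \<open>x - 7 * y\<close> modulo 25. The quotient \<open>m\<close> equals
    \<open>- (a + b)\<close>; together with \<open>4 * a + 3 * b = y\<close> it determines a and
    b.\<close>
  define S :: "int \<times> int \<Rightarrow> (int \<times> int) \<times> int"
    where "S = (\<lambda>(x, y). let m = (x - 7 * y) div 25 in
      ((y + 3 * m, - y - 4 * m), (x - 7 * y) mod 25))"
  have "S (T ((a, b), j)) = ((a, b), j)" if "0 \<le> j" "j < 25" for a b j
  proof -
    have eq: "3 * a - 4 * b + j - 7 * (4 * a + 3 * b) = j + 25 * (- a - b)"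
      by simp
    have "(j + 25 * (- a - b)) div 25 = - a - b" "(j + 25 * (- a - b)) mod 25 = j"
      using that by (simp_all only: div_mult_self2 mod_mult_self2) simp_all
    then show ?thesis
      by (simp only: T_def S_def prod.case eq Let_def) simp
  qed
  moreover have "T (S (x, y)) = (x, y)" for x y
    using div_mult_mod_eq[of "x - 7 * y" 25] by (simp add: T_def S_def Let_def) 
  ultimately have "bij_betw T (UNIV \<times> {0..<25}) UNIV"
    by (intro bij_betwI[where g = S]) (auto simp: S_def Let_def)
  moreover have "gz (T (z, j)) = Complex 3 4 * gz z + of_int j" for z j
    by (cases z) (simp add: T_def gz_def complex_eq_iff)
  moreover have "cmod (Complex 3 4) = 5"
    by (simp add: cmod_def)
  ultimately show ?thesis
    by (intro hecke_sum_dilation[where T = T and J = "{0..<25::int}" and c = of_int]) auto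
qed

lemma hecke_sum_small: "(\<lambda>R. hecke_sum R / of_nat (R\<^sup>2)) \<longlonglongrightarrow> 0"
proof -
  define d where "d = 25 * (hecke (Complex 3 4) - 1)"
  have "sgn (Complex 3 4) = Complex (3/5) (4/5)"
    by (simp add: sgn_div_norm cmod_def complex_eq_iff)
  then have "hecke (Complex 3 4) \<noteq> 1"
    by (simp add: hecke_def power4_eq_xxxx complex_eq_iff)
  then have d: "d \<noteq> 0"
    by (simp add: d_def)
  have "(\<lambda>R. (hecke_sum (5 * R) - 25 * hecke_sum R) / of_nat (R\<^sup>2)
      - (hecke_sum (5 * R) - 25 * hecke (Complex 3 4) * hecke_sum R) / of_nat (R\<^sup>2)) \<longlonglongrightarrow> 0 - 0"
    by (intro tendsto_diff hecke_sum_dilation_5 hecke_sum_dilation_3_4)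
  also have "(\<lambda>R. (hecke_sum (5 * R) - 25 * hecke_sum R) / of_nat (R\<^sup>2)
      - (hecke_sum (5 * R) - 25 * hecke (Complex 3 4) * hecke_sum R) / of_nat (R\<^sup>2))
      = (\<lambda>R. d * (hecke_sum R / of_nat (R\<^sup>2)))"
    unfolding d_def by (simp add: algebra_simps diff_divide_distrib)
  finally have "(\<lambda>R. inverse d * (d * (hecke_sum R / of_nat (R\<^sup>2)))) \<longlonglongrightarrow> inverse d * 0"
    by (intro tendsto_mult_left) simp
  then show ?thesis
    using d by (simp add: mult.assoc[symmetric])
qed

section \<open>Averages over the quarter disc\<close>

definition qball :: "nat \<Rightarrow> (nat \<times> nat) set" where
  "qball R = {l. lnorm l \<le> real R}"

lemma qball_subset: "qball R \<subseteq> {0..R} \<times> {0..R}"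
proof
  fix l assume "l \<in> qball R"
  then have "lnorm l \<le> real R"
    by (simp add: qball_def)
  moreover have "real (fst l) \<le> lnorm l" "real (snd l) \<le> lnorm l"
    unfolding lnorm_def by (rule real_sqrt_sum_squares_ge1 real_sqrt_sum_squares_ge2)+
  ultimately have "real (fst l) \<le> real R" "real (snd l) \<le> real R"
    by linarith+
  then show "l \<in> {0..R} \<times> {0..R}"
    by (cases l) auto
qed

lemma finite_qball: "finite (qball R)"
  by (rule finite_subset[OF qball_subset]) simp

lemma card_qball_le:
  assumes "R \<ge> 1"
  shows "real (card (qball R)) \<le> 4 * (real R)\<^sup>2"
proof -
  have "card (qball R) \<le> card ({0..R} \<times> {0..R})"
    by (rule card_mono[OF _ qball_subset]) simp
  also have "\<dots> \<le> (2 * R) * (2 * R)"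
    using assms by (simp only: card_cartesian_product card_atLeastAtMost) (intro mult_mono; simp)
  finally have "real (card (qball R)) \<le> real ((2 * R) * (2 * R))"
    by (simp only: of_nat_le_iff)
  then show ?thesis
    by (simp add: power2_eq_square)
qed

lemma card_qball_ge: "(real R)\<^sup>2 / 4 \<le> real (card (qball R))"
proof -
  \<comment> \<open>A square of side R / 2 fits into the quarter disc; counting 0 as well makes up
    for the rounding in \<open>R div 2\<close>.\<close>
  have "{0..R div 2} \<times> {0..R div 2} \<subseteq> qball R"
  proof
    fix l assume "l \<in> {0..R div 2} \<times> {0..R div 2}"
    then have "real (fst l) \<le> real R / 2" "real (snd l) \<le> real R / 2"
      by (auto simp: mem_Times_iff)
    then have "(real (fst l))\<^sup>2 \<le> (real R / 2)\<^sup>2" "(real (snd l))\<^sup>2 \<le> (real R / 2)\<^sup>2"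
      by (intro power_mono; simp)+
    then have "(real (fst l))\<^sup>2 \<le> (real R)\<^sup>2 / 4" "(real (snd l))\<^sup>2 \<le> (real R)\<^sup>2 / 4"
      by (simp_all add: power_divide)
    then have "(real (fst l))\<^sup>2 + (real (snd l))\<^sup>2 \<le> (real R)\<^sup>2"
      using zero_le_power2[of "real R"] by linarith
    then show "l \<in> qball R"
      by (simp add: qball_def lnorm_def real_le_lsqrt)
  qed
  then have "card ({0..R div 2} \<times> {0..R div 2}) \<le> card (qball R)"
    by (rule card_mono[OF finite_qball])
  then have "Suc (R div 2) * Suc (R div 2) \<le> card (qball R)"
    by (simp only: card_cartesian_product) simp
  then have "real (Suc (R div 2) * Suc (R div 2)) \<le> real (card (qball R))"
    by (simp only: of_nat_le_iff)
  moreover have "real R / 2 \<le> real (Suc (R div 2))"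
    by linarith
  then have "(real R / 2) * (real R / 2) \<le> real (Suc (R div 2)) * real (Suc (R div 2))"
    by (intro mult_mono) auto
  ultimately have "(real R / 2) * (real R / 2) \<le> real (card (qball R))"
    unfolding of_nat_mult by linarith
  then show ?thesis
    by (simp add: power2_eq_square)
qed

lemma card_qball_strip:
  assumes "R \<ge> 1"
  shows "real (card {l \<in> qball R. fst l \<le> a \<or> snd l \<le> b}) \<le> 2 * real (a + b + 2) * real R"
proof -
  have "{l \<in> qball R. fst l \<le> a \<or> snd l \<le> b} \<subseteq> {0..a} \<times> {0..R} \<union> {0..R} \<times> {0..b}"
    using qball_subset[of R] by auto
  then have "card {l \<in> qball R. fst l \<le> a \<or> snd l \<le> b} \<le> card ({0..a} \<times> {0..R} \<union> {0..R} \<times> {0..b})"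
    by (rule card_mono[rotated]) simp
  also have "\<dots> \<le> card ({0..a} \<times> {0..R}) + card ({0..R} \<times> {0..b})"
    by (rule card_Un_le)
  also have "\<dots> = (a + b + 2) * (R + 1)"
    by (simp add: card_cartesian_product algebra_simps)
  also have "\<dots> \<le> (a + b + 2) * (2 * R)"
    using assms by (intro mult_left_mono) auto
  finally have "real (card {l \<in> qball R. fst l \<le> a \<or> snd l \<le> b}) \<le> real ((a + b + 2) * (2 * R))"
    by (simp only: of_nat_le_iff)
  then show ?thesis
    by (simp add: algebra_simps)
qed

text \<open>This is cos (4 \<theta>) = 1 - 8 cos^2 \<theta> sin^2 \<theta>. Here the coordinates
  enter only through their squares, which is the reflection symmetry used to pass to a
  quadrant.\<close>

lemma Re_hecke_gz:
  assumes "z \<noteq> (0, 0)"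
  defines "x \<equiv> real_of_int (fst z)" and "y \<equiv> real_of_int (snd z)"
  shows "Re (hecke (gz z)) = 1 - 8 * (x\<^sup>2 * y\<^sup>2 / (x\<^sup>2 + y\<^sup>2)\<^sup>2)"
proof -
  define r where "r = cmod (gz z)"
  have r2: "r\<^sup>2 = x\<^sup>2 + y\<^sup>2"
    by (simp add: r_def cmod_gz x_def y_def)
  have "x \<noteq> 0 \<or> y \<noteq> 0"
    using assms by (cases z) auto
  then have pos: "x\<^sup>2 + y\<^sup>2 \<noteq> 0"
    by (simp add: sum_power2_eq_zero_iff)
  then have r0: "r \<noteq> 0"
    using r2 by auto
  have "sgn (gz z) = Complex (x / r) (y / r)"
    by (simp add: sgn_div_norm r_def complex_eq_iff gz_def x_def y_def divide_inverse mult.commute)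
  then have "Re (hecke (gz z)) = (x / r)^4 - 6 * (x / r)\<^sup>2 * (y / r)\<^sup>2 + (y / r)^4"
    by (simp add: hecke_def power4_eq_xxxx power2_eq_square algebra_simps)
  also have "\<dots> = ((x / r)\<^sup>2 + (y / r)\<^sup>2)\<^sup>2 - 8 * ((x / r)\<^sup>2 * (y / r)\<^sup>2)"
    by algebra
  also have "(x / r)\<^sup>2 + (y / r)\<^sup>2 = 1"
    using pos by (simp add: power_divide r2 add_divide_distrib[symmetric])
  also have "(x / r)\<^sup>2 * (y / r)\<^sup>2 = x\<^sup>2 * y\<^sup>2 / (x\<^sup>2 + y\<^sup>2)\<^sup>2"
    by (simp add: power_divide r2 power2_eq_square[of "x\<^sup>2 + y\<^sup>2"])
  finally show ?thesis
    by simp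
qed

text \<open>Off the axes every point of the open quadrant stands for four points of the disc with
  the same value, one for each pair of signs; the axes hold only O(R) points.\<close>

lemma hecke_quadrant_sum:
  "(\<lambda>R. (\<Sum>l\<in>qball R. Re (hecke (gz (int (fst l), int (snd l))))) / of_nat (R\<^sup>2)) \<longlonglongrightarrow> 0"
proof -
  define f where "f = (\<lambda>z. Re (hecke (gz z)))"
  define g where "g = (\<lambda>l :: nat \<times> nat. f (int (fst l), int (snd l)))"
  define P where "P = (\<lambda>R. {l \<in> qball R. \<not> (fst l \<le> 0 \<or> snd l \<le> 0)})"
  define A where "A = (\<lambda>R. {z \<in> gball R. fst z \<noteq> 0 \<and> snd z \<noteq> 0})"
  have f_le: "\<bar>f z\<bar> \<le> 1" for z
    unfolding f_def using abs_Re_le_cmod[of "hecke (gz z)"] norm_hecke_le[of "gz z"] by linarith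
  have f_abs: "f z = g (nat \<bar>fst z\<bar>, nat \<bar>snd z\<bar>)" for z
  proof (cases "z = (0, 0)")
    case False
    then have "(int (nat \<bar>fst z\<bar>), int (nat \<bar>snd z\<bar>)) \<noteq> (0, 0)"
      by (cases z) auto
    then show ?thesis
      unfolding f_def g_def using False by (simp add: Re_hecke_gz)
  qed (simp add: f_def g_def)
  have quad: "(\<Sum>z\<in>A R. f z) = 4 * (\<Sum>l\<in>P R. g l)" for R
  proof -
    have "(\<Sum>z\<in>A R. f z) = (\<Sum>p\<in>({1, - 1 :: int} \<times> {1, - 1 :: int}) \<times> P R. g (snd p))"
    proof -
      define i :: "(int \<times> int) \<times> (nat \<times> nat) \<Rightarrow> int \<times> int"
        where "i = (\<lambda>p. (fst (fst p) * int (fst (snd p)), snd (fst p) * int (snd (snd p))))"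
      define j :: "int \<times> int \<Rightarrow> (int \<times> int) \<times> (nat \<times> nat)"
        where "j = (\<lambda>z. ((sgn (fst z), sgn (snd z)), (nat \<bar>fst z\<bar>, nat \<bar>snd z\<bar>)))"
      show ?thesis
      proof (rule sum.reindex_bij_witness[of _ i j])
        fix z assume z: "z \<in> A R"
        show "i (j z) = z"
          by (simp add: i_def j_def sgn_mult_abs)
        show "j z \<in> ({1, - 1} \<times> {1, - 1}) \<times> P R"
          using z by (auto simp: j_def A_def P_def gball_def qball_def cmod_gz lnorm_def sgn_if)
        show "g (snd (j z)) = f z"
          by (simp add: j_def f_abs)
      next
        fix p :: "(int \<times> int) \<times> (nat \<times> nat)" assume p: "p \<in> ({1, - 1} \<times> {1, - 1}) \<times> P R"
        show "j (i p) = p"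
          using p by (auto simp: i_def j_def P_def)
        show "i p \<in> A R"
          using p by (auto simp: i_def A_def P_def gball_def qball_def cmod_gz lnorm_def)
      qed
    qed
    also have "\<dots> = (\<Sum>s\<in>{1, - 1 :: int} \<times> {1, - 1 :: int}. \<Sum>l\<in>P R. g l)"
      unfolding sum.cartesian_product by (simp add: case_prod_beta)
    also have "\<dots> = 4 * (\<Sum>l\<in>P R. g l)"
      by (simp add: card_cartesian_product)
    finally show ?thesis .
  qed
  define e where "e = (\<lambda>R. (\<Sum>z\<in>gball R - A R. f z) - 4 * (\<Sum>l\<in>{l \<in> qball R. fst l \<le> 0 \<or> snd l \<le> 0}. g l))"
  have split: "4 * (\<Sum>l\<in>qball R. g l) = Re (hecke_sum R) - e R" for R
  proof -
    have "Re (hecke_sum R) = (\<Sum>z\<in>gball R. f z)"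
      by (simp add: hecke_sum_def f_def Re_sum)
    also have "\<dots> = (\<Sum>z\<in>A R. f z) + (\<Sum>z\<in>gball R - A R. f z)"
      using sum.subset_diff[of "A R" "gball R" f] finite_gball[of R] by (simp add: A_def add.commute)
    finally have 1: "Re (hecke_sum R) = (\<Sum>z\<in>A R. f z) + (\<Sum>z\<in>gball R - A R. f z)" .
    have "qball R - P R = {l \<in> qball R. fst l \<le> 0 \<or> snd l \<le> 0}"
      by (auto simp: P_def)
    then have "(\<Sum>l\<in>qball R. g l) = (\<Sum>l\<in>P R. g l) + (\<Sum>l\<in>{l \<in> qball R. fst l \<le> 0 \<or> snd l \<le> 0}. g l)"
      using sum.subset_diff[of "P R" "qball R" g] finite_qball[of R] by (simp add: P_def add.commute)
    then show ?thesis
      using 1 quad[of R] by (simp add: e_def)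
  qed
  \<comment> \<open>The axes contribute at most \<open>6 * R\<close> for the disc and four times
    \<open>4 * R\<close> for the quadrant, which 24 covers.\<close>
  have "(\<lambda>R. e R / of_nat (R\<^sup>2)) \<longlonglongrightarrow> 0"
  proof (rule linear_over_square_tendsto_zero[of 1 _ 24])
    fix R :: nat assume R: "R \<ge> 1"
    have "gball R - A R \<subseteq> {0} \<times> {- int R..int R} \<union> {- int R..int R} \<times> {0}"
      using cmod_gz_le_box[of _ R] by (force simp: gball_def A_def)
    then have "card (gball R - A R) \<le> card ({0::int} \<times> {- int R..int R} \<union> {- int R..int R} \<times> {0::int})"
      by (rule card_mono[rotated]) simp
    also have "\<dots> \<le> card ({0::int} \<times> {- int R..int R}) + card ({- int R..int R} \<times> {0::int})"
      by (rule card_Un_le)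
    also have "\<dots> \<le> 6 * R"
      using R by (simp add: card_cartesian_product)
    finally have c1: "card (gball R - A R) \<le> 6 * R" .
    have "\<bar>\<Sum>z\<in>gball R - A R. f z\<bar> \<le> real (card (gball R - A R)) * 1"
      using sum_norm_bound[of "gball R - A R" f 1] f_le by simp
    moreover have "\<bar>\<Sum>l\<in>{l \<in> qball R. fst l \<le> 0 \<or> snd l \<le> 0}. g l\<bar>
        \<le> real (card {l \<in> qball R. fst l \<le> 0 \<or> snd l \<le> 0}) * 1"
      using sum_norm_bound[of "{l \<in> qball R. fst l \<le> 0 \<or> snd l \<le> 0}" g 1] f_le by (simp add: g_def)
    moreover have "real (card {l \<in> qball R. fst l \<le> 0 \<or> snd l \<le> 0}) \<le> 4 * real R"
      using card_qball_strip[OF R, of 0 0] by simp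
    ultimately show "norm (e R) \<le> 24 * real R"
      using c1 by (simp add: e_def)
  qed
  moreover have "(\<lambda>R. Re (hecke_sum R / of_nat (R\<^sup>2))) \<longlonglongrightarrow> Re 0"
    by (intro tendsto_Re hecke_sum_small)
  ultimately have "(\<lambda>R. (1/4) * (Re (hecke_sum R / of_nat (R\<^sup>2)) - e R / of_nat (R\<^sup>2))) \<longlonglongrightarrow> (1/4) * (Re 0 - 0)"
    by (intro tendsto_mult_left tendsto_diff)
  moreover have "(1/4) * (Re (hecke_sum R / of_nat (R\<^sup>2)) - e R / of_nat (R\<^sup>2))
      = (\<Sum>l\<in>qball R. g l) / of_nat (R\<^sup>2)" for R
  proof -
    have "Re (hecke_sum R / of_nat (R\<^sup>2)) = Re (hecke_sum R) / of_nat (R\<^sup>2)"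
      by (metis Re_divide_of_real of_real_of_nat_eq)
    then show ?thesis
      by (simp add: diff_divide_distrib[symmetric] split[of R, symmetric])
  qed
  ultimately have "(\<lambda>R. (\<Sum>l\<in>qball R. g l) / of_nat (R\<^sup>2)) \<longlonglongrightarrow> (1/4) * (Re 0 - 0)"
    by (simp only:)
  then show ?thesis
    by (simp add: g_def f_def)
qed

text \<open>Write M = x^2 y^2 / Q, A = x^4 / Q and B = y^4 / Q, so that A + 2 M + B = 1. The mean of
  M is 1/8 because 8 M = 1 - \<open>H\<close>, and A - B is odd under exchanging the coordinates, so
  A and B share the mean 3/8.\<close>

lemma quartic_average:
  fixes a b c :: real
  defines "F \<equiv> \<lambda>l :: nat \<times> nat. (a * real (fst l)^4 + b * ((real (fst l))\<^sup>2 * (real (snd l))\<^sup>2) + c * real (snd l)^4)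
     / ((real (fst l))\<^sup>2 + (real (snd l))\<^sup>2)\<^sup>2"
  shows "(\<lambda>R. (\<Sum>l\<in>qball R. F l - (3 * a + b + 3 * c) / 8) / of_nat (R\<^sup>2)) \<longlonglongrightarrow> 0"
proof -
  define q where "q = (\<lambda>l :: nat \<times> nat. (real (fst l))\<^sup>2 + (real (snd l))\<^sup>2)"
  define H where "H = (\<lambda>l :: nat \<times> nat. Re (hecke (gz (int (fst l), int (snd l)))))"
  define d where "d = (\<lambda>l :: nat \<times> nat. (real (fst l)^4 - real (snd l)^4) / (q l)\<^sup>2)"
  have anti: "(\<Sum>l\<in>qball R. d l) = 0" for R
  proof -
    have "(\<Sum>l\<in>qball R. d l) = (\<Sum>l\<in>qball R. d (snd l, fst l))"
      by (rule sum.reindex_bij_witness[of _ prod.swap prod.swap])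
        (auto simp: qball_def lnorm_def add.commute)
    also have "\<dots> = - (\<Sum>l\<in>qball R. d l)"
      by (simp add: sum_negf[symmetric] d_def q_def add.commute minus_divide_left del: minus_divide_left[symmetric])
    finally show ?thesis
      by simp
  qed
  \<comment> \<open>At the origin \<open>F\<close>, \<open>H\<close> and \<open>d\<close> are all 0,
    by \<open>x / 0 = 0\<close> and \<open>sgn 0 = 0\<close>, which leaves the constant as a
    correction.\<close>
  have F: "F l - (3 * a + b + 3 * c) / 8 = (a - b + c) / 8 * H l + (a - c) / 2 * d l
      - (if l = (0, 0) then (3 * a + b + 3 * c) / 8 else 0)" for l
  proof (cases "l = (0, 0)")
    case True
    then show ?thesis
      by (simp add: F_def H_def d_def hecke_def gz_def complex_eq_iff)
  next
    case False
    define x y where "x = real (fst l)" and "y = real (snd l)"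
    have "x \<noteq> 0 \<or> y \<noteq> 0"
      using False by (cases l) (auto simp: x_def y_def)
    then have "x\<^sup>2 + y\<^sup>2 \<noteq> 0"
      by (simp add: sum_power2_eq_zero_iff)
    then have q: "(x\<^sup>2 + y\<^sup>2)\<^sup>2 \<noteq> 0"
      by simp
    have "(int (fst l), int (snd l)) \<noteq> (0, 0)"
      using False by (cases l) auto
    from Re_hecke_gz[OF this] have "H l = 1 - 8 * (x\<^sup>2 * y\<^sup>2 / (x\<^sup>2 + y\<^sup>2)\<^sup>2)"
      by (simp add: H_def x_def y_def)
    moreover have "d l = (x^4 - y^4) / (x\<^sup>2 + y\<^sup>2)\<^sup>2"
      by (simp add: d_def q_def x_def y_def)
    moreover have "F l = (a * x^4 + b * (x\<^sup>2 * y\<^sup>2) + c * y^4) / (x\<^sup>2 + y\<^sup>2)\<^sup>2"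
      by (simp add: F_def x_def y_def)
    moreover have "(a * x^4 + b * (x\<^sup>2 * y\<^sup>2) + c * y^4) / Q - (3 * a + b + 3 * c) / 8
        = (a - b + c) / 8 * (1 - 8 * (x\<^sup>2 * y\<^sup>2 / Q)) + (a - c) / 2 * ((x^4 - y^4) / Q)"
      if "Q \<noteq> 0" "Q = (x\<^sup>2 + y\<^sup>2)\<^sup>2" for Q
    proof -
      have "y^4 = Q - 2 * (x\<^sup>2 * y\<^sup>2) - x^4"
        unfolding that(2) by algebra
      then have y4: "y^4 / Q = 1 - 2 * (x\<^sup>2 * y\<^sup>2 / Q) - x^4 / Q"
        using that(1) by (simp add: diff_divide_distrib)
      have "(a * x^4 + b * (x\<^sup>2 * y\<^sup>2) + c * y^4) / Q
          = a * (x^4 / Q) + b * (x\<^sup>2 * y\<^sup>2 / Q) + c * (y^4 / Q)"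
        "(x^4 - y^4) / Q = x^4 / Q - y^4 / Q"
        by (simp_all add: add_divide_distrib diff_divide_distrib)
      moreover have "a * A + b * M + c * B - (3 * a + b + 3 * c) / 8
          = (a - b + c) / 8 * (1 - 8 * M) + (a - c) / 2 * (A - B)" if "B = 1 - 2 * M - A" for A B M
        unfolding that by (simp add: field_simps)
      ultimately show ?thesis
        using y4 by metis
    qed
    ultimately show ?thesis
      using q False by simp
  qed
  define e where "e = (\<lambda>R. \<Sum>l\<in>qball R. (if l = (0, 0) then (3 * a + b + 3 * c) / 8 else 0))"
  have sum: "(\<Sum>l\<in>qball R. F l - (3 * a + b + 3 * c) / 8) = (a - b + c) / 8 * (\<Sum>l\<in>qball R. H l) - e R" for R
  proof -
    have "(\<Sum>l\<in>qball R. F l - (3 * a + b + 3 * c) / 8)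
        = (\<Sum>l\<in>qball R. (a - b + c) / 8 * H l) + (\<Sum>l\<in>qball R. (a - c) / 2 * d l) - e R"
      unfolding F e_def by (simp only: sum.distrib sum_subtractf)
    then show ?thesis
      by (simp only: sum_distrib_left[symmetric] anti mult_zero_right add_0_right)
  qed
  have "(\<lambda>R. e R / of_nat (R\<^sup>2)) \<longlonglongrightarrow> 0"
  proof (rule linear_over_square_tendsto_zero[of 1 _ "\<bar>(3 * a + b + 3 * c) / 8\<bar>"])
    fix R :: nat assume R: "R \<ge> 1"
    have "norm (e R) \<le> \<bar>(3 * a + b + 3 * c) / 8\<bar>"
      by (simp add: e_def sum.delta finite_qball)
    also have "\<dots> \<le> \<bar>(3 * a + b + 3 * c) / 8\<bar> * real R"
      using R by (simp add: mult_le_cancel_left1)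
    finally show "norm (e R) \<le> \<bar>(3 * a + b + 3 * c) / 8\<bar> * real R" .
  qed
  then have "(\<lambda>R. (a - b + c) / 8 * ((\<Sum>l\<in>qball R. H l) / of_nat (R\<^sup>2)) - e R / of_nat (R\<^sup>2))
      \<longlonglongrightarrow> (a - b + c) / 8 * 0 - 0"
    unfolding H_def by (intro tendsto_diff tendsto_mult_left hecke_quadrant_sum)
  then show ?thesis
    by (simp add: sum diff_divide_distrib)
qed

section \<open>Brackets of products of cosines\<close>

lemma integral_cos_affine:
  "integral {0..2 * pi} (\<lambda>t. cos (of_int m * t + a)) = (if m = 0 then 2 * pi * cos a else 0)"
proof (cases "m = 0")
  case False
  have "((\<lambda>t. cos (of_int m * t + a)) has_integral
      (sin (of_int m * (2 * pi) + a) / of_int m - sin (of_int m * 0 + a) / of_int m)) {0..2 * pi}"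
    by (rule fundamental_theorem_of_calculus)
      (use False in \<open>auto intro!: derivative_eq_intros
        simp: has_real_derivative_iff_has_vector_derivative[symmetric]\<close>)
  moreover have "sin (of_int m * (2 * pi) + a) = sin a"
    using cos_int_2pin[of m] sin_int_2pin[of m] by (simp add: sin_add mult.commute)
  ultimately show ?thesis
    using False by (simp add: integral_unique)
qed simp

lemma integral_sin_sin:
  "integral {0..2 * pi} (\<lambda>t. sin (of_int m * t + a) * sin (of_int n * t + b))
   = pi * ((if m = n then cos (a - b) else 0) - (if m = - n then cos (a + b) else 0))"
proof -
  have "(\<lambda>t. sin (of_int m * t + a) * sin (of_int n * t + b))
      = (\<lambda>t. (1/2) * cos (of_int (m - n) * t + (a - b)) - (1/2) * cos (of_int (m + n) * t + (a + b)))"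
    by (auto simp: sin_times_sin algebra_simps diff_divide_distrib)
  then have "integral {0..2 * pi} (\<lambda>t. sin (of_int m * t + a) * sin (of_int n * t + b))
      = (1/2) * integral {0..2 * pi} (\<lambda>t. cos (of_int (m - n) * t + (a - b)))
      - (1/2) * integral {0..2 * pi} (\<lambda>t. cos (of_int (m + n) * t + (a + b)))"
    by (simp only:) (subst integral_diff; auto intro!: integrable_continuous_interval continuous_intros)
  moreover have "m - n = 0 \<longleftrightarrow> m = n" "m + n = 0 \<longleftrightarrow> m = - n"
    by linarith+
  ultimately show ?thesis
    by (simp only: integral_cos_affine) (simp add: right_diff_distrib)
qed

lemma integral_cos_cos:
  "integral {0..2 * pi} (\<lambda>t. cos (real m * t + a) * cos (real n * t + b))
   = (if m = n then if m = 0 then 2 * pi * (cos a * cos b) else pi * cos (a - b) else 0)"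
proof -
  have "(\<lambda>t. cos (real m * t + a) * cos (real n * t + b))
      = (\<lambda>t. (1/2) * cos (of_int (int m - int n) * t + (a - b))
          + (1/2) * cos (of_int (int m + int n) * t + (a + b)))"
    by (auto simp: cos_times_cos algebra_simps add_divide_distrib)
  then have "integral {0..2 * pi} (\<lambda>t. cos (real m * t + a) * cos (real n * t + b))
      = (1/2) * integral {0..2 * pi} (\<lambda>t. cos (of_int (int m - int n) * t + (a - b)))
      + (1/2) * integral {0..2 * pi} (\<lambda>t. cos (of_int (int m + int n) * t + (a + b)))"
    by (simp only:) (subst integral_add; auto intro!: integrable_continuous_interval continuous_intros)
  then have "integral {0..2 * pi} (\<lambda>t. cos (real m * t + a) * cos (real n * t + b))
      = (1/2) * (if m = n then 2 * pi * cos (a - b) else 0)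
      + (1/2) * (if m = 0 \<and> n = 0 then 2 * pi * cos (a + b) else 0)"
    unfolding integral_cos_affine by simp
  then show ?thesis
    by (cases "m = n") (auto simp: cos_times_cos distrib_left)
qed

text \<open>The common form of the direction \<open>xi k a\<close> and of all four types of basis
  functions: a sine is a cosine with phase \<open>- pi / 2\<close>, and the argument of
  \<open>a\<close> becomes a phase.\<close>

definition cc :: "real \<Rightarrow> nat \<times> nat \<Rightarrow> real \<Rightarrow> real \<Rightarrow> rfun" where
  "cc c k a b = (\<lambda>x. c * (cos (real (fst k) * fst x + a) * cos (real (snd k) * snd x + b)))"

definition ss :: "int \<Rightarrow> int \<Rightarrow> real \<Rightarrow> real \<Rightarrow> rfun" where
  "ss m n a b = (\<lambda>x. sin (of_int m * fst x + a) * sin (of_int n * snd x + b))"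

lemma cc_waves:
  "cc c k a b = (\<lambda>x. (c / 2) * (wave (int (fst k)) (- int (snd k)) (a - b) x
     + wave (int (fst k)) (int (snd k)) (a + b) x))"
  by (auto simp: cc_def wave_def cos_times_cos algebra_simps)

lemma ss_waves:
  "ss m n a b = (\<lambda>x. (1 / 2) * (wave m (- n) (a - b) x + (- 1) * wave m n (a + b) x))"
  by (auto simp: ss_def wave_def sin_times_sin algebra_simps diff_divide_distrib)

lemma cc_trig: "cc c k a b \<in> trig"
  unfolding cc_waves by (intro trig.intros)

lemma ss_trig: "ss m n a b \<in> trig"
  unfolding ss_waves by (intro trig.intros)

lemma lnorm_sq: "(lnorm k)\<^sup>2 = (real (fst k))\<^sup>2 + (real (snd k))\<^sup>2"
  by (simp add: lnorm_def)

lemma lap_cc: "lap (cc c k a b) = (\<lambda>x. - (lnorm k)\<^sup>2 * cc c k a b x)"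
  unfolding cc_waves
  by (subst lap_cmult, intro trig.intros, subst lap_add, (intro trig.intros)+)
    (auto simp: lap_wave lnorm_sq field_simps)

lemma lap_ss: "lap (ss m n a b) = (\<lambda>x. - ((of_int m)\<^sup>2 + (of_int n)\<^sup>2) * ss m n a b x)"
  unfolding ss_waves
  by (subst lap_cmult, intro trig.intros, subst lap_add, (intro trig.intros)+,
      subst lap_cmult, intro trig.intros)
    (simp add: lap_wave algebra_simps)

lemma partials_cc:
  "d1 (cc c k a b) = (\<lambda>x. - c * real (fst k) * (sin (real (fst k) * fst x + a) * cos (real (snd k) * snd x + b)))"
  "d2 (cc c k a b) = (\<lambda>x. - c * real (snd k) * (cos (real (fst k) * fst x + a) * sin (real (snd k) * snd x + b)))"
  subgoal
    unfolding cc_def by (rule ext, rule d1_eqI) (auto intro!: derivative_eq_intros)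
  subgoal
    unfolding cc_def by (rule ext, rule d2_eqI) (auto intro!: derivative_eq_intros)
  done

lemma tint_cc_cc:
  "tint (\<lambda>x. cc c k a b x * cc c' l a' b' x)
   = c * c' * (integral {0..2 * pi} (\<lambda>t. cos (real (fst k) * t + a) * cos (real (fst l) * t + a'))
      * integral {0..2 * pi} (\<lambda>t. cos (real (snd k) * t + b) * cos (real (snd l) * t + b')))"
proof -
  have "(\<lambda>x. cc c k a b x * cc c' l a' b' x) = (\<lambda>x. c * c' *
      ((\<lambda>t. cos (real (fst k) * t + a) * cos (real (fst l) * t + a')) (fst x)
      * (\<lambda>t. cos (real (snd k) * t + b) * cos (real (snd l) * t + b')) (snd x)))"
    by (simp add: cc_def algebra_simps)
  then show ?thesis
    by (simp only: tint_cmult) (subst tint_prod; auto intro!: continuous_intros)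
qed

lemma ip_cc_cc: "ip (cc c k a b) (cc c' l a' b') = (lnorm k)\<^sup>2 * tint (\<lambda>x. cc c k a b x * cc c' l a' b' x)"
proof -
  have "ip (cc c k a b) (cc c' l a' b') = - tint (\<lambda>x. lap (cc c k a b) x * cc c' l a' b' x)"
    by (intro ip_lap cc_trig trig_C1per)
  then show ?thesis
    by (simp add: lap_cc mult.assoc)
qed

text \<open>The phases in the first variable for which the product of cosines changes sign under the
  involution.\<close>
definition kphase :: "nat \<Rightarrow> real \<Rightarrow> bool" where
  "kphase n a \<longleftrightarrow> odd n \<and> a = 0 \<or> even n \<and> a = - pi / 2"

lemma cc_ktrig:
  assumes "kphase (snd k) a"
  shows "cc c k a b \<in> ktrig"
proof -
  have 1: "cos (real (fst k) * (2 * pi - t) + a) = cos (real (fst k) * t - a)" for t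
  proof -
    have "real (fst k) * (2 * pi - t) + a = - (real (fst k) * t - a) + 2 * pi * of_int (int (fst k))"
      by (simp add: algebra_simps)
    then show ?thesis
      by (simp only: cos_int_shift cos_minus)
  qed
  have 2: "cos (real (snd k) * (pi + t) + b) = (- 1) ^ snd k * cos (real (snd k) * t + b)" for t
  proof -
    have "real (snd k) * (pi + t) + b = (real (snd k) * t + b) + real (snd k) * pi"
      by (simp add: algebra_simps)
    then show ?thesis
      by (simp only: cos_add cos_npi sin_npi) simp
  qed
  have 3: "(- 1) ^ snd k * cos (real (fst k) * t - a) = - cos (real (fst k) * t + a)" for t
    using assms by (auto simp: kphase_def cos_add cos_diff)
  have "cc c k a b (invI x) = c * (((- 1) ^ snd k * cos (real (fst k) * fst x - a))
      * cos (real (snd k) * snd x + b))" for x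
    by (simp add: cc_def invI_def 1 2)
  then have "antiinv (cc c k a b)"
    unfolding antiinv_def 3 by (simp add: cc_def)
  then show ?thesis
    using cc_trig by (simp add: ktrig_def)
qed

section \<open>The four Fourier modes of a bracket\<close>

locale modes =
  fixes c a1 a2 b1 b2 :: real and k l :: "nat \<times> nat"
begin

definition A where "A = (\<lambda>t. sin (of_int (int (fst k) + int (fst l)) * t + (a1 + b1)))"
definition A' where "A' = (\<lambda>t. sin (of_int (int (fst k) - int (fst l)) * t + (a1 - b1)))"
definition C where "C = (\<lambda>t. sin (of_int (int (snd k) + int (snd l)) * t + (a2 + b2)))"
definition C' where "C' = (\<lambda>t. sin (of_int (int (snd k) - int (snd l)) * t + (a2 - b2)))"

text \<open>The bracket, its Laplacian and its inverse Laplacian all lie in the span of these four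
  modes and differ only in the coefficients.\<close>

definition comb :: "real \<Rightarrow> real \<Rightarrow> real \<Rightarrow> real \<Rightarrow> rfun" where
  "comb x1 x2 x3 x4 = (\<lambda>x. x1 * (A (fst x) * C (snd x)) + x2 * (A (fst x) * C' (snd x))
     + x3 * (A' (fst x) * C (snd x)) + x4 * (A' (fst x) * C' (snd x)))"

abbreviation pair1 where "pair1 f g \<equiv> integral {0..2 * pi} (\<lambda>t. f t * g t :: real)"

definition \<alpha> where "\<alpha> = pair1 A A"
definition \<alpha>' where "\<alpha>' = pair1 A' A'"
definition \<alpha>0 where "\<alpha>0 = pair1 A A'"
definition \<gamma> where "\<gamma> = pair1 C C"
definition \<gamma>' where "\<gamma>' = pair1 C' C'"
definition \<gamma>0 where "\<gamma>0 = pair1 C C'"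

text \<open>Modes may coincide up to sign, for instance if \<open>k\<close> or \<open>l\<close> lies
  on an axis, hence the full Gram matrix with the mixed pairings \<open>\<alpha>0\<close> and
  \<open>\<gamma>0\<close>. By Fubini it factors through one-dimensional integrals.\<close>

lemma gram:
  "tint (\<lambda>x. comb x1 x2 x3 x4 x * comb y1 y2 y3 y4 x) =
     x1 * y1 * (\<alpha> * \<gamma>) + x2 * y2 * (\<alpha> * \<gamma>') + x3 * y3 * (\<alpha>' * \<gamma>) + x4 * y4 * (\<alpha>' * \<gamma>')
   + (x1 * y2 + x2 * y1) * (\<alpha> * \<gamma>0) + (x3 * y4 + x4 * y3) * (\<alpha>' * \<gamma>0)
   + (x1 * y3 + x3 * y1) * (\<alpha>0 * \<gamma>) + (x2 * y4 + x4 * y2) * (\<alpha>0 * \<gamma>')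
   + (x1 * y4 + x4 * y1 + x2 * y3 + x3 * y2) * (\<alpha>0 * \<gamma>0)"
proof -
  have cont: "continuous_on UNIV A" "continuous_on UNIV A'" "continuous_on UNIV C" "continuous_on UNIV C'"
    unfolding A_def A'_def C_def C'_def by (intro continuous_intros)+
  have h: "((\<lambda>x. (F (fst x) * F' (fst x)) * (G (snd x) * G' (snd x))) has_integral pair1 F F' * pair1 G G') torus_sq"
    if "continuous_on UNIV F" "continuous_on UNIV F'" "continuous_on UNIV G" "continuous_on UNIV G'" for F F' G G'
  proof -
    have "(\<lambda>x. (F (fst x) * F' (fst x)) * (G (snd x) * G' (snd x))) integrable_on torus_sq"
      by (intro integrable_torus continuous_intros continuous_on_compose2[OF that(1)]
          continuous_on_compose2[OF that(2)] continuous_on_compose2[OF that(3)]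
          continuous_on_compose2[OF that(4)]) auto
    then show ?thesis
      using tint_prod[of "\<lambda>t. F t * F' t" "\<lambda>t. G t * G' t"] that
      by (simp add: has_integral_integrable_integral continuous_on_mult)
  qed
  have eq: "(\<lambda>x. comb x1 x2 x3 x4 x * comb y1 y2 y3 y4 x) = (\<lambda>x.
      x1 * y1 * ((A (fst x) * A (fst x)) * (C (snd x) * C (snd x)))
    + x2 * y2 * ((A (fst x) * A (fst x)) * (C' (snd x) * C' (snd x)))
    + x3 * y3 * ((A' (fst x) * A' (fst x)) * (C (snd x) * C (snd x)))
    + x4 * y4 * ((A' (fst x) * A' (fst x)) * (C' (snd x) * C' (snd x)))
    + (x1 * y2 + x2 * y1) * ((A (fst x) * A (fst x)) * (C (snd x) * C' (snd x)))
    + (x3 * y4 + x4 * y3) * ((A' (fst x) * A' (fst x)) * (C (snd x) * C' (snd x)))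
    + (x1 * y3 + x3 * y1) * ((A (fst x) * A' (fst x)) * (C (snd x) * C (snd x)))
    + (x2 * y4 + x4 * y2) * ((A (fst x) * A' (fst x)) * (C' (snd x) * C' (snd x)))
    + (x1 * y4 + x4 * y1 + x2 * y3 + x3 * y2) * ((A (fst x) * A' (fst x)) * (C (snd x) * C' (snd x))))"
    unfolding comb_def by (rule ext) algebra
  show ?thesis
    unfolding eq \<alpha>_def \<alpha>'_def \<alpha>0_def \<gamma>_def \<gamma>'_def \<gamma>0_def
    by (intro integral_unique has_integral_add has_integral_mult_right h cont)
qed

lemma comb_ss:
  "comb x1 x2 x3 x4 = (\<lambda>x. x1 * ss (int (fst k) + int (fst l)) (int (snd k) + int (snd l)) (a1 + b1) (a2 + b2) x
     + x2 * ss (int (fst k) + int (fst l)) (int (snd k) - int (snd l)) (a1 + b1) (a2 - b2) x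
     + x3 * ss (int (fst k) - int (fst l)) (int (snd k) + int (snd l)) (a1 - b1) (a2 + b2) x
     + x4 * ss (int (fst k) - int (fst l)) (int (snd k) - int (snd l)) (a1 - b1) (a2 - b2) x)"
  by (simp add: comb_def ss_def A_def A'_def C_def C'_def)

lemma comb_trig: "comb x1 x2 x3 x4 \<in> trig"
  unfolding comb_ss by (intro trig_add trig_cmult ss_trig)

text \<open>\<open>s\<close> and \<open>D\<close> are the scalar and the cross product of
  \<open>k\<close> and \<open>l\<close>, \<open>s'\<close> and \<open>D'\<close> those of
  \<open>k\<close> with the reflected vector (l1, - l2); \<open>r1\<close> to \<open>r4\<close> are
  the squared lengths of the four frequencies, in the order used by \<open>comb\<close>.\<close>

definition p where "p = (lnorm k)\<^sup>2"
definition q where "q = (lnorm l)\<^sup>2"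
definition D where "D = real (snd k) * real (fst l) - real (fst k) * real (snd l)"
definition D' where "D' = real (snd k) * real (fst l) + real (fst k) * real (snd l)"
definition s where "s = real (fst k) * real (fst l) + real (snd k) * real (snd l)"
definition s' where "s' = real (fst k) * real (fst l) - real (snd k) * real (snd l)"
definition r1 where "r1 = p + q + 2 * s"
definition r2 where "r2 = p + q + 2 * s'"
definition r3 where "r3 = p + q - 2 * s'"
definition r4 where "r4 = p + q - 2 * s"

text \<open>Lagrange's identity for scalar and cross products.\<close>

lemma D_sq: "D\<^sup>2 = p * q - s\<^sup>2" "D'\<^sup>2 = p * q - s'\<^sup>2"
  unfolding D_def D'_def s_def s'_def p_def q_def lnorm_sq by algebra+

lemma lap_comb: "lap (comb x1 x2 x3 x4) = comb (- r1 * x1) (- r2 * x2) (- r3 * x3) (- r4 * x4)"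
proof -
  have r: "(of_int (int (fst k) + int (fst l)))\<^sup>2 + (of_int (int (snd k) + int (snd l)))\<^sup>2 = r1"
    "(of_int (int (fst k) + int (fst l)))\<^sup>2 + (of_int (int (snd k) - int (snd l)))\<^sup>2 = r2"
    "(of_int (int (fst k) - int (fst l)))\<^sup>2 + (of_int (int (snd k) + int (snd l)))\<^sup>2 = r3"
    "(of_int (int (fst k) - int (fst l)))\<^sup>2 + (of_int (int (snd k) - int (snd l)))\<^sup>2 = r4"
    unfolding r1_def r2_def r3_def r4_def p_def q_def s_def s'_def lnorm_sq
    by (simp_all add: power2_eq_square algebra_simps)
  have L: "lap (ss (int (fst k) + int (fst l)) (int (snd k) + int (snd l)) a b)
      = (\<lambda>x. - r1 * ss (int (fst k) + int (fst l)) (int (snd k) + int (snd l)) a b x)"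
    "lap (ss (int (fst k) + int (fst l)) (int (snd k) - int (snd l)) a b)
      = (\<lambda>x. - r2 * ss (int (fst k) + int (fst l)) (int (snd k) - int (snd l)) a b x)"
    "lap (ss (int (fst k) - int (fst l)) (int (snd k) + int (snd l)) a b)
      = (\<lambda>x. - r3 * ss (int (fst k) - int (fst l)) (int (snd k) + int (snd l)) a b x)"
    "lap (ss (int (fst k) - int (fst l)) (int (snd k) - int (snd l)) a b)
      = (\<lambda>x. - r4 * ss (int (fst k) - int (fst l)) (int (snd k) - int (snd l)) a b x)" for a b
    by (simp_all only: lap_ss r)
  show ?thesis
    unfolding comb_ss
    by (simp add: lap_add lap_cmult trig_add trig_cmult ss_trig L mult_ac)
qed

text \<open>The product-to-sum formulas give a factor 1/2 in each variable, which the amplitude 4 of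
  the basis functions cancels. The first and last mode, and likewise the two middle ones, get
  opposite amplitudes: these are the pairs with opposite \<sigma>.\<close>

lemma bracket_cc: "bracket (cc c k a1 a2) (cc 4 l b1 b2) = comb (c * D) (c * D') (- c * D') (- c * D)"
proof
  fix x
  define \<theta> \<theta>' \<eta> \<eta>' where "\<theta> = real (fst k) * fst x + a1" and "\<theta>' = real (fst l) * fst x + b1"
    and "\<eta> = real (snd k) * snd x + a2" and "\<eta>' = real (snd l) * snd x + b2"
  have eqs: "A (fst x) = sin (\<theta> + \<theta>')" "A' (fst x) = sin (\<theta> - \<theta>')"
    "C (snd x) = sin (\<eta> + \<eta>')" "C' (snd x) = sin (\<eta> - \<eta>')"
    by (simp_all add: A_def A'_def C_def C'_def \<theta>_def \<theta>'_def \<eta>_def \<eta>'_def algebra_simps)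
  have br: "bracket (cc c k a1 a2) (cc 4 l b1 b2) x
      = 4 * c * (real (snd k) * real (fst l) * (cos \<theta> * sin \<eta> * sin \<theta>' * cos \<eta>')
        - real (fst k) * real (snd l) * (sin \<theta> * cos \<eta> * cos \<theta>' * sin \<eta>'))"
    by (simp add: bracket_def partials_cc \<theta>_def \<theta>'_def \<eta>_def \<eta>'_def algebra_simps)
  show "bracket (cc c k a1 a2) (cc 4 l b1 b2) x = comb (c * D) (c * D') (- c * D') (- c * D) x"
    unfolding br comb_def eqs D_def D'_def sin_add sin_diff by algebra
qed

text \<open>On the left is the weight that \<open>curv_eigenfunctions\<close> gives to a mode of
  eigenvalue - r with r = P + 2 \<sigma>. Divide (p0 - q0)^2 = (r - 2 \<sigma>)^2 - 4 p0 q0 by 4 r: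
  the parts proportional to r cancel.\<close>

lemma mode_weight:
  assumes "P + 2 * \<sigma> \<noteq> (0::real)" "P = p0 + q0" "d = p0 * q0 - \<sigma>\<^sup>2"
  shows "- 3/4 * (P + 2 * \<sigma>) + P / 2 + (p0 - q0)\<^sup>2 / 4 / (P + 2 * \<sigma>) = - 2 * \<sigma> - d / (P + 2 * \<sigma>)"
proof -
  define r where "r = P + 2 * \<sigma>"
  have "(- 3/4 * r + P / 2) * (4 * r) + (p0 - q0)\<^sup>2 = - 2 * \<sigma> * (4 * r) - d * 4"
    unfolding r_def assms(2,3) by (simp add: field_simps power2_eq_square)
  then have "((- 3/4 * r + P / 2) * (4 * r) + (p0 - q0)\<^sup>2) / (4 * r) = (- 2 * \<sigma> * (4 * r) - d * 4) / (4 * r)"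
    by simp
  then show ?thesis
    using assms(1) unfolding r_def[symmetric] by (simp add: add_divide_distrib diff_divide_distrib)
qed

lemma gram_linear:
  "e1 * tint (\<lambda>x. comb x1 x2 x3 x4 x * comb y1 y2 y3 y4 x)
   + e2 * tint (\<lambda>x. comb x1 x2 x3 x4 x * comb z1 z2 z3 z4 x)
   + e3 * tint (\<lambda>x. comb x1 x2 x3 x4 x * comb w1 w2 w3 w4 x)
   = tint (\<lambda>x. comb x1 x2 x3 x4 x * comb (e1 * y1 + e2 * z1 + e3 * w1) (e1 * y2 + e2 * z2 + e3 * w2)
       (e1 * y3 + e2 * z3 + e3 * w3) (e1 * y4 + e2 * z4 + e3 * w4) x)"
  unfolding gram by (simp add: algebra_simps)

lemma gram_scale:
  "tint (\<lambda>x. comb (e * x1) (e * x2) (e * x3) (e * x4) x * comb y1 y2 y3 y4 x)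
   = tint (\<lambda>x. comb x1 x2 x3 x4 x * comb (e * y1) (e * y2) (e * y3) (e * y4) x)"
  unfolding gram by (simp add: algebra_simps)

text \<open>The amplitudes \<open>D, D', - D', - D\<close> meet weights in which \<sigma> is
  \<open>s, s', - s', - s\<close>; hence the signs disappear in the linear part and survive in the
  remainder.\<close>

lemma curvature:
  assumes "kphase (snd k) a1" "kphase (snd l) b1"
    and r: "r1 \<noteq> 0" "r2 \<noteq> 0" "r3 \<noteq> 0" "r4 \<noteq> 0"
  defines "u \<equiv> cc c k a1 a2" and "v \<equiv> cc 4 l b1 b2"
  shows "ip (curv u v u) v = - 2 * c\<^sup>2 * tint (\<lambda>x. comb D D' (- D') (- D) x * comb (s * D) (s' * D') (s' * D') (s * D) x)
     - c\<^sup>2 * tint (\<lambda>x. comb D D' (- D') (- D) x * comb (D^3 / r1) (D'^3 / r2) (- (D'^3 / r3)) (- (D^3 / r4)) x)"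
proof -
  let ?w = "comb (c * D) (c * D') (c * - D') (c * - D)"
  let ?g = "comb (c * D / r1) (c * D' / r2) (c * - D' / r3) (c * - D / r4)"
  have w: "bracket u v = ?w"
    by (simp add: u_def v_def bracket_cc)
  have lapg: "lap ?g = (\<lambda>x. - bracket u v x)"
    unfolding lap_comb w using r by (intro ext) (simp add: comb_def algebra_simps)
  have "ip (curv u v u) v = (3/4) * tint (\<lambda>x. ?w x * lap ?w x) + (p + q) / 2 * tint (\<lambda>x. ?w x * ?w x)
     + (p - q)\<^sup>2 / 4 * tint (\<lambda>x. ?w x * ?g x)"
    unfolding w[symmetric]
  proof (rule curv_eigenfunctions)
    show "u \<in> ktrig" "v \<in> ktrig" "lap u = (\<lambda>x. - p * u x)" "lap v = (\<lambda>x. - q * v x)"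
      unfolding u_def v_def p_def q_def using assms by (simp_all only: cc_ktrig lap_cc)
  qed (rule comb_trig lapg)+
  also have "\<dots> = tint (\<lambda>x. ?w x * comb
      (c * D * (- 3/4 * r1 + (p + q) / 2 + (p - q)\<^sup>2 / 4 / r1))
      (c * D' * (- 3/4 * r2 + (p + q) / 2 + (p - q)\<^sup>2 / 4 / r2))
      (c * - D' * (- 3/4 * r3 + (p + q) / 2 + (p - q)\<^sup>2 / 4 / r3))
      (c * - D * (- 3/4 * r4 + (p + q) / 2 + (p - q)\<^sup>2 / 4 / r4)) x)"
    unfolding lap_comb gram_linear
    by (intro arg_cong[of _ _ tint] ext arg_cong2[of _ _ _ _ "(*)"] refl)
      (simp add: comb_def algebra_simps)
  also have "- 3/4 * r1 + (p + q) / 2 + (p - q)\<^sup>2 / 4 / r1 = - 2 * s - D\<^sup>2 / r1"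
    using r mode_weight[of "p + q" s p q "D\<^sup>2"] by (simp add: r1_def D_sq)
  also have "- 3/4 * r2 + (p + q) / 2 + (p - q)\<^sup>2 / 4 / r2 = - 2 * s' - D'\<^sup>2 / r2"
    using r mode_weight[of "p + q" s' p q "D'\<^sup>2"] by (simp add: r2_def D_sq)
  also have "- 3/4 * r3 + (p + q) / 2 + (p - q)\<^sup>2 / 4 / r3 = 2 * s' - D'\<^sup>2 / r3"
    using r mode_weight[of "p + q" "- s'" p q "D'\<^sup>2"] by (simp add: r3_def D_sq)
  also have "- 3/4 * r4 + (p + q) / 2 + (p - q)\<^sup>2 / 4 / r4 = 2 * s - D\<^sup>2 / r4"
    using r mode_weight[of "p + q" "- s" p q "D\<^sup>2"] by (simp add: r4_def D_sq)
  finally have "ip (curv u v u) v = tint (\<lambda>x. comb D D' (- D') (- D) x * comb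
      (c * (c * D * (- 2 * s - D\<^sup>2 / r1))) (c * (c * D' * (- 2 * s' - D'\<^sup>2 / r2)))
      (c * (c * - D' * (2 * s' - D'\<^sup>2 / r3))) (c * (c * - D * (2 * s - D\<^sup>2 / r4))) x)"
    unfolding gram_scale .
  \<comment> \<open>\<open>gram_linear\<close> has three slots; the third is filled with the zero
    function.\<close>
  also have "\<dots> = (- 2 * c\<^sup>2) * tint (\<lambda>x. comb D D' (- D') (- D) x * comb (s * D) (s' * D') (s' * D') (s * D) x)
     + (- c\<^sup>2) * tint (\<lambda>x. comb D D' (- D') (- D) x * comb (D^3 / r1) (D'^3 / r2) (- (D'^3 / r3)) (- (D^3 / r4)) x)
     + 0 * tint (\<lambda>x. comb D D' (- D') (- D) x * comb 0 0 0 0 x)"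
    unfolding gram_linear
    by (intro arg_cong[of _ _ tint] ext arg_cong2[of _ _ _ _ "(*)"] refl)
      (simp add: comb_def power2_eq_square power3_eq_cube algebra_simps)
  finally show ?thesis
    by simp
qed

text \<open>Every summand carries a difference between norms at sum and at difference frequencies,
  so the linear part vanishes as soon as \<open>\<alpha> = \<alpha>'\<close> and
  \<open>\<gamma> = \<gamma>'\<close>.\<close>

lemma linear_term:
  "tint (\<lambda>x. comb D D' (- D') (- D) x * comb (s * D) (s' * D') (s' * D') (s * D) x)
   = s * D\<^sup>2 * (\<alpha> * \<gamma> - \<alpha>' * \<gamma>') + s' * D'\<^sup>2 * (\<alpha> * \<gamma>' - \<alpha>' * \<gamma>)
     + \<gamma>0 * (D * D' * (s + s')) * (\<alpha> - \<alpha>') - \<alpha>0 * (D * D' * (s - s')) * (\<gamma> - \<gamma>')"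
  unfolding gram by (simp add: power2_eq_square algebra_simps)

lemma norms_1: "fst k \<noteq> fst l \<Longrightarrow> \<alpha> = pi \<and> \<alpha>' = pi"
  unfolding \<alpha>_def \<alpha>'_def A_def A'_def integral_sin_sin by auto

lemma norms_2: "snd k \<noteq> snd l \<Longrightarrow> \<gamma> = pi \<and> \<gamma>' = pi"
  unfolding \<gamma>_def \<gamma>'_def C_def C'_def integral_sin_sin by auto

lemma pairing_bounds: "\<bar>\<alpha>\<bar> \<le> 2 * pi" "\<bar>\<alpha>'\<bar> \<le> 2 * pi" "\<bar>\<alpha>0\<bar> \<le> 2 * pi"
  "\<bar>\<gamma>\<bar> \<le> 2 * pi" "\<bar>\<gamma>'\<bar> \<le> 2 * pi" "\<bar>\<gamma>0\<bar> \<le> 2 * pi"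
proof -
  have *: "\<bar>pi * ((if P then cos x else 0) - (if Q then cos y else 0))\<bar> \<le> 2 * pi" for P Q x y
  proof -
    have "\<bar>(if P then cos x else 0) - (if Q then cos y else 0)\<bar> \<le> 2"
      using cos_ge_minus_one[of x] cos_le_one[of x] cos_ge_minus_one[of y] cos_le_one[of y]
      by (smt (verit))
    then show ?thesis
      by (simp add: abs_mult)
  qed
  show "\<bar>\<alpha>\<bar> \<le> 2 * pi" "\<bar>\<alpha>'\<bar> \<le> 2 * pi" "\<bar>\<alpha>0\<bar> \<le> 2 * pi"
    "\<bar>\<gamma>\<bar> \<le> 2 * pi" "\<bar>\<gamma>'\<bar> \<le> 2 * pi" "\<bar>\<gamma>0\<bar> \<le> 2 * pi"
    unfolding \<alpha>_def \<alpha>'_def \<alpha>0_def \<gamma>_def \<gamma>'_def \<gamma>0_def A_def A'_def C_def C'_def integral_sin_sin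
    by (rule *)+
qed

lemma pq_nonneg: "p \<ge> 0" "q \<ge> 0"
  by (simp_all add: p_def q_def)

lemma sq_bounds: "D\<^sup>2 \<le> p * q" "D'\<^sup>2 \<le> p * q" "s\<^sup>2 \<le> p * q" "s'\<^sup>2 \<le> p * q"
  using D_sq zero_le_power2[of s] zero_le_power2[of s'] zero_le_power2[of D] zero_le_power2[of D']
  by linarith+

lemma DD'_bound: "\<bar>D * D'\<bar> \<le> p * q"
proof -
  have "2 * \<bar>D * D'\<bar> \<le> D\<^sup>2 + D'\<^sup>2"
    using sum_squares_bound[of "\<bar>D\<bar>" "\<bar>D'\<bar>"] by (simp add: abs_mult)
  then show ?thesis
    using sq_bounds by linarith
qed

text \<open>Only l1 = k1 or l2 = k2 leaves anything. A single term such as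
  \<open>s * D\<^sup>2\<close> can grow like q^(3/2), but on these lines
  \<open>s * D\<^sup>2\<close> and \<open>s' * D'\<^sup>2\<close> combine so that the highest power
  of \<open>q\<close> cancels. A bound linear in \<open>q\<close> keeps the curvature bounded after
  division by the norms.\<close>

lemma linear_term_bound:
  assumes "k \<noteq> l"
  shows "\<bar>tint (\<lambda>x. comb D D' (- D') (- D) x * comb (s * D) (s' * D') (s' * D') (s * D) x)\<bar>
    \<le> 40 * pi\<^sup>2 * p\<^sup>2 * q"
proof -
  have kp: "(real (fst k))\<^sup>2 \<le> p" "(real (snd k))\<^sup>2 \<le> p" "(real (fst l))\<^sup>2 \<le> q" "(real (snd l))\<^sup>2 \<le> q"
    by (simp_all add: p_def q_def lnorm_sq)
  \<comment> \<open>Both exceptional lines have this shape, with the coordinates exchanged. The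
    constant is 4 pi from \<open>\<delta> - \<delta>'\<close> times (6 + 4) pi from the second
    factor.\<close>
  have main: "\<bar>(\<delta> - \<delta>') * (pi * X + \<omega> * (D * D' * (2 * y)))\<bar> \<le> 40 * pi\<^sup>2 * p\<^sup>2 * q"
    if "\<bar>\<delta>\<bar> \<le> 2 * pi" "\<bar>\<delta>'\<bar> \<le> 2 * pi" "\<bar>\<omega>\<bar> \<le> 2 * pi" "0 \<le> y" "y \<le> p"
      "X = y * (D\<^sup>2 + D'\<^sup>2) - 4 * (y * z * w)" "0 \<le> z" "z \<le> p" "0 \<le> w" "w \<le> q" for \<delta> \<delta>' \<omega> X y z w
  proof -
    have 1: "\<bar>X\<bar> \<le> 6 * p\<^sup>2 * q"
    proof -
      have "0 \<le> y * (D\<^sup>2 + D'\<^sup>2)"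
        using that by simp
      moreover have "y * (D\<^sup>2 + D'\<^sup>2) \<le> p * (2 * (p * q))"
        using that sq_bounds pq_nonneg by (intro mult_mono) auto
      moreover have "0 \<le> y * z * w"
        using that by simp
      moreover have "y * z * w \<le> p * p * q"
        using that pq_nonneg by (intro mult_mono) auto
      moreover have "p * (2 * (p * q)) = 2 * (p\<^sup>2 * q)" "p * p * q = p\<^sup>2 * q"
        by (simp_all add: power2_eq_square)
      ultimately show ?thesis
        unfolding that(6) by linarith
    qed
    have 2: "\<bar>\<omega> * (D * D' * (2 * y))\<bar> \<le> 2 * pi * ((p * q) * (2 * p))"
      unfolding abs_mult[of \<omega>] abs_mult[of "D * D'"]
      using that DD'_bound pq_nonneg by (intro mult_mono) auto
    have "\<bar>pi * X\<bar> \<le> pi * (6 * p\<^sup>2 * q)"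
      unfolding abs_mult using 1 by (intro mult_mono) auto
    moreover have "2 * pi * ((p * q) * (2 * p)) = 4 * (pi * (p\<^sup>2 * q))" "pi * (6 * p\<^sup>2 * q) = 6 * (pi * (p\<^sup>2 * q))"
      by (simp_all add: power2_eq_square)
    ultimately have "\<bar>pi * X + \<omega> * (D * D' * (2 * y))\<bar> \<le> 10 * (pi * (p\<^sup>2 * q))"
      using 2 abs_triangle_ineq[of "pi * X" "\<omega> * (D * D' * (2 * y))"] by linarith
    moreover have "\<bar>\<delta> - \<delta>'\<bar> \<le> 4 * pi"
      using that by linarith
    ultimately have "\<bar>\<delta> - \<delta>'\<bar> * \<bar>pi * X + \<omega> * (D * D' * (2 * y))\<bar> \<le> (4 * pi) * (10 * (pi * (p\<^sup>2 * q)))"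
      by (intro mult_mono) auto
    also have "\<dots> = 40 * pi\<^sup>2 * p\<^sup>2 * q"
      by (simp add: power2_eq_square)
    finally show ?thesis
      by (simp only: abs_mult)
  qed
  consider "fst k \<noteq> fst l" "snd k \<noteq> snd l" | "fst k = fst l" "snd k \<noteq> snd l" | "fst k \<noteq> fst l" "snd k = snd l"
    using assms by (auto simp: prod_eq_iff)
  then show ?thesis
  proof cases
    case 1
    then show ?thesis
      unfolding linear_term using norms_1 norms_2 pq_nonneg by simp
  next
    case 2
    have "s * D\<^sup>2 + s' * D'\<^sup>2 = (real (fst k))\<^sup>2 * (D\<^sup>2 + D'\<^sup>2)
        - 4 * ((real (fst k))\<^sup>2 * (real (snd k))\<^sup>2 * (real (snd l))\<^sup>2)"
    proof -
      have "(x * x + y * z) * (y * x - x * z)\<^sup>2 + (x * x - y * z) * (y * x + x * z)\<^sup>2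
          = x\<^sup>2 * ((y * x - x * z)\<^sup>2 + (y * x + x * z)\<^sup>2) - 4 * (x\<^sup>2 * y\<^sup>2 * z\<^sup>2)" for x y z :: real
        by algebra
      then show ?thesis
        unfolding s_def s'_def D_def D'_def 2(1) .
    qed
    moreover have "s + s' = 2 * (real (fst k))\<^sup>2"
      using 2(1) by (simp add: s_def s'_def power2_eq_square)
    moreover have "tint (\<lambda>x. comb D D' (- D') (- D) x * comb (s * D) (s' * D') (s' * D') (s * D) x)
        = (\<alpha> - \<alpha>') * (pi * (s * D\<^sup>2 + s' * D'\<^sup>2) + \<gamma>0 * (D * D' * (s + s')))"
      unfolding linear_term using norms_2[OF 2(2)] by (simp add: algebra_simps)
    ultimately show ?thesis
      using main[OF pairing_bounds(1,2,6), of "(real (fst k))\<^sup>2" _ "(real (snd k))\<^sup>2" "(real (snd l))\<^sup>2"] kp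
      by simp
  next
    case 3
    have "s * D\<^sup>2 - s' * D'\<^sup>2 = (real (snd k))\<^sup>2 * (D\<^sup>2 + D'\<^sup>2)
        - 4 * ((real (snd k))\<^sup>2 * (real (fst k))\<^sup>2 * (real (fst l))\<^sup>2)"
    proof -
      have "(x * z + y * y) * (y * z - x * y)\<^sup>2 - (x * z - y * y) * (y * z + x * y)\<^sup>2
          = y\<^sup>2 * ((y * z - x * y)\<^sup>2 + (y * z + x * y)\<^sup>2) - 4 * (y\<^sup>2 * x\<^sup>2 * z\<^sup>2)" for x y z :: real
        by algebra
      then show ?thesis
        unfolding s_def s'_def D_def D'_def 3(2) .
    qed
    moreover have "s - s' = 2 * (real (snd k))\<^sup>2"
      using 3(2) by (simp add: s_def s'_def power2_eq_square)
    moreover have "tint (\<lambda>x. comb D D' (- D') (- D) x * comb (s * D) (s' * D') (s' * D') (s * D) x)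
        = (\<gamma> - \<gamma>') * (pi * (s * D\<^sup>2 - s' * D'\<^sup>2) + (- \<alpha>0) * (D * D' * (s - s')))"
      unfolding linear_term using norms_1[OF 3(1)] by (simp add: algebra_simps)
    ultimately show ?thesis
      using main[OF pairing_bounds(4,5), of "- \<alpha>0" "(real (snd k))\<^sup>2" _ "(real (fst k))\<^sup>2" "(real (fst l))\<^sup>2"]
        pairing_bounds(3) kp
      by simp
  qed
qed

text \<open>\<open>4 * p < q\<close> says that |k| < |l| / 2, so the triangle inequality bounds the
  mode frequencies below by |l| / 2. The algebraic form with
  \<open>\<sigma>\<^sup>2 \<le> p * q\<close> serves all four modes.\<close>

lemma r_bound:
  assumes "4 * p < q" "\<sigma>\<^sup>2 \<le> p * q"
  shows "q / 4 \<le> p + q + 2 * \<sigma>"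
proof -
  have "0 \<le> (q / 4 - p) * (9 * q / 4 - p)"
    using assms pq_nonneg by (intro mult_nonneg_nonneg) auto
  moreover have "(p + 3 * q / 4)\<^sup>2 = (q / 4 - p) * (9 * q / 4 - p) + 4 * (p * q)"
    by (simp add: power2_eq_square field_simps)
  moreover have "(2 * \<bar>\<sigma>\<bar>)\<^sup>2 = 4 * \<sigma>\<^sup>2"
    by (simp add: power_mult_distrib)
  ultimately have "(2 * \<bar>\<sigma>\<bar>)\<^sup>2 \<le> (p + 3 * q / 4)\<^sup>2"
    using assms(2) by linarith
  then have "2 * \<bar>\<sigma>\<bar> \<le> p + 3 * q / 4"
    using pq_nonneg by (intro power2_le_imp_le[of "2 * \<bar>\<sigma>\<bar>"]) auto
  then show ?thesis
    by linarith
qed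

lemma r_bounds:
  assumes "4 * p < q"
  shows "q / 4 \<le> r1" "q / 4 \<le> r2" "q / 4 \<le> r3" "q / 4 \<le> r4"
  unfolding r1_def r2_def r3_def r4_def
  using r_bound[OF assms sq_bounds(3)] r_bound[OF assms sq_bounds(4)]
    r_bound[OF assms, of "- s"] r_bound[OF assms, of "- s'"] sq_bounds
  by simp_all

text \<open>\<open>m = sqrt (p * q)\<close> bounds \<open>D\<close> and \<open>D'\<close>, so the
  integrand is at most \<open>4 * m\<close> times \<open>16 * m^3 / q\<close>, that is
  \<open>64 * p^2 * q\<close>, and the torus has area \<open>4 * pi^2\<close>.\<close>

lemma remainder_bound:
  assumes "4 * p < q"
  shows "\<bar>tint (\<lambda>x. comb D D' (- D') (- D) x * comb (D^3 / r1) (D'^3 / r2) (- (D'^3 / r3)) (- (D^3 / r4)) x)\<bar>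
    \<le> 256 * pi\<^sup>2 * p\<^sup>2 * q"
proof -
  define m where "m = sqrt (p * q)"
  have q: "q > 0"
    using assms pq_nonneg by linarith
  have m: "m \<ge> 0" "m\<^sup>2 = p * q" "\<bar>D\<bar> \<le> m" "\<bar>D'\<bar> \<le> m"
    using pq_nonneg sq_bounds by (simp_all add: m_def real_le_rsqrt)
  have unit: "\<bar>A t\<bar> \<le> 1" "\<bar>A' t\<bar> \<le> 1" "\<bar>C t\<bar> \<le> 1" "\<bar>C' t\<bar> \<le> 1" for t
    by (simp_all add: A_def A'_def C_def C'_def)
  have comb_bound: "\<bar>comb x1 x2 x3 x4 x\<bar> \<le> 4 * M" if "\<bar>x1\<bar> \<le> M" "\<bar>x2\<bar> \<le> M" "\<bar>x3\<bar> \<le> M" "\<bar>x4\<bar> \<le> M"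
    for x1 x2 x3 x4 M x
  proof -
    have *: "\<bar>y * (F * G)\<bar> \<le> M" if "\<bar>y\<bar> \<le> M" "\<bar>F\<bar> \<le> 1" "\<bar>G\<bar> \<le> 1" for y F G :: real
    proof -
      have "\<bar>y\<bar> * (\<bar>F\<bar> * \<bar>G\<bar>) \<le> M * (1 * 1)"
        using that by (intro mult_mono) auto
      then show ?thesis
        by (simp add: abs_mult)
    qed
    show ?thesis
      using *[OF that(1) unit(1)[of "fst x"] unit(3)[of "snd x"]]
        *[OF that(2) unit(1)[of "fst x"] unit(4)[of "snd x"]]
        *[OF that(3) unit(2)[of "fst x"] unit(3)[of "snd x"]]
        *[OF that(4) unit(2)[of "fst x"] unit(4)[of "snd x"]]
      unfolding comb_def by linarith
  qed
  have cube: "\<bar>d^3 / r\<bar> \<le> m^3 * (4 / q)" if "\<bar>d\<bar> \<le> m" "q / 4 \<le> r" for d r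
  proof -
    have "\<bar>d^3\<bar> \<le> m^3"
      unfolding power_abs using that by (intro power_mono) auto
    moreover have "1 / \<bar>r\<bar> \<le> 4 / q"
      using that q by (simp add: field_simps)
    ultimately have "\<bar>d^3\<bar> * (1 / \<bar>r\<bar>) \<le> m^3 * (4 / q)"
      using m by (intro mult_mono) auto
    then show ?thesis
      by (simp add: abs_divide)
  qed
  note r = r_bounds[OF assms]
  have "\<bar>comb D D' (- D') (- D) x * comb (D^3 / r1) (D'^3 / r2) (- (D'^3 / r3)) (- (D^3 / r4)) x\<bar>
      \<le> 64 * (p\<^sup>2 * q)" for x
  proof -
    have "\<bar>comb D D' (- D') (- D) x\<bar> * \<bar>comb (D^3 / r1) (D'^3 / r2) (- (D'^3 / r3)) (- (D^3 / r4)) x\<bar>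
        \<le> (4 * m) * (4 * (m^3 * (4 / q)))"
      using m r cube by (intro mult_mono comb_bound) auto
    also have "\<dots> = 64 * ((m\<^sup>2)\<^sup>2 / q)"
      by (simp add: power2_eq_square power3_eq_cube)
    also have "\<dots> = 64 * (p\<^sup>2 * q)"
      unfolding m(2) using q by (simp add: power2_eq_square)
    finally show ?thesis
      by (simp add: abs_mult)
  qed
  then have "\<bar>tint (\<lambda>x. comb D D' (- D') (- D) x * comb (D^3 / r1) (D'^3 / r2) (- (D'^3 / r3)) (- (D^3 / r4)) x)\<bar>
      \<le> 4 * pi\<^sup>2 * (64 * (p\<^sup>2 * q))"
    by (intro tint_abs_le trig_continuous trig_mult comb_trig)
  then show ?thesis
    by (simp add: algebra_simps)
qed

end

section \<open>Sectional curvatures\<close>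

text \<open>A cosine factor of frequency 0 is constant; phase 0 makes it 1, so that the norm depends
  on nothing but \<open>k\<close> and the amplitude.\<close>

definition admissible :: "nat \<times> nat \<Rightarrow> real \<Rightarrow> real \<Rightarrow> bool" where
  "admissible k a b \<longleftrightarrow> kphase (snd k) a \<and> (fst k = 0 \<longrightarrow> a = 0) \<and> (snd k = 0 \<longrightarrow> b = 0) \<and> k \<noteq> (0, 0)"

text \<open>A constant factor has mean square 1 instead of 1/2.\<close>

definition axis_factor :: "nat \<times> nat \<Rightarrow> real" where
  "axis_factor k = (if fst k = 0 \<or> snd k = 0 then 2 else 1)"

lemma ip_cc_self:
  assumes "admissible k a b"
  shows "ip (cc c k a b) (cc c k a b) = (lnorm k)\<^sup>2 * (c\<^sup>2 * (axis_factor k * pi\<^sup>2))"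
proof -
  have "k \<noteq> (0, 0)" "fst k = 0 \<Longrightarrow> a = 0" "snd k = 0 \<Longrightarrow> b = 0"
    using assms by (auto simp: admissible_def)
  then show ?thesis
    unfolding ip_cc_cc tint_cc_cc integral_cos_cos axis_factor_def
    by (cases k) (auto simp: power2_eq_square)
qed

lemma ip_cc_orthogonal: "k \<noteq> l \<Longrightarrow> ip (cc c k a b) (cc c' l a' b') = 0"
  unfolding ip_cc_cc tint_cc_cc integral_cos_cos by (auto simp: prod_eq_iff)

lemma lnorm_pos: "k \<noteq> (0, 0) \<Longrightarrow> (lnorm k)\<^sup>2 > 0"
  unfolding lnorm_sq by (cases k) (auto simp: sum_power2_gt_zero_iff)

context modes
begin

text \<open>If \<open>k\<close> lies on an axis, the modes coincide in pairs up to sign and the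
  mixed Gram entries double the integral. The same factor occurs in the norm of the first function,
  so it cancels in the sectional curvature.\<close>

lemma remainder_exact:
  assumes "fst k < fst l" "snd k < snd l" "admissible k a1 a2"
  shows "tint (\<lambda>x. comb D D' (- D') (- D) x * comb (D^3 / r1) (D'^3 / r2) (- (D'^3 / r3)) (- (D^3 / r4)) x)
    = axis_factor k * pi\<^sup>2 * (D^4 * (1 / r1 + 1 / r4) + D'^4 * (1 / r2 + 1 / r3))"
proof -
  have n: "\<alpha> = pi" "\<alpha>' = pi" "\<gamma> = pi" "\<gamma>' = pi"
    using norms_1 norms_2 assms by auto
  have k: "k \<noteq> (0, 0)" "fst k = 0 \<Longrightarrow> a1 = 0" "snd k = 0 \<Longrightarrow> a2 = 0"
    using assms(3) by (auto simp: admissible_def)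
  \<comment> \<open>For k1 = 0 and \<open>a1 = 0\<close> one has \<open>A' = - A\<close>, hence the
    value \<open>- pi\<close>.\<close>
  have \<alpha>0: "\<alpha>0 = (if fst k = 0 then - pi else 0)"
    unfolding \<alpha>0_def A_def A'_def integral_sin_sin using assms(1) k(2) by auto
  have \<gamma>0: "\<gamma>0 = (if snd k = 0 then - pi else 0)"
    unfolding \<gamma>0_def C_def C'_def integral_sin_sin using assms(2) k(3) by auto
  consider "fst k \<noteq> 0" "snd k \<noteq> 0" | "fst k = 0" "snd k \<noteq> 0" | "fst k \<noteq> 0" "snd k = 0"
    using k(1) by (cases k) auto
  then show ?thesis
  proof cases
    case 1
    then show ?thesis
      unfolding gram n \<alpha>0 \<gamma>0
      by (simp add: axis_factor_def power2_eq_square power3_eq_cube power4_eq_xxxx algebra_simps)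
  next
    case 2
    have "D' = D" "s' = - s"
      using 2 by (simp_all add: D_def D'_def s_def s'_def)
    then have eq: "D' = D" "r2 = r4" "r3 = r1"
      by (simp_all add: r1_def r2_def r3_def r4_def)
    show ?thesis
      unfolding gram n \<alpha>0 \<gamma>0 eq using 2
      by (simp add: axis_factor_def power2_eq_square power3_eq_cube power4_eq_xxxx algebra_simps)
  next
    case 3
    have "D' = - D" "s' = s"
      using 3 by (simp_all add: D_def D'_def s_def s'_def)
    then have eq: "D' = - D" "r2 = r1" "r3 = r4"
      by (simp_all add: r1_def r2_def r3_def r4_def)
    show ?thesis
      unfolding gram n \<alpha>0 \<gamma>0 eq using 3
      by (simp add: axis_factor_def power2_eq_square power3_eq_cube power4_eq_xxxx algebra_simps)
  qed
qed

lemma r_pos: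
  assumes "4 * p < q"
  shows "r1 > 0" "r2 > 0" "r3 > 0" "r4 > 0"
  using r_bounds[OF assms] assms pq_nonneg by linarith+

text \<open>The strict inequalities keep the frequencies of \<open>k\<close> and \<open>l\<close>
  apart, which removes the linear part, and keep \<open>l\<close> off the axes, so its norm has no
  extra factor.\<close>

lemma sec_curv_exact:
  assumes adm: "admissible k a1 a2" "admissible l b1 b2" and c: "c \<noteq> 0"
    and lt: "fst k < fst l" "snd k < snd l" and pq: "4 * p < q"
  shows "sec_curv (cc c k a1 a2) (cc 4 l b1 b2)
    = - (D^4 * (1 / r1 + 1 / r4) + D'^4 * (1 / r2 + 1 / r3)) / (16 * p * q * pi\<^sup>2)"
proof -
  define X where "X = D^4 * (1 / r1 + 1 / r4) + D'^4 * (1 / r2 + 1 / r3)"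
  have kl: "k \<noteq> l"
    using lt by auto
  have phase: "kphase (snd k) a1" "kphase (snd l) b1"
    using adm by (auto simp: admissible_def)
  have p: "p > 0"
    using adm lnorm_pos by (simp add: p_def admissible_def)
  have q: "q > 0"
    using p pq by linarith
  have lin: "tint (\<lambda>x. comb D D' (- D') (- D) x * comb (s * D) (s' * D') (s' * D') (s * D) x) = 0"
    unfolding linear_term using norms_1 norms_2 lt by simp
  have "ip (curv (cc c k a1 a2) (cc 4 l b1 b2) (cc c k a1 a2)) (cc 4 l b1 b2)
      = - c\<^sup>2 * (axis_factor k * pi\<^sup>2 * X)"
    using curvature[OF phase] r_pos[OF pq] lin remainder_exact[OF lt adm(1)] by (simp add: X_def)
  moreover have "ip (cc c k a1 a2) (cc 4 l b1 b2) = 0"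
    by (rule ip_cc_orthogonal[OF kl])
  moreover have "ip (cc c k a1 a2) (cc c k a1 a2) = p * (c\<^sup>2 * (axis_factor k * pi\<^sup>2))"
    using ip_cc_self[OF adm(1)] by (simp add: p_def)
  moreover have "ip (cc 4 l b1 b2) (cc 4 l b1 b2) = q * (16 * pi\<^sup>2)"
    using ip_cc_self[OF adm(2)] lt by (simp add: q_def axis_factor_def)
  moreover have "axis_factor k \<noteq> 0"
    by (simp add: axis_factor_def)
  ultimately show ?thesis
    unfolding sec_curv_def X_def[symmetric] using p q c by (simp add: divide_simps)
qed

text \<open>The constant is 21 = (2 * 40 + 256) / 16, from the bounds of the linear part and of the
  remainder and from the squared amplitude of the basis function.\<close>

lemma sec_curv_bound:
  assumes adm: "admissible k a1 a2" "admissible l b1 b2" and c: "c \<noteq> 0" and pq: "4 * p < q"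
  shows "\<bar>sec_curv (cc c k a1 a2) (cc 4 l b1 b2)\<bar> \<le> 21 * p / pi\<^sup>2"
proof -
  have phase: "kphase (snd k) a1" "kphase (snd l) b1"
    using adm by (auto simp: admissible_def)
  have p: "p > 0"
    using adm lnorm_pos by (simp add: p_def admissible_def)
  have q: "q > 0"
    using p pq by linarith
  have kl: "k \<noteq> l"
    using p pq by (auto simp: p_def q_def)
  define L where "L = tint (\<lambda>x. comb D D' (- D') (- D) x * comb (s * D) (s' * D') (s' * D') (s * D) x)"
  define M where "M = tint (\<lambda>x. comb D D' (- D') (- D) x * comb (D^3 / r1) (D'^3 / r2) (- (D'^3 / r3)) (- (D^3 / r4)) x)"
  define N where "N = ip (curv (cc c k a1 a2) (cc 4 l b1 b2) (cc c k a1 a2)) (cc 4 l b1 b2)"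
  have "\<bar>L\<bar> \<le> 40 * pi\<^sup>2 * p\<^sup>2 * q" "\<bar>M\<bar> \<le> 256 * pi\<^sup>2 * p\<^sup>2 * q"
    unfolding L_def M_def by (rule linear_term_bound[OF kl] remainder_bound[OF pq])+
  then have "\<bar>2 * L + M\<bar> \<le> 336 * (pi\<^sup>2 * p\<^sup>2 * q)"
    by linarith
  moreover have "N = - (c\<^sup>2 * (2 * L + M))"
    unfolding N_def using curvature[OF phase] r_pos[OF pq] by (simp add: L_def M_def algebra_simps)
  ultimately have N: "\<bar>N\<bar> \<le> c\<^sup>2 * (336 * (pi\<^sup>2 * p\<^sup>2 * q))"
    by (simp add: abs_mult mult_left_mono)
  define den where "den = (p * (c\<^sup>2 * (axis_factor k * pi\<^sup>2))) * (q * (4\<^sup>2 * (axis_factor l * pi\<^sup>2)))"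
  have "(p * (c\<^sup>2 * (1 * pi\<^sup>2))) * (q * (4\<^sup>2 * (1 * pi\<^sup>2))) \<le> den"
    unfolding den_def using p q
    by (intro mult_mono mult_left_mono mult_nonneg_nonneg) (auto simp: axis_factor_def)
  then have den: "16 * p * q * c\<^sup>2 * pi^4 \<le> den"
    by (simp add: power2_eq_square power4_eq_xxxx algebra_simps)
  have pos: "16 * p * q * c\<^sup>2 * pi^4 > 0"
    using p q c by simp
  have "sec_curv (cc c k a1 a2) (cc 4 l b1 b2) = N / den"
    unfolding sec_curv_def N_def den_def
    by (simp add: ip_cc_orthogonal[OF kl] ip_cc_self[OF adm(1)] ip_cc_self[OF adm(2)] p_def q_def)
  then have "\<bar>sec_curv (cc c k a1 a2) (cc 4 l b1 b2)\<bar> = \<bar>N\<bar> / den"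
    using den pos by (simp add: abs_divide)
  also have "\<dots> \<le> (c\<^sup>2 * (336 * (pi\<^sup>2 * p\<^sup>2 * q))) / (16 * p * q * c\<^sup>2 * pi^4)"
    using N den pos p q by (intro frac_le) auto
  also have "\<dots> = 21 * p / pi\<^sup>2"
    using p q c by (simp add: field_simps power2_eq_square power4_eq_xxxx)
  finally show ?thesis .
qed

text \<open>The odd powers of l1 and l2 cancel between the two terms, which leaves the even quartic
  form that \<open>quartic_average\<close> handles.\<close>

lemma quartic_D: "D^4 + D'^4 = 2 * real (snd k)^4 * real (fst l)^4
    + 12 * (real (fst k))\<^sup>2 * (real (snd k))\<^sup>2 * ((real (fst l))\<^sup>2 * (real (snd l))\<^sup>2)
    + 2 * real (fst k)^4 * real (snd l)^4"
  unfolding D_def D'_def by algebra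

text \<open>Each of \<open>r1\<close> to \<open>r4\<close> differs from \<open>q\<close> by at most
  \<open>(p + 2 * lnorm k) * lnorm l\<close>, so replacing all four reciprocals in
  \<open>sec_curv_exact\<close> by \<open>1 / q\<close> costs a relative error O(1 / |l|).\<close>

lemma sec_curv_asymptotic:
  assumes adm: "admissible k a1 a2" "admissible l b1 b2" and c: "c \<noteq> 0"
    and lt: "fst k < fst l" "snd k < snd l" and pq: "4 * p < q"
  shows "\<bar>sec_curv (cc c k a1 a2) (cc 4 l b1 b2) - (- (D^4 + D'^4) / (8 * p * pi\<^sup>2) / q\<^sup>2)\<bar>
    \<le> p * (p + 2 * lnorm k) / lnorm l"
proof -
  define n where "n = lnorm l"
  have p: "p > 0"
    using adm lnorm_pos by (simp add: p_def admissible_def)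
  have q: "q > 0"
    using p pq by linarith
  have n2: "n\<^sup>2 = q"
    by (simp add: n_def q_def)
  have n1: "n \<ge> 1"
  proof -
    have "1 \<le> fst l"
      using lt by simp
    then have "1 \<le> (real (fst l))\<^sup>2"
      by simp
    then have "1\<^sup>2 \<le> (lnorm l)\<^sup>2"
      unfolding lnorm_sq one_power2 using zero_le_power2[of "real (snd l)"] by linarith
    then show ?thesis
      unfolding n_def by (rule power2_le_imp_le) (simp add: lnorm_def)
  qed
  have lk: "lnorm k \<ge> 0"
    by (simp add: lnorm_def)
  have inv: "\<bar>1 / (p + q + 2 * \<sigma>) - 1 / q\<bar> \<le> 4 * (p + 2 * lnorm k) * n / q\<^sup>2" if "\<sigma>\<^sup>2 \<le> p * q" for \<sigma>
  proof -
    define r where "r = p + q + 2 * \<sigma>"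
    have r: "q / 4 \<le> r"
      unfolding r_def by (rule r_bound[OF pq that])
    have "\<sigma>\<^sup>2 \<le> (lnorm k * n)\<^sup>2"
      using that by (simp add: power_mult_distrib n2 p_def)
    then have "\<bar>\<sigma>\<bar> \<le> lnorm k * n"
      using lk n1 by (simp add: abs_le_square_iff[symmetric])
    moreover have "p \<le> p * n"
      using p n1 by simp
    moreover have "(p + 2 * lnorm k) * n = p * n + 2 * (lnorm k * n)"
      by (simp add: algebra_simps)
    ultimately have "\<bar>q - r\<bar> \<le> (p + 2 * lnorm k) * n"
      using p unfolding r_def by linarith
    moreover have "1 / (r * q) \<le> 4 / q\<^sup>2"
    proof -
      have "q / 4 * q \<le> r * q"
        using r q by (intro mult_right_mono) auto
      then have "1 / (r * q) \<le> 1 / (q / 4 * q)"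
        using q by (intro divide_left_mono) auto
      then show ?thesis
        by (simp add: power2_eq_square)
    qed
    ultimately have "\<bar>q - r\<bar> * (1 / (r * q)) \<le> (p + 2 * lnorm k) * n * (4 / q\<^sup>2)"
      using r q p lk n1 by (intro mult_mono) auto
    moreover have "1 / r - 1 / q = (q - r) * (1 / (r * q))"
      using r q by (simp add: field_simps)
    ultimately show ?thesis
      using r q unfolding r_def[symmetric] by (simp add: abs_mult mult_ac)
  qed
  define E where "E = 4 * (p + 2 * lnorm k) * n / q\<^sup>2"
  have E: "E \<ge> 0"
    unfolding E_def using p lk n1 by simp
  have e: "\<bar>1 / r1 - 1 / q\<bar> \<le> E" "\<bar>1 / r2 - 1 / q\<bar> \<le> E" "\<bar>1 / r3 - 1 / q\<bar> \<le> E" "\<bar>1 / r4 - 1 / q\<bar> \<le> E"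
    unfolding r1_def r2_def r3_def r4_def E_def
    using inv[of s] inv[of s'] inv[of "- s"] inv[of "- s'"] sq_bounds by simp_all
  have D4: "D^4 \<le> (p * q)\<^sup>2" "D'^4 \<le> (p * q)\<^sup>2"
    using power_mono[OF sq_bounds(1), of 2] power_mono[OF sq_bounds(2), of 2]
    by (simp_all add: power_mult[symmetric])
  define Y where "Y = D^4 * ((1 / r1 - 1 / q) + (1 / r4 - 1 / q)) + D'^4 * ((1 / r2 - 1 / q) + (1 / r3 - 1 / q))"
  have "\<bar>D^4 * ((1 / r1 - 1 / q) + (1 / r4 - 1 / q))\<bar> \<le> (p * q)\<^sup>2 * (2 * E)"
    unfolding abs_mult using D4 e E by (intro mult_mono) auto
  moreover have "\<bar>D'^4 * ((1 / r2 - 1 / q) + (1 / r3 - 1 / q))\<bar> \<le> (p * q)\<^sup>2 * (2 * E)"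
    unfolding abs_mult using D4 e E by (intro mult_mono) auto
  ultimately have "\<bar>Y\<bar> \<le> (p * q)\<^sup>2 * (2 * E) + (p * q)\<^sup>2 * (2 * E)"
    unfolding Y_def by (intro order_trans[OF abs_triangle_ineq] add_mono)
  then have Y: "\<bar>Y\<bar> \<le> (p * q)\<^sup>2 * (4 * E)"
    by (simp add: mult_ac)
  have "sec_curv (cc c k a1 a2) (cc 4 l b1 b2) - (- (D^4 + D'^4) / (8 * p * pi\<^sup>2) / q\<^sup>2)
      = - Y / (16 * p * q * pi\<^sup>2)"
    unfolding sec_curv_exact[OF assms] Y_def using p q
    by (simp add: field_simps power2_eq_square)
  then have "\<bar>sec_curv (cc c k a1 a2) (cc 4 l b1 b2) - (- (D^4 + D'^4) / (8 * p * pi\<^sup>2) / q\<^sup>2)\<bar>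
      = \<bar>Y\<bar> / (16 * p * q * pi\<^sup>2)"
    using p q by (simp add: abs_divide abs_mult)
  also have "\<dots> \<le> ((p * q)\<^sup>2 * (4 * E)) / (16 * p * q * pi\<^sup>2)"
    using Y p q by (intro divide_right_mono) auto
  also have "\<dots> = p * (p + 2 * lnorm k) * n / q / pi\<^sup>2"
    unfolding E_def using p q by (simp add: field_simps power2_eq_square)
  also have "\<dots> = p * (p + 2 * lnorm k) / n / pi\<^sup>2"
    using n1 by (simp add: n2[symmetric] power2_eq_square)
  also have "\<dots> \<le> p * (p + 2 * lnorm k) / n"
  proof -
    have "1 \<le> pi\<^sup>2"
      using pi_gt3 by (intro one_le_power) simp
    moreover have "0 \<le> p * (p + 2 * lnorm k) / n"
      using p lk n1 by simp
    ultimately have "p * (p + 2 * lnorm k) / n / pi\<^sup>2 \<le> p * (p + 2 * lnorm k) / n / 1"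
      by (intro divide_left_mono) auto
    then show ?thesis
      by simp
  qed
  finally show ?thesis
    by (simp add: n_def)
qed

end

section \<open>Averaging over the basis\<close>

definition phase1 :: "nat \<Rightarrow> real" where
  "phase1 t = (if t = 0 \<or> t = 1 then 0 else - pi / 2)"

definition phase2 :: "nat \<Rightarrow> real" where
  "phase2 t = (if t = 0 \<or> t = 3 then 0 else - pi / 2)"

lemma cos_minus_half_pi: "cos (y + - pi / 2) = sin y"
  by (simp add: cos_diff)

lemma bvalid_less: "bvalid t l \<Longrightarrow> t < 4"
  by (auto simp: bvalid_def)

lemma bfun_cc: "t < 4 \<Longrightarrow> bfun t l = cc 4 l (phase1 t) (phase2 t)"
proof -
  assume "t < 4"
  then consider "t = 0" | "t = 1" | "t = 2" | "t = 3"
    by linarith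
  then show ?thesis
    by cases (simp_all add: bfun_def cc_def phase1_def phase2_def cos_diff mult.assoc)
qed

lemma admissible_phase: "bvalid t l \<Longrightarrow> admissible l (phase1 t) (phase2 t)"
  by (cases l) (auto simp: bvalid_def admissible_def kphase_def phase1_def phase2_def J_Re_def J_Im_def
      odd_pos elim!: evenE)

text \<open>The four exponentials collapse to 4 |a| cos (k1 x1) cos (k2 x2 + arg a) for odd k2 and
  to - 4 |a| sin (k1 x1) sin (k2 x2 + arg a) for even k2. In the even case k1 = 0 would make
  \<open>xi k a\<close> vanish.\<close>

lemma xi_cc:
  assumes "k \<noteq> (0, 0)" "xi k a \<noteq> (\<lambda>x. 0)"
  obtains c a1 a2 where "c \<noteq> 0" "admissible k a1 a2" "xi k a = cc c k a1 a2"
proof -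
  define X where "X = (\<lambda>x :: real \<times> real. real (fst k) * fst x)"
  define Y where "Y = (\<lambda>x :: real \<times> real. real (snd k) * snd x)"
  define s :: real where "s = (- 1) ^ (snd k + 1)"
  have xi: "xi k a x = 2 * (Re a * cos (X x + Y x) - Im a * sin (X x + Y x))
      + 2 * s * (Re a * cos (X x - Y x) + Im a * sin (X x - Y x))" for x
  proof -
    have e: "expk (m, n) x = cis (of_int m * fst x + of_int n * snd x)" for m n
      by (simp add: expk_def cis_conv_exp)
    have sc: "(- 1) ^ (snd k + 1) = complex_of_real s"
      by (simp add: s_def)
    have args: "of_int (int (fst k)) * fst x + of_int (int (snd k)) * snd x = X x + Y x"
      "of_int (- int (fst k)) * fst x + of_int (- int (snd k)) * snd x = - (X x + Y x)"
      "of_int (int (fst k)) * fst x + of_int (- int (snd k)) * snd x = X x - Y x"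
      "of_int (- int (fst k)) * fst x + of_int (int (snd k)) * snd x = - (X x - Y x)"
      by (simp_all add: X_def Y_def)
    show ?thesis
      unfolding xi_def Let_def e sc args by (simp add: distrib_left del: minus_add_distrib minus_diff_eq)
  qed
  define \<phi> where "\<phi> = Arg a"
  have polar: "Re a = cmod a * cos \<phi>" "Im a = cmod a * sin \<phi>"
    using rcis_cmod_Arg[of a] by (metis \<phi>_def Re_rcis Im_rcis)+
  show thesis
  proof (cases "odd (snd k)")
    case True
    then have "s = 1"
      by (simp add: s_def)
    then have "xi k a x = (4 * cmod a) * (cos (X x) * cos (Y x + \<phi>))" for x
      unfolding xi polar cos_add cos_diff sin_add sin_diff by (simp add: algebra_simps)
    then have eq: "xi k a = cc (4 * cmod a) k 0 \<phi>"
      by (auto simp: cc_def X_def Y_def)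
    moreover have "4 * cmod a \<noteq> 0"
      using assms(2) eq by (auto simp: cc_def)
    moreover have "admissible k 0 \<phi>"
      using True assms(1) by (auto simp: admissible_def kphase_def)
    ultimately show ?thesis
      using that by blast
  next
    case False
    then have "s = - 1"
      by (simp add: s_def)
    then have xi': "xi k a x = - 4 * sin (X x) * (Re a * sin (Y x) + Im a * cos (Y x))" for x
      unfolding xi cos_add cos_diff sin_add sin_diff by (simp add: algebra_simps)
    have k1: "fst k \<noteq> 0"
    proof
      assume "fst k = 0"
      then have "xi k a = (\<lambda>x. 0)"
        by (intro ext) (simp add: xi' X_def)
      then show False
        using assms(2) by contradiction
    qed
    show ?thesis
    proof (cases "snd k = 0")
      case True
      \<comment> \<open>For k2 = 0 \<open>admissible\<close> asks for second phase 0, so the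
        constant second factor goes into the amplitude.\<close>
      have eq: "xi k a = cc (- 4 * Im a) k (- pi / 2) 0"
        unfolding cc_def cos_minus_half_pi by (auto simp: xi' X_def Y_def True)
      moreover have "- 4 * Im a \<noteq> 0"
        using assms(2) eq by (auto simp: cc_def)
      moreover have "admissible k (- pi / 2) 0"
        using True k1 by (auto simp: admissible_def kphase_def)
      ultimately show ?thesis
        using that by blast
    next
      case k2: False
      have "xi k a x = (- 4 * cmod a) * (sin (X x) * sin (Y x + \<phi>))" for x
        unfolding xi' polar sin_add by (simp add: algebra_simps)
      then have eq: "xi k a = cc (- 4 * cmod a) k (- pi / 2) (\<phi> + - pi / 2)"
        unfolding cc_def add.assoc[symmetric] cos_minus_half_pi by (auto simp: X_def Y_def)
      moreover have "- 4 * cmod a \<noteq> 0"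
        using assms(2) eq by (auto simp: cc_def)
      moreover have "admissible k (- pi / 2) (\<phi> + - pi / 2)"
        using False k1 k2 assms(1) by (auto simp: admissible_def kphase_def)
      ultimately show ?thesis
        using that by blast
    qed
  qed
qed

lemma ip_bfun_pos:
  assumes "bvalid t l"
  shows "ip (bfun t l) (bfun t l) > 0"
proof -
  have adm: "admissible l (phase1 t) (phase2 t)"
    by (rule admissible_phase[OF assms])
  then have "(lnorm l)\<^sup>2 > 0"
    by (intro lnorm_pos) (simp add: admissible_def)
  moreover have "axis_factor l > 0"
    by (simp add: axis_factor_def)
  ultimately show ?thesis
    unfolding bfun_cc[OF bvalid_less[OF assms]] ip_cc_self[OF adm] by simp
qed

lemma ip_bfun_orthogonal:
  assumes "bvalid t l" "bvalid t' l'" "(t, l) \<noteq> (t', l')"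
  shows "ip (bfun t l) (bfun t' l') = 0"
proof (cases "l = l'")
  case False
  then show ?thesis
    using ip_cc_orthogonal bfun_cc bvalid_less assms by simp
next
  case True
  \<comment> \<open>For equal \<open>l\<close> the parity of l2 fixes the first phase, and the two
    types differ by a quarter period in the second; for l2 = 0 only one type is valid.\<close>
  have "snd l \<noteq> 0" "cos (phase2 t - phase2 t') = 0"
    using assms True by (cases l; auto simp: bvalid_def phase2_def J_Re_def J_Im_def)+
  then show ?thesis
    unfolding bfun_cc[OF bvalid_less[OF assms(1)]] bfun_cc[OF bvalid_less[OF assms(2)]]
      ip_cc_cc tint_cc_cc integral_cos_cos True by simp
qed

definition btypes :: "nat \<times> nat \<Rightarrow> nat set" where
  "btypes l = {t. bvalid t l}"

lemma btypes_subset: "btypes l \<subseteq> {..<4}"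
  by (auto simp: btypes_def dest: bvalid_less)

lemma finite_btypes: "finite (btypes l)"
  by (rule finite_subset[OF btypes_subset]) simp

lemma card_btypes_le: "card (btypes l) \<le> 4"
  using card_mono[OF _ btypes_subset, of l] by simp

lemma card_btypes:
  assumes "0 < fst l" "0 < snd l"
  shows "card (btypes l) = 2"
proof -
  have "btypes l = (if odd (snd l) then {0, 1} else {2, 3})"
    using assms by (cases l) (auto simp: btypes_def bvalid_def J_Re_def J_Im_def)
  then show ?thesis
    by simp
qed

definition bindex :: "nat \<Rightarrow> ((nat \<times> nat) \<times> nat) set" where
  "bindex R = Sigma (qball R) btypes"

text \<open>\<open>basis_R\<close> is a set of functions, so sums over indices require that
  different indices give different functions; orthogonality and positive norms ensure this.\<close>

lemma bij_bindex: "bij_betw (\<lambda>(l, t). bfun t l) (bindex R) (basis_R R)"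
proof (rule bij_betw_imageI)
  show "inj_on (\<lambda>(l, t). bfun t l) (bindex R)"
  proof (rule inj_onI)
    fix i j assume ij: "i \<in> bindex R" "j \<in> bindex R" "(\<lambda>(l, t). bfun t l) i = (\<lambda>(l, t). bfun t l) j"
    obtain l t l' t' where eq: "i = (l, t)" "j = (l', t')"
      by (meson surj_pair)
    have "bvalid t l" "bvalid t' l'" "bfun t l = bfun t' l'"
      using ij by (auto simp: eq bindex_def btypes_def)
    then have "(t, l) = (t', l')"
      using ip_bfun_orthogonal[of t l t' l'] ip_bfun_pos[of t l] by fastforce
    then show "i = j"
      by (simp add: eq)
  qed
  show "(\<lambda>(l, t). bfun t l) ` bindex R = basis_R R"
  proof (intro set_eqI iffI)
    fix E assume "E \<in> (\<lambda>(l, t). bfun t l) ` bindex R"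
    then obtain l t where "l \<in> qball R" "t \<in> btypes l" "E = bfun t l"
      unfolding bindex_def by auto
    then show "E \<in> basis_R R"
      unfolding basis_R_def btypes_def qball_def by blast
  next
    fix E assume "E \<in> basis_R R"
    then obtain l t where "(l, t) \<in> bindex R" "E = bfun t l"
      unfolding basis_R_def bindex_def btypes_def qball_def by blast
    then show "E \<in> (\<lambda>(l, t). bfun t l) ` bindex R"
      by (metis (mono_tags, lifting) case_prod_conv image_eqI)
  qed
qed

lemma strip_sum_tendsto_zero:
  fixes h :: "nat \<times> nat \<Rightarrow> real"
  assumes "\<And>l. \<bar>h l\<bar> \<le> M" "\<And>l. a < fst l \<Longrightarrow> b < snd l \<Longrightarrow> h l = 0"
  shows "(\<lambda>R. (\<Sum>l\<in>qball R. h l) / of_nat (R\<^sup>2)) \<longlonglongrightarrow> 0"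
proof (rule linear_over_square_tendsto_zero[of 1 _ "M * (2 * real (a + b + 2))"])
  fix R :: nat assume R: "R \<ge> 1"
  have M: "M \<ge> 0"
    using assms(1)[of "(0, 0)"] by linarith
  let ?S = "{l \<in> qball R. fst l \<le> a \<or> snd l \<le> b}"
  have "(\<Sum>l\<in>qball R. h l) = (\<Sum>l\<in>?S. h l)"
    using assms(2) finite_qball by (intro sum.mono_neutral_right) (auto simp: not_le)
  also have "norm \<dots> \<le> real (card ?S) * M"
    using assms(1) by (intro sum_norm_bound) auto
  also have "\<dots> \<le> (2 * real (a + b + 2) * real R) * M"
    using card_qball_strip[OF R, of a b] M by (intro mult_right_mono)
  finally show "norm (\<Sum>l\<in>qball R. h l) \<le> M * (2 * real (a + b + 2)) * real R"
    by (simp add: mult_ac)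
qed

theorem theorem4:
  fixes k :: "nat \<times> nat" and a :: complex
  assumes "k \<noteq> (0, 0)"
    and "xi k a \<noteq> (\<lambda>x. 0)"
  shows "ric_seq (xi k a) \<longlonglongrightarrow> - 3 * lnorm k ^ 2 / (8 * S_T)
         \<and> - 3 * lnorm k ^ 2 / (8 * S_T) = - 3 * lnorm k ^ 2 / (16 * S_K)"
proof
  show "- 3 * lnorm k ^ 2 / (8 * S_T) = - 3 * lnorm k ^ 2 / (16 * S_K)"
    by (simp add: S_K_def)
  obtain c a1 a2 where c: "c \<noteq> 0" and adm: "admissible k a1 a2" and xi: "xi k a = cc c k a1 a2"
    using xi_cc[OF assms] .
  define \<xi> where "\<xi> = xi k a"
  define P where "P = (lnorm k)\<^sup>2"
  define Rxi where "Rxi = {(\<lambda>x. d * \<xi> x) | d. True}"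
  \<comment> \<open>Basis elements proportional to \<xi> get the value 0, which allows sums over the
    whole index set.\<close>
  define sc where "sc = (\<lambda>(l, t). if bfun t l \<in> Rxi then 0 else sec_curv \<xi> (bfun t l))"
  \<comment> \<open>The main term of \<open>sec_curv_asymptotic\<close>, expanded by
    \<open>quartic_D\<close>.\<close>
  define lead where "lead = (\<lambda>l. - (2 * real (snd k)^4 * real (fst l)^4
    + 12 * (real (fst k))\<^sup>2 * (real (snd k))\<^sup>2 * ((real (fst l))\<^sup>2 * (real (snd l))\<^sup>2)
    + 2 * real (fst k)^4 * real (snd l)^4) / (8 * P * pi\<^sup>2) / ((lnorm l)\<^sup>2)\<^sup>2)"
  define \<kappa> where "\<kappa> = - 3 * P / (32 * pi\<^sup>2)"
  have P: "P > 0"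
    unfolding P_def by (rule lnorm_pos[OF assms(1)])
  have adm_b: "admissible l (phase1 t) (phase2 t)" "bfun t l = cc 4 l (phase1 t) (phase2 t)"
    if "t \<in> btypes l" for t l
    using that admissible_phase bfun_cc bvalid_less by (auto simp: btypes_def)
  \<comment> \<open>The condition \<open>4 * P < (lnorm l)\<^sup>2\<close> forces
    \<open>k \<noteq> l\<close>; the basis function is then orthogonal to \<xi> and cannot be a
    multiple of it.\<close>
  have sc_eq: "sc (l, t) = sec_curv (cc c k a1 a2) (cc 4 l (phase1 t) (phase2 t))"
    if "t \<in> btypes l" "4 * P < (lnorm l)\<^sup>2" for l t
  proof -
    have "k \<noteq> l"
      using that(2) P by (auto simp: P_def)
    have "bfun t l \<notin> Rxi"
    proof
      assume "bfun t l \<in> Rxi"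
      then obtain d where d: "bfun t l = (\<lambda>x. d * cc c k a1 a2 x)"
        by (auto simp: Rxi_def \<xi>_def xi)
      have "ip (bfun t l) (bfun t l) = d * ip (cc c k a1 a2) (bfun t l)"
        by (subst (1) d) (intro ip_cmult_left trig_C1per cc_trig)
      also have "\<dots> = 0"
        using ip_cc_orthogonal[OF \<open>k \<noteq> l\<close>] adm_b(2)[OF that(1)] by simp
      finally show False
        using ip_bfun_pos[of t l] that(1) by (simp add: btypes_def)
    qed
    then show ?thesis
      using adm_b(2)[OF that(1)] by (simp add: sc_def \<xi>_def xi)
  qed
  define T where "T = (\<lambda>l. \<Sum>t\<in>btypes l. sc (l, t))"
  define h where "h = (\<lambda>l. T l - 2 * lead l)"
  \<comment> \<open>In the strip the error is merely bounded, elsewhere it tends to 0. Small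
    \<open>l\<close> are not counted as bad: there are finitely many, which
    \<open>cesaro_square_tendsto_zero\<close> tolerates.\<close>
  define bad where "bad = (\<lambda>l. (fst l \<le> fst k \<or> snd l \<le> snd k) \<and> 4 * P < (lnorm l)\<^sup>2)"
  have lead_eq: "lead l = - (modes.D k l^4 + modes.D' k l^4) / (8 * modes.p k * pi\<^sup>2) / (modes.q l)\<^sup>2" for l
  proof -
    \<comment> \<open>The quantities in this equation depend on \<open>k\<close> and
      \<open>l\<close> alone; the phases 0 are placeholders.\<close>
    interpret modes c a1 a2 0 0 k l .
    show ?thesis
      unfolding quartic_D lead_def P_def modes.p_def modes.q_def by simp
  qed
  have h_generic: "\<bar>h l\<bar> \<le> 2 * (P * (P + 2 * lnorm k)) / lnorm l"
    if lt: "fst k < fst l" "snd k < snd l" "4 * P < (lnorm l)\<^sup>2" for l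
  proof -
    have *: "\<bar>sc (l, t) - lead l\<bar> \<le> P * (P + 2 * lnorm k) / lnorm l" if t: "t \<in> btypes l" for t
    proof -
      interpret modes c a1 a2 "phase1 t" "phase2 t" k l .
      have pq: "P = modes.p k" "(lnorm l)\<^sup>2 = modes.q l"
        by (simp_all add: P_def modes.p_def modes.q_def)
      show ?thesis
        unfolding sc_eq[OF t lt(3)] lead_eq pq(1)
        using sec_curv_asymptotic[OF adm adm_b(1)[OF t] c lt(1,2)] lt(3)
        by (simp add: pq)
    qed
    have card: "card (btypes l) = 2"
      using lt by (intro card_btypes) auto
    have "h l = (\<Sum>t\<in>btypes l. sc (l, t) - lead l)"
      by (simp add: h_def T_def sum_subtractf card)
    also have "\<bar>\<dots>\<bar> \<le> real (card (btypes l)) * (P * (P + 2 * lnorm k) / lnorm l)"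
      unfolding real_norm_def[symmetric] using * by (intro sum_norm_bound) auto
    finally show ?thesis
      by (simp add: card)
  qed
  have h_bad: "\<bar>h l\<bar> \<le> 4 * (21 * P / pi\<^sup>2) + 2 * (P / (4 * pi\<^sup>2))" if "bad l" for l
  proof -
    have pos: "(lnorm l)\<^sup>2 > 0"
      using that P unfolding bad_def by linarith
    have "\<bar>sc (l, t)\<bar> \<le> 21 * P / pi\<^sup>2" if t: "t \<in> btypes l" for t
    proof -
      interpret modes c a1 a2 "phase1 t" "phase2 t" k l .
      show ?thesis
        using sec_curv_bound[OF adm adm_b(1)[OF t] c] sc_eq[OF t] \<open>bad l\<close>
        by (simp add: bad_def P_def modes.p_def modes.q_def)
    qed
    then have "\<bar>T l\<bar> \<le> real (card (btypes l)) * (21 * P / pi\<^sup>2)"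
      unfolding T_def real_norm_def[symmetric] by (intro sum_norm_bound) auto
    also have "\<dots> \<le> 4 * (21 * P / pi\<^sup>2)"
      using card_btypes_le[of l] P by (intro mult_right_mono) auto
    finally have "\<bar>T l\<bar> \<le> 4 * (21 * P / pi\<^sup>2)" .
    moreover have "\<bar>lead l\<bar> \<le> P / (4 * pi\<^sup>2)"
    proof -
      interpret modes c a1 a2 0 0 k l .
      have pq: "modes.p k = P" "modes.q l = (lnorm l)\<^sup>2"
        by (simp_all add: P_def modes.p_def modes.q_def)
      have "D^4 \<le> (P * (lnorm l)\<^sup>2)\<^sup>2" "D'^4 \<le> (P * (lnorm l)\<^sup>2)\<^sup>2"
        using power_mono[OF sq_bounds(1), of 2] power_mono[OF sq_bounds(2), of 2]
        by (simp_all add: power_mult[symmetric] pq)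
      then have "\<bar>D^4 + D'^4\<bar> \<le> 2 * (P * (lnorm l)\<^sup>2)\<^sup>2"
        by simp
      then have "\<bar>D^4 + D'^4\<bar> / (8 * P * pi\<^sup>2) / ((lnorm l)\<^sup>2)\<^sup>2
          \<le> (2 * (P * (lnorm l)\<^sup>2)\<^sup>2) / (8 * P * pi\<^sup>2) / ((lnorm l)\<^sup>2)\<^sup>2"
        using P by (intro divide_right_mono) auto
      also have "\<dots> = P / (4 * pi\<^sup>2)"
        using P pos by (auto simp: field_simps power2_eq_square)
      finally have "\<bar>D^4 + D'^4\<bar> / (8 * P * pi\<^sup>2) / ((lnorm l)\<^sup>2)\<^sup>2 \<le> P / (4 * pi\<^sup>2)" .
      moreover have "\<bar>- (D^4 + D'^4) / (8 * P * pi\<^sup>2) / ((lnorm l)\<^sup>2)\<^sup>2\<bar>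
          = \<bar>D^4 + D'^4\<bar> / (8 * P * pi\<^sup>2) / ((lnorm l)\<^sup>2)\<^sup>2"
      proof -
        have "\<bar>- X / d / e\<bar> = \<bar>X\<bar> / d / e" if "d \<ge> 0" "e \<ge> 0" for X d e :: real
          using that by (simp add: abs_divide)
        then show ?thesis
          using P by (metis mult_nonneg_nonneg less_imp_le zero_le_numeral zero_le_power2)
      qed
      ultimately show ?thesis
        unfolding lead_eq pq by (simp only:)
    qed
    ultimately show ?thesis
      unfolding h_def by linarith
  qed
  have hA: "(\<lambda>R. (\<Sum>l\<in>qball R. if bad l then 0 else h l) / of_nat (R\<^sup>2)) \<longlonglongrightarrow> 0"
  proof (rule cesaro_square_tendsto_zero[OF finite_qball card_qball_le])
    fix \<epsilon> :: real assume \<epsilon>: "\<epsilon> > 0"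
    define K where "K = 2 * (P * (P + 2 * lnorm k))"
    \<comment> \<open>Outside \<open>qball N\<close> both \<open>4 * P < (lnorm l)\<^sup>2\<close>
      and \<open>K / lnorm l \<le> \<epsilon>\<close> hold.\<close>
    obtain N :: nat where N: "max (4 * P + 1) (K / \<epsilon>) \<le> real N"
      using real_arch_simple by blast
    have "{l. \<epsilon> < norm (if bad l then 0 else h l)} \<subseteq> qball N"
    proof
      fix l assume "l \<in> {l. \<epsilon> < norm (if bad l then 0 else h l)}"
      then have l: "\<not> bad l" "\<epsilon> < \<bar>h l\<bar>"
        using \<epsilon> by (auto split: if_splits)
      have n0: "lnorm l \<ge> 0"
        by (simp add: lnorm_def)
      show "l \<in> qball N"
      proof (cases "4 * P < (lnorm l)\<^sup>2")
        case True
        then have "\<epsilon> < K / lnorm l"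
          using l h_generic[of l] by (auto simp: bad_def K_def not_le)
        moreover have "lnorm l > 0"
          using True P n0 by (cases "lnorm l = 0") auto
        ultimately have "lnorm l < K / \<epsilon>"
          using \<epsilon> by (simp add: field_simps)
        then show ?thesis
          using N by (simp add: qball_def)
      next
        case False
        have "4 * P \<le> (4 * P + 1)\<^sup>2"
          using P by (simp add: power2_eq_square algebra_simps)
        then have "(lnorm l)\<^sup>2 \<le> (4 * P + 1)\<^sup>2"
          using False by linarith
        then have "lnorm l \<le> 4 * P + 1"
          by (rule power2_le_imp_le) (use P in simp)
        then show ?thesis
          using N by (simp add: qball_def)
      qed
    qed
    then show "finite {l. \<epsilon> < norm (if bad l then 0 else h l)}"
      by (rule finite_subset) (rule finite_qball)
  qed
  have hB: "(\<lambda>R. (\<Sum>l\<in>qball R. if bad l then h l else 0) / of_nat (R\<^sup>2)) \<longlonglongrightarrow> 0"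
    by (rule strip_sum_tendsto_zero[of _ "4 * (21 * P / pi\<^sup>2) + 2 * (P / (4 * pi\<^sup>2))" "fst k" "snd k"])
      (use h_bad P in \<open>auto simp: bad_def\<close>)
  have hV: "(\<lambda>R. (\<Sum>l\<in>qball R. real (card (btypes l)) - 2) / of_nat (R\<^sup>2)) \<longlonglongrightarrow> 0"
  proof (rule strip_sum_tendsto_zero[of _ 2 0 0])
    show "\<bar>real (card (btypes l)) - 2\<bar> \<le> 2" for l
      using card_btypes_le[of l] by simp
  qed (simp add: card_btypes)
  have lead_avg: "(\<lambda>R. (\<Sum>l\<in>qball R. lead l - \<kappa>) / of_nat (R\<^sup>2)) \<longlonglongrightarrow> 0"
  proof -
    define A B E where "A = - (2 * real (snd k)^4) / (8 * P * pi\<^sup>2)"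
      and "B = - (12 * (real (fst k))\<^sup>2 * (real (snd k))\<^sup>2) / (8 * P * pi\<^sup>2)"
      and "E = - (2 * real (fst k)^4) / (8 * P * pi\<^sup>2)"
    have "lead l = (A * real (fst l)^4 + B * ((real (fst l))\<^sup>2 * (real (snd l))\<^sup>2) + E * real (snd l)^4)
        / ((real (fst l))\<^sup>2 + (real (snd l))\<^sup>2)\<^sup>2" for l
      unfolding lead_def A_def B_def E_def lnorm_sq
      by (simp add: add_divide_distrib diff_divide_distrib mult_ac)
    moreover have "(3 * A + B + 3 * E) / 8 = \<kappa>"
    proof -
      \<comment> \<open>The weights 3, 1, 3 produce the perfect square (k1^2 + k2^2)^2, so the mean
        depends on the length of \<open>k\<close> but not on its direction.\<close>
      have "(3 * A + B + 3 * E) / 8 = - (6 * (real (snd k)^4 + 2 * (real (fst k))\<^sup>2 * (real (snd k))\<^sup>2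
          + real (fst k)^4)) / (64 * P * pi\<^sup>2)"
        unfolding A_def B_def E_def using P by (simp add: field_simps)
      also have "real (snd k)^4 + 2 * (real (fst k))\<^sup>2 * (real (snd k))\<^sup>2 + real (fst k)^4 = P\<^sup>2"
        unfolding P_def lnorm_sq by algebra
      finally show ?thesis
        using P by (simp add: \<kappa>_def field_simps power2_eq_square)
    qed
    ultimately show ?thesis
      using quartic_average[of A B E] by simp
  qed
  define n where "n = (\<lambda>R. real (card (basis_R R)))"
  define S where "S = (\<lambda>R. \<Sum>E \<in> basis_R R - Rxi. sec_curv \<xi> E)"
  have n_eq: "n R = (\<Sum>l\<in>qball R. real (card (btypes l)))" for R
  proof -
    have "card (basis_R R) = card (bindex R)"
      using bij_betw_same_card[OF bij_bindex] by simp
    then show ?thesis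
      unfolding n_def bindex_def by (simp add: card_SigmaI finite_qball finite_btypes)
  qed
  have fin: "finite (basis_R R)" for R
    using bij_betw_finite[OF bij_bindex[of R]] by (simp add: bindex_def finite_qball finite_btypes)
  have S_eq: "S R = (\<Sum>l\<in>qball R. T l)" for R
  proof -
    have "S R = (\<Sum>E\<in>basis_R R. if E \<in> Rxi then 0 else sec_curv \<xi> E)"
      unfolding S_def using fin by (intro sum.mono_neutral_cong_left) auto
    also have "\<dots> = (\<Sum>x\<in>bindex R. if (\<lambda>(l, t). bfun t l) x \<in> Rxi then 0 else sec_curv \<xi> ((\<lambda>(l, t). bfun t l) x))"
      by (rule sum.reindex_bij_betw[OF bij_bindex, symmetric])
    also have "\<dots> = (\<Sum>(l, t)\<in>bindex R. sc (l, t))"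
      by (intro sum.cong) (auto simp: sc_def)
    also have "\<dots> = (\<Sum>l\<in>qball R. T l)"
      unfolding bindex_def T_def using finite_qball finite_btypes by (intro sum.Sigma[symmetric]) auto
    finally show ?thesis .
  qed
  define x where "x = (\<lambda>R. S R - \<kappa> * (n R - 1))"
  have x_lim: "(\<lambda>R. x R / of_nat (R\<^sup>2)) \<longlonglongrightarrow> 0"
  proof -
    \<comment> \<open>Two basis functions per index are typical; the last sum corrects the count on
      the axes, and the final \<open>\<kappa>\<close> accounts for the 1 subtracted from the
      cardinality.\<close>
    have "x R = 2 * (\<Sum>l\<in>qball R. lead l - \<kappa>) + (\<Sum>l\<in>qball R. if bad l then 0 else h l)
        + (\<Sum>l\<in>qball R. if bad l then h l else 0) - \<kappa> * (\<Sum>l\<in>qball R. real (card (btypes l)) - 2) + \<kappa>" for R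
    proof -
      have "(\<Sum>l\<in>qball R. if bad l then 0 else h l) + (\<Sum>l\<in>qball R. if bad l then h l else 0)
          = (\<Sum>l\<in>qball R. h l)"
        unfolding sum.distrib[symmetric] by (intro sum.cong) auto
      moreover have "(\<Sum>l\<in>qball R. h l) = (\<Sum>l\<in>qball R. T l) - 2 * (\<Sum>l\<in>qball R. lead l)"
        by (simp add: h_def sum_subtractf sum_distrib_left)
      ultimately show ?thesis
        unfolding x_def S_eq n_eq by (simp add: sum_subtractf algebra_simps)
    qed
    then have "(\<lambda>R. x R / of_nat (R\<^sup>2)) = (\<lambda>R. 2 * ((\<Sum>l\<in>qball R. lead l - \<kappa>) / of_nat (R\<^sup>2))
        + (\<Sum>l\<in>qball R. if bad l then 0 else h l) / of_nat (R\<^sup>2)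
        + (\<Sum>l\<in>qball R. if bad l then h l else 0) / of_nat (R\<^sup>2)
        - \<kappa> * ((\<Sum>l\<in>qball R. real (card (btypes l)) - 2) / of_nat (R\<^sup>2)) + \<kappa> / of_nat (R\<^sup>2))"
      by (simp add: add_divide_distrib diff_divide_distrib)
    moreover have "(\<lambda>R. \<kappa> / of_nat (R\<^sup>2)) \<longlonglongrightarrow> 0"
    proof (rule linear_over_square_tendsto_zero[of 1 _ "\<bar>\<kappa>\<bar>"])
      show "norm \<kappa> \<le> \<bar>\<kappa>\<bar> * real R" if "R \<ge> 1" for R
        using that by (simp add: mult_le_cancel_left1)
    qed
    then have "(\<lambda>R. 2 * ((\<Sum>l\<in>qball R. lead l - \<kappa>) / of_nat (R\<^sup>2))
        + (\<Sum>l\<in>qball R. if bad l then 0 else h l) / of_nat (R\<^sup>2)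
        + (\<Sum>l\<in>qball R. if bad l then h l else 0) / of_nat (R\<^sup>2)
        - \<kappa> * ((\<Sum>l\<in>qball R. real (card (btypes l)) - 2) / of_nat (R\<^sup>2)) + \<kappa> / of_nat (R\<^sup>2))
        \<longlonglongrightarrow> 2 * 0 + 0 + 0 - \<kappa> * 0 + 0"
      by (intro tendsto_add tendsto_diff tendsto_mult_left lead_avg hA hB hV)
    ultimately show ?thesis
      by simp
  qed
  \<comment> \<open>Two functions for each of at least R^2 / 4 indices give R^2 / 2; the error of
    this count takes at most R^2 / 4, and for R at least 4 the subtracted 1 is at most R^2 /
    8.\<close>
  have n_large: "\<forall>\<^sub>F R in sequentially. n R - 1 \<ge> (real R)\<^sup>2 / 8"
  proof -
    have "\<forall>\<^sub>F R in sequentially. \<bar>(\<Sum>l\<in>qball R. real (card (btypes l)) - 2) / of_nat (R\<^sup>2)\<bar> < 1 / 4"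
      using tendstoD[OF hV, of "1/4"] by (simp add: dist_real_def)
    then show ?thesis
      using eventually_ge_at_top[of 4]
    proof eventually_elim
      case (elim R)
      define y where "y = (\<Sum>l\<in>qball R. real (card (btypes l)) - 2)"
      have R: "(real R)\<^sup>2 \<ge> 4\<^sup>2"
        using elim(2) by (intro power_mono) auto
      have "\<bar>y\<bar> / (real R)\<^sup>2 < 1 / 4"
        using elim(1) by (simp add: y_def abs_divide)
      moreover have "(real R)\<^sup>2 > 0"
        using elim(2) by simp
      ultimately have "\<bar>y\<bar> < 1 / 4 * (real R)\<^sup>2"
        by (simp only: pos_divide_less_eq)
      moreover have "n R = y + 2 * real (card (qball R))"
        by (simp add: n_eq y_def sum_subtractf)
      ultimately show ?case
        using card_qball_ge[of R] R by simp
    qed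
  qed
  have "(\<lambda>R. S R / (n R - 1) - \<kappa>) \<longlonglongrightarrow> 0"
  proof (rule Lim_null_comparison)
    show "(\<lambda>R. 8 * \<bar>x R / of_nat (R\<^sup>2)\<bar>) \<longlonglongrightarrow> 0"
      using tendsto_mult_left[OF tendsto_rabs_zero[OF x_lim], of 8] by simp
    show "\<forall>\<^sub>F R in sequentially. norm (S R / (n R - 1) - \<kappa>) \<le> 8 * \<bar>x R / of_nat (R\<^sup>2)\<bar>"
      using n_large eventually_gt_at_top[of 0]
    proof eventually_elim
      case (elim R)
      have R: "(real R)\<^sup>2 > 0"
        using elim(2) by simp
      then have pos: "n R - 1 > 0"
        using elim(1) by linarith
      then have "S R / (n R - 1) - \<kappa> = x R / (n R - 1)"
        by (simp add: x_def field_simps)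
      then have "norm (S R / (n R - 1) - \<kappa>) = \<bar>x R\<bar> / (n R - 1)"
        using pos by (simp add: abs_divide)
      also have "\<dots> \<le> \<bar>x R\<bar> / ((real R)\<^sup>2 / 8)"
        using elim(1) R pos by (intro divide_left_mono mult_pos_pos) auto
      finally show ?case
        by (simp add: abs_divide mult.commute)
    qed
  qed
  then have "(\<lambda>R. S R / (n R - 1)) \<longlonglongrightarrow> \<kappa>"
    by (rule LIM_zero_cancel)
  moreover have "ric_seq (xi k a) = (\<lambda>R. S R / (n R - 1))"
    by (auto simp: ric_seq_def S_def n_def Rxi_def \<xi>_def)
  moreover have "\<kappa> = - 3 * lnorm k ^ 2 / (8 * S_T)"
    by (simp add: \<kappa>_def P_def S_T_def)
  ultimately show "ric_seq (xi k a) \<longlonglongrightarrow> - 3 * lnorm k ^ 2 / (8 * S_T)"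
    by simp
qed

end
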